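(* Let $n$ be the dimension and $0<\lambda\le\Lambda$. There is a constant $c>0$, depending only on $n,\lambda,\Lambda$ (in particular independent of $u$ and $f$), such that the following holds. Let $A$ be a symmetric measurable matrix field satisfying $\lambda|\xi|^2\le\langle A(x)\xi,\xi\rangle\le\Lambda|\xi|^2$ for every $\xi\in\mathbb{R}^n$, let $f:\mathbb{R}\to[0,\infty)$ be nondecreasing, and let $F(t)=\int_0^t f(s)\,ds$. Let $x_0\in\mathbb{R}^n$, $R>0$, and let $u\in W^{1,2}(B(x_0,2R))$ be a continuous and nonnegative subsolution of $$\operatorname{div}(A(x)Du)\ge f(u)\quad\text{in } B(x_0,2R).$$ Denote $M=\sup_{B(x_0,R)}u$ and $m=\inf_{B(x_0,R)}u$. If $u(x_0)>0$, then $$\int_{m/4}^M\frac{dt}{\sqrt{F(t)}}\ge c\,R.$$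
   Context: $B(x,r)$ denotes the open ball in $\mathbb{R}^n$ with centre $x$ and radius $r$. For an open set $U\subset\mathbb{R}^n$, $u\in W^{1,2}(U)$ is a subsolution, i.e. satisfies $\operatorname{div}(A(x)Du)\ge f(u)$ in $U$, if $\int_U\langle A(x)Du,D\varphi\rangle\,dx\le-\int_U f(u)\varphi\,dx$ for all nonnegative $\varphi\in W^{1,2}_0(U)$. The function $f$ may be discontinuous. The convention $1/\sqrt{0}=+\infty$ is used, so the integral may equal $+\infty$. *)

theory Defs
  imports "HOL-Analysis.Analysis"
begin

definition partial_deriv :: "'n::finite \<Rightarrow> (real ^ 'n \<Rightarrow> real) \<Rightarrow> real ^ 'n \<Rightarrow> real" where
  "partial_deriv i \<phi> x = frechet_derivative \<phi> (at x) (axis i 1)"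

definition gradient :: "(real ^ 'n::finite \<Rightarrow> real) \<Rightarrow> real ^ 'n \<Rightarrow> real ^ 'n" where
  "gradient \<phi> x = (\<chi> i. partial_deriv i \<phi> x)"

(* Together over all k this gives the usual notion of C^infinity on the whole space. *)
fun times_differentiable :: "nat \<Rightarrow> (real ^ 'n::finite \<Rightarrow> real) \<Rightarrow> bool" where
  "times_differentiable 0 \<phi> \<longleftrightarrow> continuous_on UNIV \<phi>"
| "times_differentiable (Suc k) \<phi> \<longleftrightarrow>
     (\<forall>x. \<phi> differentiable (at x)) \<and> (\<forall>i. times_differentiable k (partial_deriv i \<phi>))"

(* C_c^infinity(U), its elements being extended by zero outside U *)
definition test_functions :: "(real ^ 'n::finite) set \<Rightarrow> (real ^ 'n \<Rightarrow> real) set" where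
  "test_functions U = {\<phi>. (\<forall>k. times_differentiable k \<phi>) \<and>
     compact (closure {x. \<phi> x \<noteq> 0}) \<and> closure {x. \<phi> x \<noteq> 0} \<subseteq> U}"

definition square_integrable_on ::
    "(real ^ 'n::finite \<Rightarrow> 'b::euclidean_space) \<Rightarrow> (real ^ 'n) set \<Rightarrow> bool"
    (infix \<open>square'_integrable'_on\<close> 46) where
  "f square_integrable_on U \<longleftrightarrow>
     f \<in> borel_measurable (lebesgue_on U) \<and> integrable (lebesgue_on U) (\<lambda>x. (norm (f x))\<^sup>2)"

(* "u is in W^{1,2}(U) and g is a representative of its weak gradient Du". Functions are not
   identified up to null sets, so Du is a relation: g is determined only almost everywhere in U,
   and the values of u and g outside U play no role. *)
definition has_W12_gradient ::
    "(real ^ 'n::finite) set \<Rightarrow> (real ^ 'n \<Rightarrow> real) \<Rightarrow> (real ^ 'n \<Rightarrow> real ^ 'n) \<Rightarrow> bool" where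
  "has_W12_gradient U u g \<longleftrightarrow> u square_integrable_on U \<and> g square_integrable_on U \<and>
     (\<forall>\<phi>\<in>test_functions U. \<forall>i.
        (LINT x|lebesgue_on U. u x * partial_deriv i \<phi> x) = - (LINT x|lebesgue_on U. g x $ i * \<phi> x))"

definition W12 :: "(real ^ 'n::finite) set \<Rightarrow> (real ^ 'n \<Rightarrow> real) set" where
  "W12 U = {u. \<exists>g. has_W12_gradient U u g}"

(* the closure of C_c^infinity(U) in the W^{1,2}(U) norm *)
definition W12_0 :: "(real ^ 'n::finite) set \<Rightarrow> (real ^ 'n \<Rightarrow> real) set" where
  "W12_0 U = {u. \<exists>g. has_W12_gradient U u g \<and>
     (\<exists>\<psi>. (\<forall>k::nat. \<psi> k \<in> test_functions U) \<and>
       (\<lambda>k. (LINT x|lebesgue_on U. (\<psi> k x - u x)\<^sup>2)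
          + (LINT x|lebesgue_on U. (norm (gradient (\<psi> k) x - g x))\<^sup>2)) \<longlonglongrightarrow> 0)}"

(* div(A(x) Du) >= f(u) in U.  The Bochner integral of a non-integrable function is 0, so
   integrability of f(u) phi has to be demanded.  For f >= 0 (and phi >= 0) this adds nothing:
   the integral of f(u) phi then makes sense in [0, infinity], and the inequality, whose
   left-hand side is finite for bounded A, excludes the value infinity. *)
definition subsolution ::
    "(real ^ 'n::finite \<Rightarrow> real ^ 'n ^ 'n) \<Rightarrow> (real \<Rightarrow> real) \<Rightarrow> (real ^ 'n) set \<Rightarrow> (real ^ 'n \<Rightarrow> real) \<Rightarrow> bool"
  where
  "subsolution A f U u \<longleftrightarrow> (\<exists>Du. has_W12_gradient U u Du \<and>
     (\<forall>\<phi>\<in>W12_0 U. \<forall>D\<phi>. has_W12_gradient U \<phi> D\<phi> \<longrightarrow> (AE x in lebesgue_on U. 0 \<le> \<phi> x) \<longrightarrow>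
        integrable (lebesgue_on U) (\<lambda>x. f (u x) * \<phi> x) \<and>
        (LINT x|lebesgue_on U. (A x *v Du x) \<bullet> D\<phi> x) \<le> - (LINT x|lebesgue_on U. f (u x) * \<phi> x)))"

(* symmetric measurable coefficients on U with ellipticity constants l \<le> L *)
definition elliptic_field ::
    "real \<Rightarrow> real \<Rightarrow> (real ^ 'n::finite) set \<Rightarrow> (real ^ 'n \<Rightarrow> real ^ 'n ^ 'n) \<Rightarrow> bool" where
  "elliptic_field l L U A \<longleftrightarrow> A \<in> borel_measurable (lebesgue_on U) \<and>
     (\<forall>x\<in>U. transpose (A x) = A x \<and>
       (\<forall>\<xi>. l * (norm \<xi>)\<^sup>2 \<le> (A x *v \<xi>) \<bullet> \<xi> \<and> (A x *v \<xi>) \<bullet> \<xi> \<le> L * (norm \<xi>)\<^sup>2))"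

definition primitive :: "(real \<Rightarrow> real) \<Rightarrow> real \<Rightarrow> real" where
  "primitive f t = (LBINT s=ereal 0..ereal t. f s)"

(* The integral of 1/sqrt(F) over [a,b] (for a \<le> b) as an element of [0, infinity]; division in
   ennreal satisfies 1 / 0 = infinity, which is the convention 1/sqrt 0 = infinity. *)
definition inverse_sqrt_integral :: "(real \<Rightarrow> real) \<Rightarrow> real \<Rightarrow> real \<Rightarrow> ennreal" where
  "inverse_sqrt_integral F a b = (\<integral>\<^sup>+ t\<in>{a..b}. 1 / ennreal (sqrt (F t)) \<partial>lborel)"

end

theory Submission
  imports Defs
begin

text \<open>
  The heart of the matter is a growth estimate: if $u(y) = t > 0$ and $u \le 2t$ on $B(y,\rho)$, then
  $f(t/2) \le K t/\rho^2$. Since $F(s) \le s f(s)$, this says that $\rho$ is at most a multiple of the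
  integral of $1/\sqrt F$ over $[t/4, t/2]$. Passing from $y$ to a nearest point where $u \ge 2t$ and
  repeating, one obtains disjoint intervals, all of them between $u(x_0)/4$ and $M$, while the radii add up
  to $R$.

  For the growth estimate, subtract a paraboloid: the levels $k \ge t/2$ of
  $P = u - 2t|x-y|^2/\rho^2$ are attained only well inside the ball, so that (a smooth version of)
  $(P-k)_+$ is an admissible test function and no cut-off is needed. The energy inequality
  $l \int |D(P-k)_+|^2 + 2 f(t/2) \int (P-k)_+ \le 16 L t^2 \rho^{-2} |\{P>k\}|$, combined with the
  Faber--Krahn inequality, drives a Stampacchia iteration which shows that $\{P > 3t/4\}$ occupies a
  fixed fraction of the ball, as otherwise $P(y) < t$. The same energy inequality at $k = t/2$ then bounds
  $f(t/2)$.

  Faber--Krahn comes from averaging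
  $\int w^2 - \int w(x) w(x+h)\,dx = \frac12 \int |w(x+h)-w(x)|^2\,dx \le \frac12 |h|^2 \int |Dw|^2$
  over $|h| < \delta$.
\<close>

section \<open>Smooth functions\<close>

text \<open>Since \<open>f\<close> may jump and \<open>A\<close> is merely measurable, all
  information comes from testing the weak inequality. \<open>f\<close> enters only through
  monotonicity: f(u) >= f(t/2) where u >= t/2, and F(s) <= s f(s). As \<open>W12_0\<close> is a
  closure of smooth functions with compact support, admissibility of a truncation means exhibiting
  approximants; that is the purpose of the mollification theory.

  The factors are tied together. The paraboloid reaches 2t, the bound for u, on the sphere of radius
  \<rho>, which keeps its superlevel sets away from that sphere, while its value 0 at the centre
  leaves P(y) = t and hence room for levels between t/2 and 7t/8. Doubling matches the shape of
  [t/4, t/2]: at the next centre the value is at least 2t, so its interval begins at t/2 or later.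
  Only finitely many doublings fit below M, which is finite because the closure of B(x0,R) is
  compact in B(x0,2R).

  Averaging over translations involves no Sobolev exponent, so dimensions one and two need no
  separate treatment.\<close>

definition smooth :: "(real ^ 'n::finite \<Rightarrow> real) \<Rightarrow> bool" where
  "smooth \<phi> \<longleftrightarrow> (\<forall>k. times_differentiable k \<phi>)"

lemma partial_deriv_eq:
  "(\<phi> has_derivative D) (at x) \<Longrightarrow> partial_deriv i \<phi> x = D (axis i 1)"
  unfolding partial_deriv_def using frechet_derivative_at by metis

lemma gradient_has_derivative:
  fixes \<phi> :: "real ^ 'n::finite \<Rightarrow> real"
  assumes "\<phi> differentiable (at x)"
  shows "(\<phi> has_derivative (\<lambda>h. gradient \<phi> x \<bullet> h)) (at x)"
proof -
  obtain D where D: "(\<phi> has_derivative D) (at x)"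
    using assms by (auto simp: differentiable_def)
  then have lin: "linear D" by (simp add: has_derivative_linear)
  have "D h = gradient \<phi> x \<bullet> h" for h
  proof -
    have "D h = D (\<Sum>i\<in>UNIV. h $ i *\<^sub>R axis i 1)"
      using basis_expansion[of h] by (simp add: scalar_mult_eq_scaleR)
    also have "\<dots> = (\<Sum>i\<in>UNIV. h $ i *\<^sub>R D (axis i 1))"
      by (simp add: linear_sum[OF lin] linear_cmul[OF lin])
    also have "\<dots> = gradient \<phi> x \<bullet> h"
      by (simp add: inner_vec_def gradient_def partial_deriv_eq[OF D] mult.commute)
    finally show ?thesis .
  qed
  then have "D = (\<lambda>h. gradient \<phi> x \<bullet> h)" by auto
  with D show ?thesis by simp
qed

lemma gradient_eq:
  fixes \<phi> :: "real ^ 'n::finite \<Rightarrow> real"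
  assumes "(\<phi> has_derivative (\<lambda>h. g \<bullet> h)) (at x)"
  shows "gradient \<phi> x = g"
  by (simp add: vec_eq_iff gradient_def partial_deriv_eq[OF assms] inner_axis)

text \<open>The recursion speaks about the partial derivatives and not about the lower classes of
  the function itself. Products and compositions need those, because their derivatives contain
  undifferentiated factors.\<close>

lemma times_differentiable_Suc_D:
  "times_differentiable (Suc k) \<phi> \<Longrightarrow> times_differentiable k \<phi>"
proof (induction k arbitrary: \<phi>)
  case 0
  then show ?case
    by (simp add: continuous_at_imp_continuous_on differentiable_imp_continuous_within)
next
  case (Suc k)
  then show ?case by (metis times_differentiable.simps(2))
qed

lemma times_differentiable_const: "times_differentiable k (\<lambda>x. c)"
proof (induction k arbitrary: c)
  case (Suc k)
  have "partial_deriv i (\<lambda>x. c) = (\<lambda>x. 0)" for i :: 'a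
    by (rule ext) (simp add: partial_deriv_eq[of _ "\<lambda>h. 0"])
  with Suc show ?case by simp
qed simp

lemma times_differentiable_add:
  "times_differentiable k \<phi> \<Longrightarrow> times_differentiable k \<psi> \<Longrightarrow> times_differentiable k (\<lambda>x. \<phi> x + \<psi> x)"
proof (induction k arbitrary: \<phi> \<psi>)
  case 0
  then show ?case by (auto intro: continuous_on_add)
next
  case (Suc k)
  have "partial_deriv i (\<lambda>x. \<phi> x + \<psi> x) = (\<lambda>x. partial_deriv i \<phi> x + partial_deriv i \<psi> x)" for i
  proof
    fix x
    have "((\<lambda>x. \<phi> x + \<psi> x) has_derivative (\<lambda>h. gradient \<phi> x \<bullet> h + gradient \<psi> x \<bullet> h)) (at x)"
      using Suc.prems by (intro has_derivative_add gradient_has_derivative) auto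
    from partial_deriv_eq[OF this] show "partial_deriv i (\<lambda>x. \<phi> x + \<psi> x) x = partial_deriv i \<phi> x + partial_deriv i \<psi> x"
      by (simp add: inner_axis gradient_def)
  qed
  with Suc show ?case by (auto intro: differentiable_add)
qed

lemma partial_deriv_mult:
  assumes "\<phi> differentiable (at x)" "\<psi> differentiable (at x)"
  shows "partial_deriv i (\<lambda>x. \<phi> x * \<psi> x) x = \<phi> x * partial_deriv i \<psi> x + partial_deriv i \<phi> x * \<psi> x"
proof -
  have "((\<lambda>x. \<phi> x * \<psi> x) has_derivative (\<lambda>h. \<phi> x * (gradient \<psi> x \<bullet> h) + (gradient \<phi> x \<bullet> h) * \<psi> x)) (at x)"
    using assms by (intro has_derivative_mult gradient_has_derivative)
  from partial_deriv_eq[OF this] show ?thesis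
    by (simp add: inner_axis gradient_def)
qed

lemma times_differentiable_mult:
  "times_differentiable k \<phi> \<Longrightarrow> times_differentiable k \<psi> \<Longrightarrow> times_differentiable k (\<lambda>x. \<phi> x * \<psi> x)"
proof (induction k arbitrary: \<phi> \<psi>)
  case 0
  then show ?case by (auto intro: continuous_on_mult)
next
  case (Suc k)
  have "partial_deriv i (\<lambda>x. \<phi> x * \<psi> x) = (\<lambda>x. \<phi> x * partial_deriv i \<psi> x + partial_deriv i \<phi> x * \<psi> x)" for i
    using Suc.prems by (auto simp: partial_deriv_mult)
  moreover have "times_differentiable k \<phi>" "times_differentiable k \<psi>"
    using Suc.prems by (auto dest: times_differentiable_Suc_D simp del: times_differentiable.simps)
  ultimately show ?case using Suc by (auto intro: differentiable_mult times_differentiable_add)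
qed

lemma times_differentiable_nth: "times_differentiable k (\<lambda>x. x $ j)"
proof (cases k)
  case (Suc k')
  have d: "((\<lambda>x::real^'a. x $ j) has_derivative (\<lambda>h. h $ j)) (at x)" for x
    by (rule bounded_linear.has_derivative[OF bounded_linear_vec_nth has_derivative_ident])
  have "partial_deriv i (\<lambda>x. x $ j) = (\<lambda>x. axis i 1 $ j)" for i :: 'a
    by (rule ext) (simp add: partial_deriv_eq[OF d])
  with Suc show ?thesis using times_differentiable_const d by (auto simp: differentiable_def simp del: One_nat_def intro!: exI)
qed (auto intro!: continuous_intros)

lemma smooth_const [intro]: "smooth (\<lambda>x. c)"
  by (simp add: smooth_def times_differentiable_const)

lemma smooth_add [intro]: "smooth \<phi> \<Longrightarrow> smooth \<psi> \<Longrightarrow> smooth (\<lambda>x. \<phi> x + \<psi> x)"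
  by (simp add: smooth_def times_differentiable_add)

lemma smooth_mult [intro]: "smooth \<phi> \<Longrightarrow> smooth \<psi> \<Longrightarrow> smooth (\<lambda>x. \<phi> x * \<psi> x)"
  by (simp add: smooth_def times_differentiable_mult)

lemma smooth_minus: "smooth \<phi> \<Longrightarrow> smooth (\<lambda>x. - \<phi> x)"
  using smooth_mult[OF smooth_const[of "-1"], of \<phi>] by simp

lemma smooth_diff [intro]: "smooth \<phi> \<Longrightarrow> smooth \<psi> \<Longrightarrow> smooth (\<lambda>x. \<phi> x - \<psi> x)"
  using smooth_add[OF _ smooth_minus, of \<phi> \<psi>] by simp

lemma smooth_sum: "finite I \<Longrightarrow> (\<And>i. i \<in> I \<Longrightarrow> smooth (\<phi> i)) \<Longrightarrow> smooth (\<lambda>x. \<Sum>i\<in>I. \<phi> i x)"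
  by (induction I rule: finite_induct) auto

lemma smooth_nth [intro]: "smooth (\<lambda>x. x $ j)"
  by (simp add: smooth_def times_differentiable_nth)

lemma smooth_dist_sq: "smooth (\<lambda>x. (norm (x - c))\<^sup>2)"
proof -
  have "smooth (\<lambda>x. \<Sum>i\<in>UNIV. (x $ i - c $ i) * (x $ i - c $ i))"
    by (intro smooth_sum smooth_mult smooth_diff smooth_nth smooth_const) auto
  then show ?thesis
    by (simp add: power2_norm_eq_inner inner_vec_def)
qed

lemma smooth_differentiable: "smooth \<phi> \<Longrightarrow> \<phi> differentiable (at x)"
  unfolding smooth_def by (drule spec[of _ "Suc 0"]) simp

lemma smooth_partial_deriv: "smooth \<phi> \<Longrightarrow> smooth (partial_deriv i \<phi>)"
  unfolding smooth_def by (intro allI, drule_tac x = "Suc k" in spec) simp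

lemma smooth_continuous: "smooth \<phi> \<Longrightarrow> continuous_on S \<phi>"
  unfolding smooth_def by (drule spec[of _ 0]) (auto intro: continuous_on_subset)

lemma smooth_continuous_gradient: "smooth \<phi> \<Longrightarrow> continuous_on S (gradient \<phi>)"
  unfolding gradient_def using smooth_continuous smooth_partial_deriv
  by (intro continuous_intros) blast

text \<open>The derivative of $s^{-m} e^{-1/s}$ is again a combination of functions of this family.\<close>

definition flat :: "nat \<Rightarrow> real \<Rightarrow> real" where
  "flat m s = (if 0 < s then (1 / s) ^ m * exp (- (1 / s)) else 0)"

lemma flat_nonneg: "0 \<le> flat m s"
  by (simp add: flat_def)

lemma flat_pos: "0 < s \<Longrightarrow> 0 < flat m s"
  by (simp add: flat_def)

lemma flat_Suc: "s * flat (Suc m) s = flat m s"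
  by (simp add: flat_def)

text \<open>A single term of the exponential series: y^m / m! <= e^y with y = 1/s. The bound is
  uniform in s, hence usable at the critical point 0.\<close>

lemma flat_le: "flat m s \<le> fact m"
proof (cases "0 < s")
  case True
  have "(\<Sum>n\<in>{m}. (1 / s) ^ n /\<^sub>R fact n) \<le> (\<Sum>n. (1 / s) ^ n /\<^sub>R fact n)"
    using True by (intro sum_le_suminf summable_exp_generic) auto
  then have "(1 / s) ^ m / fact m \<le> exp (1 / s)"
    by (simp add: exp_def divide_inverse mult.commute)
  then show ?thesis using True by (simp add: flat_def exp_minus field_simps)
qed (simp add: flat_def)

lemma flat_has_derivative:
  "(flat m has_real_derivative (flat (m + 2) s - real m * flat (m + 1) s)) (at s)"
proof -
  consider "s < 0" | "s = 0" | "0 < s" by linarith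
  then show ?thesis
  proof cases
    case 1
    have "(flat m has_real_derivative 0) (at s)"
      by (rule has_field_derivative_transform_within_open[of "\<lambda>_. 0" _ _ "{..<0}"])
        (use 1 in \<open>auto simp: flat_def\<close>)
    then show ?thesis using 1 by (simp add: flat_def)
  next
    case 2
    \<comment> \<open>Writing \<open>flat m t\<close> as t^2 \<open>flat (m + 2) t\<close> turns
      boundedness two indices higher into quadratic decay at 0, so the difference quotient there
      tends to 0.\<close>
    have b: "norm (flat m t) \<le> fact (m + 2) * norm t ^ 2" for t
    proof -
      have "flat m t = t^2 * flat (m + 2) t"
        by (simp add: power2_eq_square mult.assoc flat_Suc numeral_2_eq_2)
      also have "\<dots> \<le> t^2 * fact (m + 2)" by (intro mult_left_mono flat_le) auto
      finally show ?thesis using flat_nonneg[of m t] by (simp add: mult.commute)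
    qed
    have "((\<lambda>t. flat m t / t) \<longlongrightarrow> 0) (at 0)"
    proof (rule Lim_null_comparison)
      have "norm (flat m t / t) \<le> fact (m + 2) * norm t" if "t \<noteq> 0" for t
        using b[of t] that by (simp add: divide_le_eq power2_eq_square mult.assoc del: fact_Suc add_2_eq_Suc')
      then show "\<forall>\<^sub>F t in at 0. norm (flat m t / t) \<le> fact (m + 2) * norm t"
        by (simp add: eventually_at_filter)
      show "((\<lambda>t::real. fact (m + 2) * norm t) \<longlongrightarrow> 0) (at 0)"
        by (auto intro!: tendsto_eq_intros)
    qed
    then show ?thesis using 2 by (simp add: DERIV_def flat_def)
  next
    case 3
    define y where "y = 1 / s"
    have f: "flat j s = y ^ j * exp (- y)" for j
      using 3 by (simp add: flat_def y_def)
    have inv: "((\<lambda>s. 1 / s) has_real_derivative - (y * y)) (at s)"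
      using 3 by (auto intro!: derivative_eq_intros simp: y_def)
    have "((\<lambda>s. (1 / s) ^ m * exp (- (1 / s))) has_real_derivative
        (real m * (- (y * y) * y ^ (m - 1)) * exp (- y) + (exp (- y) * - (- (y * y))) * y ^ m)) (at s)"
      using DERIV_mult[OF DERIV_power[OF inv, of m] DERIV_fun_exp[OF DERIV_minus[OF inv]]]
      by (simp add: y_def)
    also have "real m * (- (y * y) * y ^ (m - 1)) * exp (- y) + (exp (- y) * - (- (y * y))) * y ^ m
        = flat (m + 2) s - real m * flat (m + 1) s"
      by (cases m) (simp_all add: f algebra_simps)
    finally have "((\<lambda>s. (1 / s) ^ m * exp (- (1 / s))) has_real_derivative
        flat (m + 2) s - real m * flat (m + 1) s) (at s)" .
    then show ?thesis
      by (rule has_field_derivative_transform_within_open[of _ _ _ "{0<..}"])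
        (use 3 in \<open>auto simp: flat_def\<close>)
  qed
qed

lemma continuous_flat: "continuous_on S (flat m)"
  using flat_has_derivative DERIV_isCont continuous_at_imp_continuous_on by blast

lemma has_derivative_gradient_compose:
  fixes \<phi> :: "real ^ 'n::finite \<Rightarrow> real"
  assumes "(g has_real_derivative d) (at (\<phi> x))" "\<phi> differentiable (at x)"
  shows "((\<lambda>x. g (\<phi> x)) has_derivative (\<lambda>h. (d *\<^sub>R gradient \<phi> x) \<bullet> h)) (at x)"
  using has_derivative_compose[OF gradient_has_derivative[OF assms(2)]
      assms(1)[unfolded has_field_derivative_def]] by simp

text \<open>The index \<open>m\<close> is generalised because differentiation raises it to
  \<open>m + 1\<close> and \<open>m + 2\<close>; by the chain rule the remaining factors are again
  covered by the induction hypothesis.\<close>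

lemma times_differentiable_flat:
  "times_differentiable k \<phi> \<Longrightarrow> times_differentiable k (\<lambda>x. flat m (\<phi> x))"
proof (induction k arbitrary: m)
  case 0
  with continuous_flat[of UNIV m] show ?case by (auto intro: continuous_on_compose2)
next
  case (Suc k)
  have d: "((\<lambda>x. flat m (\<phi> x)) has_derivative
      (\<lambda>h. ((flat (m + 2) (\<phi> x) - real m * flat (m + 1) (\<phi> x)) *\<^sub>R gradient \<phi> x) \<bullet> h)) (at x)" for x
    using Suc.prems by (intro has_derivative_gradient_compose flat_has_derivative) auto
  have p: "partial_deriv i (\<lambda>x. flat m (\<phi> x)) =
      (\<lambda>x. (flat (m + 2) (\<phi> x) + (- real m) * flat (m + 1) (\<phi> x)) * partial_deriv i \<phi> x)" for i
    by (rule ext) (simp add: partial_deriv_eq[OF d] inner_axis gradient_def)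
  have "times_differentiable k \<phi>" using Suc.prems by (rule times_differentiable_Suc_D)
  then have "times_differentiable k (partial_deriv i (\<lambda>x. flat m (\<phi> x)))" for i
    unfolding p using Suc.prems
    by (intro times_differentiable_mult times_differentiable_add times_differentiable_const Suc.IH) simp_all
  moreover have "(\<lambda>x. flat m (\<phi> x)) differentiable (at x)" for x
    using d[of x] unfolding differentiable_def by blast
  ultimately show ?case by simp
qed

lemma smooth_flat: "smooth \<phi> \<Longrightarrow> smooth (\<lambda>x. flat m (\<phi> x))"
  by (simp add: smooth_def times_differentiable_flat)

lemma vanishing_partial_deriv:
  assumes "\<forall>x. r < norm x \<longrightarrow> \<phi> x = 0" "r < norm x"
  shows "partial_deriv i \<phi> x = 0"
proof -
  have "open {x::real^'a. r < norm x}" by (intro open_Collect_less continuous_intros)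
  then have "(\<phi> has_derivative (\<lambda>h. 0)) (at x)"
    using assms by (intro has_derivative_transform_within_open[OF has_derivative_const]) auto
  from partial_deriv_eq[OF this] show ?thesis .
qed

section \<open>Convolution with smooth kernels\<close>

lemma continuous_vanishing_bounded:
  fixes k :: "'a::euclidean_space \<Rightarrow> 'b::real_normed_vector"
  assumes "continuous_on UNIV k" and "\<forall>x. r < norm x \<longrightarrow> k x = 0"
  obtains B where "0 \<le> B" "\<And>x. norm (k x) \<le> B"
proof -
  have "compact (k ` cball 0 r)"
    using assms(1) by (intro compact_continuous_image) (auto intro: continuous_on_subset)
  then obtain B where B: "\<And>x. x \<in> cball 0 r \<Longrightarrow> norm (k x) \<le> B"
    by (meson bounded_iff compact_imp_bounded image_eqI)
  have "norm (k x) \<le> max B 0" for x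
    using B[of x] assms(2) by (cases "r < norm x") auto
  then show ?thesis by (intro that[of "max B 0"]) auto
qed

lemma uniformly_continuous_vanishing:
  fixes k :: "'a::euclidean_space \<Rightarrow> 'b::real_normed_vector"
  assumes "continuous_on UNIV k" and van: "\<forall>x. r < norm x \<longrightarrow> k x = 0"
  shows "uniformly_continuous_on UNIV k"
  unfolding uniformly_continuous_on_def
proof (intro allI impI)
  fix e :: real assume "0 < e"
  \<comment> \<open>With the margin 1 and a modulus of at most 1, two close points either both lie
    in the enlarged ball or both lie where \<open>k\<close> vanishes.\<close>
  have "uniformly_continuous_on (cball 0 (r + 1)) k"
    using assms(1) by (intro compact_uniformly_continuous) (auto intro: continuous_on_subset)
  then obtain d where d: "d > 0"
      "\<And>x y. x \<in> cball 0 (r+1) \<Longrightarrow> y \<in> cball 0 (r+1) \<Longrightarrow> dist y x < d \<Longrightarrow> dist (k y) (k x) < e"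
    unfolding uniformly_continuous_on_def using \<open>0 < e\<close> by meson
  have "dist (k y) (k x) < e" if "dist y x < min d 1" for x y
  proof (cases "norm x \<le> r + 1 \<and> norm y \<le> r + 1")
    case False
    moreover have "norm x \<le> norm y + dist y x" "norm y \<le> norm x + dist y x"
      using norm_triangle_sub[of x y] norm_triangle_sub[of y x]
      by (auto simp: dist_norm norm_minus_commute)
    ultimately have "r < norm x" "r < norm y" using that by auto
    with van \<open>0 < e\<close> show ?thesis by simp
  qed (use d that in auto)
  with \<open>d > 0\<close> show "\<exists>d>0. \<forall>x\<in>UNIV. \<forall>x'\<in>UNIV. dist x' x < d \<longrightarrow> dist (k x') (k x) < e"
    by (intro exI[of _ "min d 1"]) auto
qed

lemma integrable_scaleR_vanishing:
  fixes v :: "'a::euclidean_space \<Rightarrow> real" and k :: "'a \<Rightarrow> 'b::euclidean_space"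
  assumes v: "integrable lborel v" and k: "continuous_on UNIV k" "\<forall>x. r < norm x \<longrightarrow> k x = 0"
  shows "integrable lborel (\<lambda>y. v y *\<^sub>R k (x - y))"
proof -
  obtain B where B: "0 \<le> B" "\<And>x. norm (k x) \<le> B"
    using continuous_vanishing_bounded[OF k] by blast
  show ?thesis
  proof (rule Bochner_Integration.integrable_bound)
    show "integrable lborel (\<lambda>y. B * v y)" using v by simp
    have [measurable]: "k \<in> borel_measurable borel" using k(1) by (rule borel_measurable_continuous_onI)
    show "(\<lambda>y. v y *\<^sub>R k (x - y)) \<in> borel_measurable lborel"
      using borel_measurable_integrable[OF v] by measurable
    show "AE y in lborel. norm (v y *\<^sub>R k (x - y)) \<le> norm (B * v y)"
    proof (intro AE_I2)
      fix y
      show "norm (v y *\<^sub>R k (x - y)) \<le> norm (B * v y)"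
        using mult_right_mono[OF B(2)[of "x - y"], of "\<bar>v y\<bar>"] B(1) by (simp add: abs_mult mult.commute)
    qed
  qed
qed

definition conv :: "('a::euclidean_space \<Rightarrow> real) \<Rightarrow> ('a \<Rightarrow> real) \<Rightarrow> 'a \<Rightarrow> real" where
  "conv v k x = (LINT y|lborel. v y * k (x - y))"

lemma vanishing_gradient:
  "\<forall>x. r < norm x \<longrightarrow> \<phi> x = 0 \<Longrightarrow> r < norm x \<Longrightarrow> gradient \<phi> x = 0"
  by (simp add: gradient_def vanishing_partial_deriv vec_eq_iff)

text \<open>The gradient is continuous with bounded support, hence uniformly continuous, so the mean
  value inequality gives a first-order remainder whose radius does not depend on the base point
  \<open>z\<close>. This uniformity is what allows the expansion to be integrated in a
  convolution.\<close>

lemma smooth_uniform_derivative: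
  fixes \<phi> :: "real ^ 'n::finite \<Rightarrow> real"
  assumes "smooth \<phi>" and van: "\<forall>x. r < norm x \<longrightarrow> \<phi> x = 0" and "0 < e"
  obtains d where "0 < d"
    "\<And>z w. norm w < d \<Longrightarrow> \<bar>\<phi> (z + w) - \<phi> z - gradient \<phi> z \<bullet> w\<bar> \<le> e * norm w"
proof -
  have "uniformly_continuous_on UNIV (gradient \<phi>)"
    using vanishing_gradient[OF van] 
    by (intro uniformly_continuous_vanishing[where r = r] smooth_continuous_gradient[OF assms(1)]) simp
  then obtain d where d: "d > 0" "\<And>x y. dist y x < d \<Longrightarrow> dist (gradient \<phi> y) (gradient \<phi> x) < e"
    unfolding uniformly_continuous_on_def using \<open>0 < e\<close> by blast
  have "\<bar>\<phi> (z + w) - \<phi> z - gradient \<phi> z \<bullet> w\<bar> \<le> e * norm w" if "norm w < d" for z w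
  proof -
    have "norm (\<phi> (z + w) - \<phi> z - gradient \<phi> z \<bullet> (z + w - z)) \<le> norm (z + w - z) * e"
    proof (rule differentiable_bound_linearization[of z "z + w" "ball z d" \<phi> "\<lambda>x h. gradient \<phi> x \<bullet> h" z e])
      show "z + t *\<^sub>R (z + w - z) \<in> ball z d" if "t \<in> {0..1}" for t
      proof -
        have "norm (t *\<^sub>R w) \<le> norm w" using that by (simp add: mult_left_le_one_le)
        with \<open>norm w < d\<close> show ?thesis by (simp add: dist_norm[of z])
      qed
      show "(\<phi> has_derivative (\<bullet>) (gradient \<phi> x)) (at x within ball z d)" for x
        by (rule has_derivative_at_withinI[OF gradient_has_derivative[OF smooth_differentiable[OF assms(1)]]])
      show "onorm ((\<lambda>h. gradient \<phi> x \<bullet> h) - (\<lambda>h. gradient \<phi> z \<bullet> h)) \<le> e" if "x \<in> ball z d" for x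
      proof (rule onorm_le)
        fix h
        have "\<bar>(gradient \<phi> x - gradient \<phi> z) \<bullet> h\<bar> \<le> norm (gradient \<phi> x - gradient \<phi> z) * norm h"
          by (rule Cauchy_Schwarz_ineq2)
        also have "\<dots> \<le> e * norm h"
          using d(2)[of x z] that by (intro mult_right_mono) (simp_all add: dist_norm norm_minus_commute[of z x])
        finally show "norm (((\<lambda>h. gradient \<phi> x \<bullet> h) - (\<lambda>h. gradient \<phi> z \<bullet> h)) h) \<le> e * norm h"
          by (simp add: inner_diff_left)
      qed
      show "z \<in> ball z d" using d by simp
    qed
    then show ?thesis by (simp add: mult.commute)
  qed
  with d(1) show ?thesis by (rule that)
qed

text \<open>The uniform expansion of the kernel is integrated against \<open>v\<close>, and its
  remainder costs only the L^1 norm of \<open>v\<close>. No regularity of \<open>v\<close> beyond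
  integrability enters.\<close>

lemma conv_has_derivative:
  fixes \<phi> :: "real ^ 'n::finite \<Rightarrow> real"
  assumes v: "integrable lborel v" and s: "smooth \<phi>" and van: "\<forall>x. r < norm x \<longrightarrow> \<phi> x = 0"
  shows "(conv v \<phi> has_derivative (\<lambda>h. (LINT y|lborel. v y *\<^sub>R gradient \<phi> (x - y)) \<bullet> h)) (at x)"
    (is "(_ has_derivative (\<lambda>h. ?G \<bullet> h)) _")
  unfolding has_derivative_at_alt
proof (intro conjI allI impI)
  show "bounded_linear (\<lambda>h. ?G \<bullet> h)" by (rule bounded_linear_inner_right)
  fix e :: real assume "0 < e"
  define N where "N = (LINT y|lborel. \<bar>v y\<bar>)"
  have "0 \<le> N" by (simp add: N_def)
  \<comment> \<open>Dividing by \<open>N + 1\<close> instead of \<open>N\<close> covers the case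
    that \<open>v\<close> vanishes almost everywhere.\<close>
  then have "0 < e / (N + 1)" using \<open>0 < e\<close> by simp
  from smooth_uniform_derivative[OF s van this] obtain d where d: "0 < d"
    "\<And>z w. norm w < d \<Longrightarrow> \<bar>\<phi> (z + w) - \<phi> z - gradient \<phi> z \<bullet> w\<bar> \<le> e / (N + 1) * norm w"
    by blast
  have i1: "integrable lborel (\<lambda>y. v y * \<phi> (x - y))" for x
    using integrable_scaleR_vanishing[OF v smooth_continuous[OF s] van] by simp
  have i2: "integrable lborel (\<lambda>y. v y *\<^sub>R gradient \<phi> (x - y))"
    using vanishing_gradient[OF van]
    by (intro integrable_scaleR_vanishing[where r = r] v smooth_continuous_gradient s) auto
  have "norm (conv v \<phi> z - conv v \<phi> x - ?G \<bullet> (z - x)) \<le> e * norm (z - x)" if "norm (z - x) < d" for z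
  proof -
    have bd: "norm (v y * (\<phi> (x - y + (z - x)) - \<phi> (x - y) - gradient \<phi> (x - y) \<bullet> (z - x)))
        \<le> \<bar>v y\<bar> * (e / (N + 1) * norm (z - x))" for y
      unfolding real_norm_def abs_mult by (intro mult_left_mono d(2)[OF that]) simp
    have "conv v \<phi> z - conv v \<phi> x - ?G \<bullet> (z - x) =
      (LINT y|lborel. v y * (\<phi> (x - y + (z - x)) - \<phi> (x - y) - gradient \<phi> (x - y) \<bullet> (z - x)))"
      using i1[of z] i1[of x] integrable_inner_left[of "z - x", OF i2]
      by (simp add: conv_def right_diff_distrib flip: integral_inner_left[OF i2])
    also have "norm \<dots> \<le> (LINT y|lborel. \<bar>v y\<bar> * (e / (N + 1) * norm (z - x)))"
      using i1[of z] i1[of x] integrable_inner_left[of "z - x", OF i2] v d(2)[OF that]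
      by (intro order_trans[OF integral_norm_bound] integral_mono bd) (auto simp: right_diff_distrib)
    also have "\<dots> = N * (e / (N + 1) * norm (z - x))" by (simp add: N_def)
    also have "\<dots> = (N / (N + 1)) * (e * norm (z - x))" by simp
    also have "\<dots> \<le> 1 * (e * norm (z - x))"
      using \<open>0 \<le> N\<close> \<open>0 < e\<close> by (intro mult_right_mono) auto
    finally show ?thesis by simp
  qed
  with d(1) show "\<exists>d>0. \<forall>z. norm (z - x) < d \<longrightarrow>
      norm (conv v \<phi> z - conv v \<phi> x - ?G \<bullet> (z - x)) \<le> e * norm (z - x)" by blast
qed

lemma partial_deriv_conv:
  fixes \<phi> :: "real ^ 'n::finite \<Rightarrow> real"
  assumes v: "integrable lborel v" and s: "smooth \<phi>" and van: "\<forall>x. r < norm x \<longrightarrow> \<phi> x = 0"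
  shows "partial_deriv i (conv v \<phi>) = conv v (partial_deriv i \<phi>)"
proof
  fix x
  have i2: "integrable lborel (\<lambda>y. v y *\<^sub>R gradient \<phi> (x - y))"
    using vanishing_gradient[OF van]
    by (intro integrable_scaleR_vanishing[where r = r] v smooth_continuous_gradient s) auto
  have "partial_deriv i (conv v \<phi>) x = (LINT y|lborel. v y *\<^sub>R gradient \<phi> (x - y)) \<bullet> axis i 1"
    by (rule partial_deriv_eq[OF conv_has_derivative[OF assms]])
  also have "\<dots> = conv v (partial_deriv i \<phi>) x"
    unfolding integral_inner_left[OF i2, symmetric] by (simp add: conv_def inner_axis gradient_def)
  finally show "partial_deriv i (conv v \<phi>) x = conv v (partial_deriv i \<phi>) x" .
qed

text \<open>All derivatives fall on the kernel, so the induction varies the kernel while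
  \<open>v\<close> and the support radius \<open>r\<close> stay fixed.\<close>

lemma smooth_conv:
  fixes \<phi> :: "real ^ 'n::finite \<Rightarrow> real"
  assumes v: "integrable lborel v" and "smooth \<phi>" and "\<forall>x. r < norm x \<longrightarrow> \<phi> x = 0"
  shows "smooth (conv v \<phi>)"
proof -
  have "times_differentiable k (conv v \<phi>)" for k
    using assms(2,3)
  proof (induction k arbitrary: \<phi>)
    case 0
    then show ?case using conv_has_derivative[OF v 0]
      by (auto intro!: continuous_at_imp_continuous_on has_derivative_continuous)
  next
    case (Suc k)
    have "conv v \<phi> differentiable (at x)" for x
      using conv_has_derivative[OF v Suc.prems] by (auto simp: differentiable_def)
    moreover have "times_differentiable k (conv v (partial_deriv i \<phi>))" for i
      using Suc.prems by (intro Suc.IH smooth_partial_deriv) (simp_all add: vanishing_partial_deriv)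
    ultimately show ?case by (simp add: partial_deriv_conv[OF v Suc.prems])
  qed
  then show ?thesis by (simp add: smooth_def)
qed

lemma lborel_distr_reflect: "distr lborel borel (\<lambda>y. x - y) = (lborel :: 'a::euclidean_space measure)"
  by (subst (2) lborel_affine[of "-1" x]) (auto simp: density_1)

lemma integral_reflect_translate:
  fixes F :: "'a::euclidean_space \<Rightarrow> real"
  assumes [measurable]: "F \<in> borel_measurable borel"
  shows "(LINT y|lborel. F (x - y)) = (LINT y|lborel. F y)"
proof -
  have "(LINT y|lborel. F y) = (LINT y|distr lborel borel (\<lambda>y. x - y). F y)"
    by (simp add: lborel_distr_reflect)
  also have "\<dots> = (LINT y|lborel. F (x - y))" by (intro integral_distr) measurable
  finally show ?thesis ..
qed

text \<open>Convolving with the indicator of a large ball gives a function that is constant near the origin.\<close>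

lemma integral_partial_deriv:
  fixes \<phi> :: "real ^ 'n::finite \<Rightarrow> real"
  assumes s: "smooth \<phi>" and van: "\<forall>x. r < norm x \<longrightarrow> \<phi> x = 0"
  shows "(LINT x|lborel. partial_deriv i \<phi> x) = 0"
proof -
  define v where "v = indicat_real (ball (0::real^'n) (r + 1))"
  have v: "integrable lborel v" unfolding v_def
    by (intro integrable_real_indicator emeasure_lborel_ball_finite) auto
  have eq: "conv v k x = (LINT y|lborel. k y)"
    if "\<forall>x. r < norm x \<longrightarrow> k x = 0" "norm x < 1" "continuous_on UNIV k" for k :: "real^'n \<Rightarrow> real" and x
  proof -
    have "v y * k (x - y) = k (x - y)" for y
    proof (cases "norm y < r + 1")
      case False
      then have "r < norm (x - y)" using norm_triangle_sub[of y x] that(2) by (simp add: norm_minus_commute)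
      then show ?thesis using that(1) by simp
    qed (simp add: v_def)
    then have "conv v k x = (LINT y|lborel. k (x - y))" by (simp only: conv_def)
    also have "\<dots> = (LINT y|lborel. k y)"
      by (rule integral_reflect_translate[OF borel_measurable_continuous_onI[OF that(3)]])
    finally show ?thesis .
  qed
  have c: "(LINT y|lborel. \<phi> y) = conv v \<phi> x" if "x \<in> ball 0 1" for x
    using eq[OF van _ smooth_continuous[OF s], of x] that by simp
  have "(conv v \<phi> has_derivative (\<lambda>h. 0)) (at 0)"
    by (rule has_derivative_transform_within_open[OF has_derivative_const open_ball[of 0 1] _ c]) simp_all
  from partial_deriv_eq[OF this] have "conv v (partial_deriv i \<phi>) 0 = 0"
    unfolding partial_deriv_conv[OF v s van] .
  moreover have "conv v (partial_deriv i \<phi>) 0 = (LINT y|lborel. partial_deriv i \<phi> y)"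
    by (rule eq) (simp_all add: vanishing_partial_deriv[OF van] smooth_continuous[OF smooth_partial_deriv[OF s]])
  ultimately show ?thesis by simp
qed

section \<open>Nash's inequality for smooth functions\<close>

text \<open>The variance of \<open>a\<close> under the probability density \<open>k\<close> is
  nonnegative.\<close>

lemma integral_square_le:
  fixes k a :: "'b \<Rightarrow> real"
  assumes k: "integrable M k" "(LINT x|M. k x) = 1" "\<And>x. 0 \<le> k x"
    and a: "integrable M (\<lambda>x. k x * a x)" "integrable M (\<lambda>x. k x * (a x)\<^sup>2)"
  shows "(LINT x|M. k x * a x)\<^sup>2 \<le> (LINT x|M. k x * (a x)\<^sup>2)"
proof -
  define m where "m = (LINT x|M. k x * a x)"
  have "0 \<le> (LINT x|M. k x * (a x - m)\<^sup>2)" using k(3) by simp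
  also have "\<dots> = (LINT x|M. k x * (a x)\<^sup>2 - 2 * m * (k x * a x) + m\<^sup>2 * k x)"
    by (rule Bochner_Integration.integral_cong) (auto simp: power2_diff algebra_simps)
  also have "\<dots> = (LINT x|M. k x * (a x)\<^sup>2) - m\<^sup>2"
    using k a by (simp add: m_def power2_eq_square)
  finally show ?thesis by (simp add: m_def)
qed

lemma integrable_vanishing:
  fixes k :: "'a::euclidean_space \<Rightarrow> 'b::euclidean_space"
  assumes "continuous_on UNIV k" "\<forall>x. r < norm x \<longrightarrow> k x = 0"
  shows "integrable lborel k"
proof -
  have "integrable lborel (\<lambda>x. indicator (cball 0 r) x *\<^sub>R k x)"
    by (intro borel_integrable_compact continuous_on_subset[OF assms(1)]) auto
  moreover have "(\<lambda>x. indicator (cball 0 r) x *\<^sub>R k x) = k"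
    using assms(2) by (auto simp: indicator_def)
  ultimately show ?thesis by simp
qed

lemma nn_integral_translate:
  fixes F :: "'a::euclidean_space \<Rightarrow> ennreal"
  assumes [measurable]: "F \<in> borel_measurable borel"
  shows "(\<integral>\<^sup>+x. F (x + h) \<partial>lborel) = (\<integral>\<^sup>+x. F x \<partial>lborel)"
proof -
  have "(\<integral>\<^sup>+x. F x \<partial>lborel) = (\<integral>\<^sup>+x. F x \<partial>distr lborel borel ((+) h))"
    by (simp add: lborel_distr_plus)
  also have "\<dots> = (\<integral>\<^sup>+x. F (h + x) \<partial>lborel)" by (intro nn_integral_distr) measurable
  finally show ?thesis by (simp add: add.commute)
qed

lemma integral_translate:
  fixes F :: "'a::euclidean_space \<Rightarrow> 'b::euclidean_space"
  assumes [measurable]: "F \<in> borel_measurable borel"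
  shows "(LINT x|lborel. F (x + h)) = (LINT x|lborel. F x)"
proof -
  have "(LINT x|lborel. F x) = (LINT x|distr lborel borel ((+) h). F x)"
    by (simp add: lborel_distr_plus)
  also have "\<dots> = (LINT x|lborel. F (h + x))" by (intro integral_distr) measurable
  finally show ?thesis by (simp add: add.commute)
qed

text \<open>The fundamental theorem of calculus along the segment from x to x + h, followed by the
  variance inequality for the uniform density on [0,1] and Cauchy-Schwarz in the inner product. The
  indicator form of the bound prepares for exchanging the integrals over t and x.\<close>

lemma smooth_difference_square_le:
  fixes w :: "real ^ 'n::finite \<Rightarrow> real"
  assumes s: "smooth w"
  shows "(w (x + h) - w x)\<^sup>2 \<le> (LINT t|lborel. indicator {0..1} t * ((norm h)\<^sup>2 * (norm (gradient w (x + t *\<^sub>R h)))\<^sup>2))"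
proof -
  define a where "a t = gradient w (x + t *\<^sub>R h) \<bullet> h" for t
  have ca: "continuous_on S a" "continuous_on S (\<lambda>t. (norm (gradient w (x + t *\<^sub>R h)))\<^sup>2)" for S
    unfolding a_def
    by (intro continuous_intros continuous_on_compose2[OF smooth_continuous_gradient[OF s, of UNIV]]; simp)+
  have i: "integrable lborel (\<lambda>t. indicator {0..1} t * f t)"
    if "continuous_on {0..1} f" for f :: "real \<Rightarrow> real"
    using borel_integrable_compact[OF _ that] by simp
  have "(LINT t|lborel. indicator {0..1} t *\<^sub>R a t) = w (x + 1 *\<^sub>R h) - w (x + 0 *\<^sub>R h)"
  proof (rule integral_FTC_atLeastAtMost)
    fix t :: real
    have "((\<lambda>t. w (x + t *\<^sub>R h)) has_derivative (\<lambda>k. gradient w (x + t *\<^sub>R h) \<bullet> (k *\<^sub>R h))) (at t within {0..1})"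
      by (rule has_derivative_compose[OF _ gradient_has_derivative[OF smooth_differentiable[OF s]]])
        (auto intro!: derivative_eq_intros)
    then show "((\<lambda>t. w (x + t *\<^sub>R h)) has_vector_derivative a t) (at t within {0..1})"
      by (simp add: has_vector_derivative_def a_def mult.commute)
  qed (use ca in auto)
  then have "(w (x + h) - w x)\<^sup>2 = (LINT t|lborel. indicator {0..1} t * a t)\<^sup>2" by simp
  also have "\<dots> \<le> (LINT t|lborel. indicator {0..1} t * (a t)\<^sup>2)"
    by (intro integral_square_le i ca continuous_on_power) auto
  also have "\<dots> \<le> (LINT t|lborel. indicator {0..1} t * ((norm h)\<^sup>2 * (norm (gradient w (x + t *\<^sub>R h)))\<^sup>2))"
  proof (intro integral_mono i ca continuous_on_power continuous_on_mult_left mult_left_mono)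
    show "(a t)\<^sup>2 \<le> (norm h)\<^sup>2 * (norm (gradient w (x + t *\<^sub>R h)))\<^sup>2" for t
      using power_mono[OF Cauchy_Schwarz_ineq2[of "gradient w (x + t *\<^sub>R h)" h], of 2]
      by (simp add: a_def power_mult_distrib mult.commute)
  qed auto
  finally show ?thesis .
qed

text \<open>After the pointwise bound is integrated in x and the order exchanged, every t in [0,1]
  contributes the same Dirichlet integral, by translation invariance. Extended nonnegative integrals
  make the exchange free of integrability conditions.\<close>

lemma translation_estimate:
  fixes w :: "real ^ 'n::finite \<Rightarrow> real"
  assumes s: "smooth w" and van: "\<forall>x. r < norm x \<longrightarrow> w x = 0"
  shows "(LINT x|lborel. (w (x + h) - w x)\<^sup>2) \<le> (norm h)\<^sup>2 * (LINT x|lborel. (norm (gradient w x))\<^sup>2)"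
proof -
  have cg: "continuous_on UNIV (gradient w)" by (rule smooth_continuous_gradient[OF s])
  have [measurable]: "w \<in> borel_measurable borel" "gradient w \<in> borel_measurable borel"
    using smooth_continuous[OF s] cg by (auto intro: borel_measurable_continuous_onI)
  have ig: "integrable lborel (\<lambda>x. (norm (gradient w x))\<^sup>2)"
    by (rule integrable_vanishing[where r = r]) (use vanishing_gradient[OF van] in \<open>auto intro!: continuous_intros cg\<close>)
  \<comment> \<open>An inequality is enough here, and it holds without integrability: an infinite
    right-hand side would correspond to the Bochner integral 0.\<close>
  have "ennreal (LINT x|lborel. (w (x + h) - w x)\<^sup>2) \<le> (\<integral>\<^sup>+x. ennreal ((w (x + h) - w x)\<^sup>2) \<partial>lborel)"
    by (subst integral_eq_nn_integral) (auto simp: ennreal_enn2real_if)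
  also have "\<dots> \<le> (\<integral>\<^sup>+x. (\<integral>\<^sup>+t. ennreal (indicator {0..1} t * ((norm h)\<^sup>2 * (norm (gradient w (x + t *\<^sub>R h)))\<^sup>2)) \<partial>lborel) \<partial>lborel)"
  proof (rule nn_integral_mono)
    fix x :: "real^'n"
    have "ennreal ((w (x + h) - w x)\<^sup>2) \<le> ennreal (LINT t|lborel. indicator {0..1} t * ((norm h)\<^sup>2 * (norm (gradient w (x + t *\<^sub>R h)))\<^sup>2))"
      by (rule ennreal_leI[OF smooth_difference_square_le[OF s]])
    also have "\<dots> \<le> (\<integral>\<^sup>+t. ennreal (indicator {0..1} t * ((norm h)\<^sup>2 * (norm (gradient w (x + t *\<^sub>R h)))\<^sup>2)) \<partial>lborel)"
      by (subst integral_eq_nn_integral) (auto simp: ennreal_enn2real_if)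
    finally show "ennreal ((w (x + h) - w x)\<^sup>2) \<le> \<dots>" .
  qed
  also have "\<dots> = (\<integral>\<^sup>+t. (\<integral>\<^sup>+x. ennreal (indicator {0..1} t * ((norm h)\<^sup>2 * (norm (gradient w (x + t *\<^sub>R h)))\<^sup>2)) \<partial>lborel) \<partial>lborel)"
    by (rule pair_sigma_finite.Fubini') (unfold_locales, measurable)
  also have "\<dots> = (\<integral>\<^sup>+t. indicator {0..1} t * (ennreal ((norm h)\<^sup>2) * (\<integral>\<^sup>+x. ennreal ((norm (gradient w x))\<^sup>2) \<partial>lborel)) \<partial>(lborel::real measure))"
  proof (rule nn_integral_cong)
    fix t :: real
    have "(\<integral>\<^sup>+x. ennreal (indicator {0..1} t * ((norm h)\<^sup>2 * (norm (gradient w (x + t *\<^sub>R h)))\<^sup>2)) \<partial>lborel)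
      = (\<integral>\<^sup>+x. indicator {0..1} t * (ennreal ((norm h)\<^sup>2) * ennreal ((norm (gradient w (x + t *\<^sub>R h)))\<^sup>2)) \<partial>lborel)"
      by (rule nn_integral_cong) (simp add: ennreal_mult indicator_def)
    also have "\<dots> = indicator {0..1} t * (ennreal ((norm h)\<^sup>2) * (\<integral>\<^sup>+x. ennreal ((norm (gradient w (x + t *\<^sub>R h)))\<^sup>2) \<partial>lborel))"
      by (simp add: nn_integral_cmult)
    also have "(\<integral>\<^sup>+x. ennreal ((norm (gradient w (x + t *\<^sub>R h)))\<^sup>2) \<partial>lborel) = (\<integral>\<^sup>+x. ennreal ((norm (gradient w x))\<^sup>2) \<partial>lborel)"
      by (rule nn_integral_translate[of "\<lambda>x. ennreal ((norm (gradient w x))\<^sup>2)"]) measurable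
    finally show "(\<integral>\<^sup>+x. ennreal (indicator {0..1} t * ((norm h)\<^sup>2 * (norm (gradient w (x + t *\<^sub>R h)))\<^sup>2)) \<partial>lborel)
      = indicator {0..1} t * (ennreal ((norm h)\<^sup>2) * (\<integral>\<^sup>+x. ennreal ((norm (gradient w x))\<^sup>2) \<partial>lborel))" .
  qed
  also have "\<dots> = ennreal ((norm h)\<^sup>2) * (\<integral>\<^sup>+x. ennreal ((norm (gradient w x))\<^sup>2) \<partial>lborel)"
    by (simp add: nn_integral_multc)
  also have "\<dots> = ennreal ((norm h)\<^sup>2 * (LINT x|lborel. (norm (gradient w x))\<^sup>2))"
    by (simp add: nn_integral_eq_integral[OF ig] ennreal_mult)
  finally show ?thesis by simp
qed

text \<open>For |h| < \<delta> the correlation of \<open>w\<close> with its translate is bounded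
  below by the bracket on the left; integrating over all h bounds the total correlation above by the
  squared L^1 norm. The radius \<delta> is kept as a free parameter, since it is later matched to
  the measure of a superlevel set.\<close>

lemma nash_inequality:
  fixes w :: "real ^ 'n::finite \<Rightarrow> real"
  assumes s: "smooth w" and van: "\<forall>x. r < norm x \<longrightarrow> w x = 0"
  shows "measure lborel (ball (0::real^'n) \<delta>) * ((LINT x|lborel. (w x)\<^sup>2) - \<delta>\<^sup>2 / 2 * (LINT x|lborel. (norm (gradient w x))\<^sup>2))
    \<le> (LINT x|lborel. \<bar>w x\<bar>)\<^sup>2"
proof -
  let ?B = "ball (0::real^'n) \<delta>"
  define D where "D = (LINT x|lborel. (w x)\<^sup>2) - \<delta>\<^sup>2 / 2 * (LINT x|lborel. (norm (gradient w x))\<^sup>2)"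
  have cw: "continuous_on UNIV w" by (rule smooth_continuous[OF s])
  have [measurable]: "w \<in> borel_measurable borel"
    using cw by (rule borel_measurable_continuous_onI)
  have iw: "integrable lborel (\<lambda>x. (w x)\<^sup>2)" "integrable lborel (\<lambda>x. \<bar>w x\<bar>)"
    using van by (intro integrable_vanishing[where r = r] continuous_intros cw; simp)+
  \<comment> \<open>\<open>D\<close> may be negative. Then \<open>ennreal D\<close> is 0 and the
    chain of inequalities remains valid.\<close>
  have pt: "ennreal D \<le> (\<integral>\<^sup>+x. ennreal \<bar>w x\<bar> * ennreal \<bar>w (x + h)\<bar> \<partial>lborel)" if "h \<in> ?B" for h
  proof -
    have cwh: "continuous_on UNIV (\<lambda>x. w (x + h))"
      by (intro continuous_on_compose2[OF cw] continuous_intros) simp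
    have vanh: "w (x + h) = 0" if "r + norm h < norm x" for x
      using van norm_triangle_ineq4[of "x + h" h] that by (simp add: algebra_simps)
    have i2: "integrable lborel (\<lambda>x. (w (x + h))\<^sup>2)"
      using vanh by (intro integrable_vanishing[where r = "r + norm h"] continuous_intros cwh) simp
    have i3: "integrable lborel (\<lambda>x. w x * w (x + h))" "integrable lborel (\<lambda>x. \<bar>w x\<bar> * \<bar>w (x + h)\<bar>)"
      using van by (intro integrable_vanishing[where r = r] continuous_intros cwh cw; simp)+
    have "(LINT x|lborel. (w (x + h) - w x)\<^sup>2) = (LINT x|lborel. (w (x + h))\<^sup>2 + (w x)\<^sup>2 - 2 * (w x * w (x + h)))"
      by (rule Bochner_Integration.integral_cong) (auto simp: power2_diff)
    also have "\<dots> = 2 * (LINT x|lborel. (w x)\<^sup>2) - 2 * (LINT x|lborel. w x * w (x + h))"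
      using iw i2 i3 integral_translate[of "\<lambda>x. (w x)\<^sup>2" h] by simp
    finally have "2 * (LINT x|lborel. (w x)\<^sup>2) - 2 * (LINT x|lborel. w x * w (x + h))
        \<le> (norm h)\<^sup>2 * (LINT x|lborel. (norm (gradient w x))\<^sup>2)"
      using translation_estimate[OF s van, of h] by simp
    also have "\<dots> \<le> \<delta>\<^sup>2 * (LINT x|lborel. (norm (gradient w x))\<^sup>2)"
      using that by (intro mult_right_mono power_mono) auto
    finally have "D \<le> (LINT x|lborel. w x * w (x + h))" by (simp add: D_def)
    also have "\<dots> \<le> (LINT x|lborel. \<bar>w x\<bar> * \<bar>w (x + h)\<bar>)"
      by (intro integral_mono i3) (simp flip: abs_mult)
    finally have "ennreal D \<le> ennreal (LINT x|lborel. \<bar>w x\<bar> * \<bar>w (x + h)\<bar>)" by (rule ennreal_leI)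
    also have "\<dots> = (\<integral>\<^sup>+x. ennreal (\<bar>w x\<bar> * \<bar>w (x + h)\<bar>) \<partial>lborel)"
      by (rule nn_integral_eq_integral[symmetric]) (use i3 in auto)
    finally show ?thesis by (simp add: ennreal_mult)
  qed
  have "ennreal (measure lborel ?B) * ennreal D = (\<integral>\<^sup>+h. indicator ?B h * ennreal D \<partial>lborel)"
    using emeasure_lborel_ball_finite[of "0::real^'n" \<delta>]
    by (subst nn_integral_multc) (auto simp: emeasure_eq_ennreal_measure intro!: borel_measurable_indicator)
  also have "\<dots> \<le> (\<integral>\<^sup>+h. (\<integral>\<^sup>+x. ennreal \<bar>w x\<bar> * ennreal \<bar>w (x + h)\<bar> \<partial>lborel) \<partial>lborel)"
    using pt by (intro nn_integral_mono) (simp add: indicator_def)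
  also have "\<dots> = (\<integral>\<^sup>+x. (\<integral>\<^sup>+h. ennreal \<bar>w x\<bar> * ennreal \<bar>w (x + h)\<bar> \<partial>lborel) \<partial>lborel)"
    by (rule pair_sigma_finite.Fubini') (unfold_locales, measurable)
  also have "\<dots> = (\<integral>\<^sup>+x. ennreal \<bar>w x\<bar> * (\<integral>\<^sup>+h. ennreal \<bar>w h\<bar> \<partial>lborel) \<partial>lborel)"
    using nn_integral_translate[of "\<lambda>x. ennreal \<bar>w x\<bar>"]
    by (intro nn_integral_cong) (simp add: nn_integral_cmult add.commute)
  also have "\<dots> = (\<integral>\<^sup>+h. ennreal \<bar>w h\<bar> \<partial>lborel) * (\<integral>\<^sup>+h. ennreal \<bar>w h\<bar> \<partial>lborel)"
    by (simp add: nn_integral_multc)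
  also have "\<dots> = ennreal ((LINT x|lborel. \<bar>w x\<bar>)\<^sup>2)"
    using nn_integral_eq_integral[OF iw(2)] by (simp add: ennreal_mult power2_eq_square)
  finally have "ennreal (measure lborel ?B * D) \<le> ennreal ((LINT x|lborel. \<bar>w x\<bar>)\<^sup>2)"
    by (simp add: ennreal_mult')
  then have "measure lborel ?B * D \<le> (LINT x|lborel. \<bar>w x\<bar>)\<^sup>2" by (subst (asm) ennreal_le_iff) simp_all
  then show ?thesis by (simp add: D_def)
qed

section \<open>Mollification in $L^2$\<close>

lemma integrable_translate:
  fixes f :: "'a::euclidean_space \<Rightarrow> real"
  assumes "integrable lborel f"
  shows "integrable lborel (\<lambda>x. f (x + h))"
proof -
  have [measurable]: "f \<in> borel_measurable borel" using borel_measurable_integrable[OF assms] by simp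
  have "integrable (distr lborel borel ((+) h)) f" using assms by (simp add: lborel_distr_plus)
  then have "integrable lborel (\<lambda>x. f (h + x))" by (subst (asm) integrable_distr_eq) measurable
  then show ?thesis by (simp add: add.commute)
qed

text \<open>The triangle inequality through \<open>g\<close>; the approximation error occurs once at
  x and once at x + h, with the same integral by translation invariance.\<close>

lemma L1_translation_comparison:
  fixes f g :: "'a::euclidean_space \<Rightarrow> real"
  assumes f: "integrable lborel f" and g: "integrable lborel g"
  shows "(LINT x|lborel. \<bar>f (x + h) - f x\<bar>) \<le> 2 * (LINT x|lborel. \<bar>g x - f x\<bar>) + (LINT x|lborel. \<bar>g (x + h) - g x\<bar>)"
proof -
  have [measurable]: "f \<in> borel_measurable borel" "g \<in> borel_measurable borel"
    using borel_measurable_integrable[OF f] borel_measurable_integrable[OF g] by simp_all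
  note i = f g integrable_translate[OF f] integrable_translate[OF g]
  have j: "integrable lborel (\<lambda>x. \<bar>g (x + h) - f (x + h)\<bar>)" "integrable lborel (\<lambda>x. \<bar>g x - f x\<bar>)"
    "integrable lborel (\<lambda>x. \<bar>g (x + h) - g x\<bar>)" "integrable lborel (\<lambda>x. \<bar>f (x + h) - f x\<bar>)"
    using i by simp_all
  have "(LINT x|lborel. \<bar>f (x + h) - f x\<bar>) \<le>
      (LINT x|lborel. \<bar>g (x + h) - f (x + h)\<bar> + \<bar>g x - f x\<bar> + \<bar>g (x + h) - g x\<bar>)"
    using j by (intro integral_mono) auto
  also have "\<dots> = (LINT x|lborel. \<bar>g (x + h) - f (x + h)\<bar>) + (LINT x|lborel. \<bar>g x - f x\<bar>) + (LINT x|lborel. \<bar>g (x + h) - g x\<bar>)"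
    using j by simp
  also have "(LINT x|lborel. \<bar>g (x + h) - f (x + h)\<bar>) = (LINT x|lborel. \<bar>g x - f x\<bar>)"
    by (rule integral_translate[of "\<lambda>x. \<bar>g x - f x\<bar>"]) measurable
  finally show ?thesis by simp
qed

text \<open>The functions with this continuity property form a closed subset of L^1, so it suffices
  to approximate. Sequences \<open>X\<close> are used instead of a limit in h because dominated
  convergence is sequential.\<close>

lemma translation_continuous_closure:
  fixes f :: "'a::euclidean_space \<Rightarrow> real"
  assumes f: "integrable lborel f"
    and ap: "\<And>e. 0 < e \<Longrightarrow> \<exists>g. integrable lborel g \<and> (LINT x|lborel. \<bar>g x - f x\<bar>) < e \<and>
      (\<lambda>n. LINT x|lborel. \<bar>g (x + X n) - g x\<bar>) \<longlonglongrightarrow> 0"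
  shows "(\<lambda>n::nat. LINT x|lborel. \<bar>f (x + X n) - f x\<bar>) \<longlonglongrightarrow> 0"
proof (rule LIMSEQ_I)
  fix e :: real assume "0 < e"
  then obtain g where g: "integrable lborel g" "(LINT x|lborel. \<bar>g x - f x\<bar>) < e / 4"
    "(\<lambda>n. LINT x|lborel. \<bar>g (x + X n) - g x\<bar>) \<longlonglongrightarrow> 0"
    using ap[of "e / 4"] by auto
  from LIMSEQ_D[OF g(3), of "e / 2"] \<open>0 < e\<close> obtain N where
    N: "\<And>n. N \<le> n \<Longrightarrow> \<bar>LINT x|lborel. \<bar>g (x + X n) - g x\<bar>\<bar> < e / 2" by auto
  have "norm ((LINT x|lborel. \<bar>f (x + X n) - f x\<bar>) - 0) < e" if "N \<le> n" for n
    using L1_translation_comparison[OF f g(1), of "X n"] N[OF that] g(2) by simp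
  then show "\<exists>N. \<forall>n\<ge>N. norm ((LINT x|lborel. \<bar>f (x + X n) - f x\<bar>) - 0) < e" by blast
qed

text \<open>The full difference has no evident integrable majorant independent of n, but its
  one-sided part, supported in \<open>U\<close>, is dominated by the indicator of \<open>U\<close>;
  it tends to 0 because a point of an open set stays in it under small shifts. As \<open>U\<close>
  and its translates have equal measure, the other side contributes the same integral, whence the
  factor 2.\<close>

lemma translation_continuous_open:
  fixes U :: "'a::euclidean_space set"
  assumes "open U" and fin: "emeasure lborel U < \<infinity>" and X: "X \<longlonglongrightarrow> 0"
  shows "(\<lambda>n::nat. LINT x|lborel. \<bar>indicat_real U (x + X n) - indicat_real U x\<bar>) \<longlonglongrightarrow> 0"
proof -
  have [measurable]: "U \<in> sets borel" using assms(1) by simp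
  have i: "integrable lborel (indicat_real U)" using fin by simp
  have m: "integrable lborel (\<lambda>x. indicat_real U (x + h))" for h
    by (rule integrable_translate[OF i])
  have j: "integrable lborel (\<lambda>x. max 0 (indicat_real U x - indicat_real U (x + h)))" for h
    using i m[of h] by (intro integrable_max) auto
  have "(\<lambda>n. LINT x|lborel. max 0 (indicat_real U x - indicat_real U (x + X n))) \<longlonglongrightarrow> (LINT (x::'a)|lborel. (0::real))"
  proof (rule integral_dominated_convergence[where w = "indicat_real U"])
    show "AE x in lborel. (\<lambda>n. max 0 (indicat_real U x - indicat_real U (x + X n))) \<longlonglongrightarrow> 0"
    proof (intro AE_I2)
      fix x
      show "(\<lambda>n. max 0 (indicat_real U x - indicat_real U (x + X n))) \<longlonglongrightarrow> 0"
      proof (cases "x \<in> U")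
        case True
        have "(\<lambda>n. x + X n) \<longlonglongrightarrow> x" using tendsto_add[OF tendsto_const X, of x] by simp
        then have "\<forall>\<^sub>F n in sequentially. x + X n \<in> U" using assms(1) True by (rule topological_tendstoD)
        then have "\<forall>\<^sub>F n in sequentially. max 0 (indicat_real U x - indicat_real U (x + X n)) = 0"
          by eventually_elim (use True in simp)
        then show ?thesis by (rule tendsto_eventually)
      qed (simp add: indicator_def)
    qed
    show "AE x in lborel. norm (max 0 (indicat_real U x - indicat_real U (x + X n))) \<le> indicat_real U x" for n
      by (auto simp: indicator_def)
  qed (use i in auto)
  moreover have "(LINT x|lborel. \<bar>indicat_real U (x + X n) - indicat_real U x\<bar>)
      = 2 * (LINT x|lborel. max 0 (indicat_real U x - indicat_real U (x + X n)))" for n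
  proof -
    have "(LINT x|lborel. \<bar>indicat_real U (x + X n) - indicat_real U x\<bar>) =
      (LINT x|lborel. 2 * max 0 (indicat_real U x - indicat_real U (x + X n)) + (indicat_real U (x + X n) - indicat_real U x))"
      by (rule Bochner_Integration.integral_cong) (auto simp: indicator_def)
    also have "\<dots> = 2 * (LINT x|lborel. max 0 (indicat_real U x - indicat_real U (x + X n)))
        + ((LINT x|lborel. indicat_real U (x + X n)) - (LINT x|lborel. indicat_real U x))"
      using i m[of "X n"] j[of "X n"] by simp
    also have "(LINT x|lborel. indicat_real U (x + X n)) = (LINT x|lborel. indicat_real U x)"
      by (rule integral_translate) measurable
    finally show ?thesis by simp
  qed
  ultimately show ?thesis using tendsto_mult_left[of _ 0 sequentially 2] by simp
qed

lemma translation_continuous_L1: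
  fixes f :: "'a::euclidean_space \<Rightarrow> real"
  assumes "integrable lborel f" and X: "X \<longlonglongrightarrow> 0"
  shows "(\<lambda>n::nat. LINT x|lborel. \<bar>f (x + X n) - f x\<bar>) \<longlonglongrightarrow> 0"
  using assms(1)
proof (induction rule: integrable_induct)
  case (base A c)
  then have A [measurable]: "A \<in> sets borel" and fin: "emeasure lborel A < \<infinity>" by auto
  have iA: "integrable lborel (indicat_real A)" using fin by simp
  have "(\<lambda>n. LINT x|lborel. \<bar>indicat_real A (x + X n) - indicat_real A x\<bar>) \<longlonglongrightarrow> 0"
  proof (rule translation_continuous_closure[OF iA])
    fix e :: real assume "0 < e"
    \<comment> \<open>Outer regularity reduces a Borel set of finite measure to the open case, with
      an L^1 error below e.\<close>
    from outer_regular_lborel[OF A this] obtain U where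
      U: "open U" "A \<subseteq> U" "emeasure lborel (U - A) < ennreal e" by metis
    have [measurable]: "U \<in> sets borel" using U(1) by simp
    have "emeasure lborel U = emeasure lborel A + emeasure lborel (U - A)"
      using U(2) by (subst plus_emeasure) (auto simp: Un_absorb1)
    then have Ufin: "emeasure lborel U < \<infinity>" using U(3) fin by (simp add: less_top[symmetric])
        (metis ennreal_less_top less_trans less_top)
    have "(LINT x|lborel. \<bar>indicat_real U x - indicat_real A x\<bar>) = (LINT x|lborel. indicat_real (U - A) x)"
      using U(2) by (intro Bochner_Integration.integral_cong) (auto simp: indicator_def)
    also have "\<dots> = measure lborel (U - A)" by simp
    also have "\<dots> < e" using U(3) \<open>0 < e\<close> unfolding measure_def
      by (metis enn2real_less_iff ennreal_less_top less_trans less_top order_less_imp_le top.not_eq_extremum)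
    finally show "\<exists>g. integrable lborel g \<and> (LINT x|lborel. \<bar>g x - indicat_real A x\<bar>) < e \<and>
      (\<lambda>n. LINT x|lborel. \<bar>g (x + X n) - g x\<bar>) \<longlonglongrightarrow> 0"
      using Ufin translation_continuous_open[OF U(1) Ufin X]
      by (intro exI[of _ "indicat_real U"]) auto
  qed
  from tendsto_mult_left[OF this, of "\<bar>c\<bar>"] show ?case
    by (simp add: abs_mult flip: left_diff_distrib integral_mult_left_zero) (simp add: mult.commute)
next
  case (add f g)
  note i = add.hyps integrable_translate[OF add.hyps(1)] integrable_translate[OF add.hyps(2)]
  show ?case
  proof (rule tendsto_sandwich[OF _ _ tendsto_const])
    have 1: "(LINT x|lborel. \<bar>f (x + h) + g (x + h) - (f x + g x)\<bar>)
      \<le> (LINT x|lborel. \<bar>f (x + h) - f x\<bar> + \<bar>g (x + h) - g x\<bar>)" for h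
      using i by (intro integral_mono) auto
    have 2: "(LINT x|lborel. \<bar>f (x + h) - f x\<bar> + \<bar>g (x + h) - g x\<bar>)
      = (LINT x|lborel. \<bar>f (x + h) - f x\<bar>) + (LINT x|lborel. \<bar>g (x + h) - g x\<bar>)" for h
      using i by (intro Bochner_Integration.integral_add) auto
    show "\<forall>\<^sub>F n in sequentially. (LINT x|lborel. \<bar>f (x + X n) + g (x + X n) - (f x + g x)\<bar>)
      \<le> (LINT x|lborel. \<bar>f (x + X n) - f x\<bar>) + (LINT x|lborel. \<bar>g (x + X n) - g x\<bar>)"
      by (intro always_eventually allI 1[unfolded 2])
    show "(\<lambda>n. (LINT x|lborel. \<bar>f (x + X n) - f x\<bar>) + (LINT x|lborel. \<bar>g (x + X n) - g x\<bar>)) \<longlonglongrightarrow> 0"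
      using tendsto_add[OF add.IH] by simp
  qed auto
next
  case (lim f s)
  have [measurable]: "f \<in> borel_measurable borel" using borel_measurable_integrable[OF lim.hyps(4)] by simp
  have [measurable]: "s i \<in> borel_measurable borel" for i
    using borel_measurable_integrable[OF lim.hyps(1)] by simp
  have "(\<lambda>i. LINT x|lborel. \<bar>s i x - f x\<bar>) \<longlonglongrightarrow> (LINT (x::'a)|lborel. (0::real))"
  \<comment> \<open>The approximants supplied by the induction rule are bounded by twice |f|, so the
    difference is bounded by three times |f|.\<close>
  proof (rule integral_dominated_convergence[where w = "\<lambda>x. 3 * \<bar>f x\<bar>"])
    show "AE x in lborel. (\<lambda>i. \<bar>s i x - f x\<bar>) \<longlonglongrightarrow> 0"
      using lim.hyps(2) by (auto intro!: AE_I2 tendsto_rabs_zero simp: LIM_zero_iff)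
    show "AE x in lborel. norm \<bar>s i x - f x\<bar> \<le> 3 * \<bar>f x\<bar>" for i
    proof (intro AE_I2)
      fix x
      show "norm \<bar>s i x - f x\<bar> \<le> 3 * \<bar>f x\<bar>"
        using lim.hyps(3)[of x i] by simp
    qed
  qed (use lim.hyps(4) in auto)
  then have l: "(\<lambda>i. LINT x|lborel. \<bar>s i x - f x\<bar>) \<longlonglongrightarrow> 0" by simp
  show ?case
  proof (rule translation_continuous_closure[OF lim.hyps(4)])
    fix e :: real assume "0 < e"
    from LIMSEQ_D[OF l this] obtain i where "(LINT x|lborel. \<bar>s i x - f x\<bar>) < e" by auto
    with lim.hyps(1) lim.IH show "\<exists>g. integrable lborel g \<and> (LINT x|lborel. \<bar>g x - f x\<bar>) < e \<and>
      (\<lambda>n. LINT x|lborel. \<bar>g (x + X n) - g x\<bar>) \<longlonglongrightarrow> 0" by blast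
  qed
qed

text \<open>Continuity of translations in $L^2$ follows from that in $L^1$, applied to $g|g|$.\<close>

lemma square_diff_le_signed_squares:
  fixes a b :: real
  shows "(a - b)\<^sup>2 \<le> 2 * \<bar>a * \<bar>a\<bar> - b * \<bar>b\<bar>\<bar>"
proof -
  have same: "(a - b)\<^sup>2 \<le> \<bar>a * a - b * b\<bar>" if "0 \<le> a * b" for a b :: real
  proof -
    have "\<bar>a - b\<bar> \<le> \<bar>a + b\<bar>" using that by (auto simp: zero_le_mult_iff abs_if)
    then have "\<bar>a - b\<bar> * \<bar>a - b\<bar> \<le> \<bar>a - b\<bar> * \<bar>a + b\<bar>" by (intro mult_left_mono) auto
    also have "\<dots> = \<bar>a * a - b * b\<bar>" by (simp add: algebra_simps flip: abs_mult)
    finally show ?thesis by (simp add: power2_eq_square)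
  qed
  have opp: "(a - b)\<^sup>2 \<le> 2 * (a * a + b * b)"
    using zero_le_power2[of "a + b"] by (simp add: power2_eq_square algebra_simps)
  show ?thesis
  proof (cases "0 \<le> a * b")
    case True
    then have "\<bar>a * \<bar>a\<bar> - b * \<bar>b\<bar>\<bar> = \<bar>a * a - b * b\<bar>"
      by (auto simp: zero_le_mult_iff)
    then show ?thesis by (simp only:) (rule order_trans[OF same[OF True]], simp)
  next
    case False
    then have "\<bar>a * \<bar>a\<bar> - b * \<bar>b\<bar>\<bar> = a * a + b * b"
      by (auto simp: not_le mult_less_0_iff)
    with opp show ?thesis by simp
  qed
qed

lemma translation_continuous_L2:
  fixes g :: "'a::euclidean_space \<Rightarrow> real"
  assumes [measurable]: "g \<in> borel_measurable borel" and g2: "integrable lborel (\<lambda>x. (g x)\<^sup>2)" and X: "X \<longlonglongrightarrow> 0"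
  shows "(\<lambda>n::nat. LINT x|lborel. (g (x + X n) - g x)\<^sup>2) \<longlonglongrightarrow> 0"
proof -
  define f where "f x = g x * \<bar>g x\<bar>" for x
  have [measurable]: "f \<in> borel_measurable borel" unfolding f_def by measurable
  have f: "integrable lborel f"
    by (rule Bochner_Integration.integrable_bound[OF g2]) (auto simp: f_def abs_mult power2_eq_square)
  have i: "integrable lborel (\<lambda>x. 2 * \<bar>f (x + h) - f x\<bar>)" for h
    using f integrable_translate[OF f, of h] by simp
  have b: "(g (x + h) - g x)\<^sup>2 \<le> 2 * \<bar>f (x + h) - f x\<bar>" for x h
    unfolding f_def by (rule square_diff_le_signed_squares)
  have "integrable lborel (\<lambda>x. (g (x + h) - g x)\<^sup>2)" for h
    by (rule Bochner_Integration.integrable_bound[OF i[of h]]) (use b in auto)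
  then have "(LINT x|lborel. (g (x + h) - g x)\<^sup>2) \<le> (LINT x|lborel. 2 * \<bar>f (x + h) - f x\<bar>)" for h
    by (intro integral_mono i b)
  then have le: "(LINT x|lborel. (g (x + h) - g x)\<^sup>2) \<le> 2 * (LINT x|lborel. \<bar>f (x + h) - f x\<bar>)" for h
    by (simp only: integral_mult_right_zero)
  have l: "(\<lambda>n. 2 * (LINT x|lborel. \<bar>f (x + X n) - f x\<bar>)) \<longlonglongrightarrow> 0"
    using tendsto_mult_left[OF translation_continuous_L1[OF f X], of 2] by simp
  show ?thesis
    by (rule tendsto_sandwich[OF _ _ tendsto_const l]) (simp_all add: le)
qed

text \<open>The classical bump exp(-1/(\<epsilon>^2 - |x|^2)) on the ball of radius \<epsilon>,
  normalised to integral 1. Using the squared norm keeps it smooth at the origin.\<close>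

definition mollifier :: "real \<Rightarrow> real ^ 'n::finite \<Rightarrow> real" where
  "mollifier \<epsilon> x = flat 0 (\<epsilon>\<^sup>2 - (norm x)\<^sup>2) / (LINT y|lborel. flat 0 (\<epsilon>\<^sup>2 - (norm (y::real^'n))\<^sup>2))"

lemma smooth_mollifier_shift: "smooth (\<lambda>x. mollifier \<epsilon> (x - c))"
  unfolding mollifier_def divide_inverse
  by (intro smooth_mult smooth_flat smooth_diff smooth_const smooth_dist_sq)

lemma mollifier_vanishing:
  assumes "0 < \<epsilon>" "\<epsilon> \<le> norm x" shows "mollifier \<epsilon> x = 0"
proof -
  have "\<epsilon>\<^sup>2 \<le> (norm x)\<^sup>2" using assms by (intro power_mono) auto
  then show ?thesis by (simp add: mollifier_def flat_def)
qed

lemma mollifier_minus: "mollifier \<epsilon> (x - y) = mollifier \<epsilon> (y - x)"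
  by (simp add: mollifier_def norm_minus_commute)

lemma mollifier_normalizer_pos:
  assumes "0 < \<epsilon>" shows "0 < (LINT y|lborel. flat 0 (\<epsilon>\<^sup>2 - (norm (y::real^'n::finite))\<^sup>2))"
proof -
  let ?f = "\<lambda>y::real^'n. flat 0 (\<epsilon>\<^sup>2 - (norm y)\<^sup>2)"
  have s: "smooth ?f"
    using smooth_flat[OF smooth_diff[OF smooth_const smooth_dist_sq[of 0]], of 0 "\<epsilon>\<^sup>2"] by simp
  have "flat 0 (\<epsilon>\<^sup>2 - (norm y)\<^sup>2) = 0" if "\<epsilon> < norm y" for y :: "real^'n"
    using power_mono[of \<epsilon> "norm y" 2] that assms by (auto simp: flat_def not_less)
  then have i: "integrable lborel ?f"
    by (intro integrable_vanishing[where r = \<epsilon>] smooth_continuous[OF s]) simp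
  define m where "m = flat 0 (\<epsilon>\<^sup>2 - (\<epsilon>/2)\<^sup>2)"
  have m: "0 < m" unfolding m_def using assms by (intro flat_pos) (simp add: power2_eq_square)
  have mono: "flat 0 a \<le> flat 0 b" if "a \<le> b" for a b
    using that by (auto simp: flat_def frac_le)
  have "m * measure lborel (ball (0::real^'n) (\<epsilon>/2)) = (LINT y|lborel. m * indicator (ball (0::real^'n) (\<epsilon>/2)) y)"
    by simp
  also have "\<dots> \<le> (LINT y|lborel. ?f y)"
  proof (intro integral_mono i)
    show "integrable lborel (\<lambda>y. m * indicator (ball (0::real^'n) (\<epsilon>/2)) y)"
      by (intro integrable_mult_right integrable_real_indicator emeasure_lborel_ball_finite) auto
    show "m * indicator (ball 0 (\<epsilon>/2)) y \<le> ?f y" for y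
    proof (cases "norm y < \<epsilon> / 2")
      case True
      then have "(norm y)\<^sup>2 \<le> (\<epsilon>/2)\<^sup>2" by (intro power_mono) auto
      then show ?thesis using True by (auto simp: m_def intro!: mono)
    qed (simp add: flat_nonneg)
  qed
  finally show ?thesis using m assms
    by (smt (verit) content_ball_gt_0_iff half_gt_zero mult_pos_pos)
qed

lemma mollifier_nonneg: "0 \<le> mollifier \<epsilon> x"
  by (simp add: mollifier_def flat_nonneg)

lemma smooth_mollifier: "smooth (mollifier \<epsilon>)"
  using smooth_mollifier_shift[of \<epsilon> 0] by simp

lemma integrable_mollifier: "0 < \<epsilon> \<Longrightarrow> integrable lborel (mollifier \<epsilon> :: real ^ 'n::finite \<Rightarrow> real)"
  by (intro integrable_vanishing[where r = \<epsilon>] smooth_continuous smooth_mollifier)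
    (auto intro: mollifier_vanishing)

lemma integral_mollifier: "0 < \<epsilon> \<Longrightarrow> (LINT y|lborel. mollifier \<epsilon> (y::real^'n::finite)) = 1"
  using mollifier_normalizer_pos[of \<epsilon>, where 'n = 'n] by (simp add: mollifier_def)

lemma integral_mollifier_reflect:
  assumes "0 < \<epsilon>"
  shows "integrable lborel (\<lambda>y::real^'n::finite. mollifier \<epsilon> (x - y))" "(LINT y|lborel. mollifier \<epsilon> (x - y::real^'n)) = 1"
proof -
  have m: "mollifier \<epsilon> \<in> borel_measurable (borel :: (real^'n) measure)"
    using smooth_continuous[OF smooth_mollifier] by (rule borel_measurable_continuous_onI)
  show "(LINT y|lborel. mollifier \<epsilon> (x - y::real^'n)) = 1"
    using integral_reflect_translate[OF m] integral_mollifier[OF assms] by simp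
  \<comment> \<open>A nonintegrable function has Bochner integral 0, so the value 1 already yields
    integrability.\<close>
  then show "integrable lborel (\<lambda>y::real^'n. mollifier \<epsilon> (x - y))"
    using not_integrable_integral_eq by force
qed

lemma conv_mollifier_integrable:
  fixes v :: "real^'n::finite \<Rightarrow> real"
  assumes "0 < \<epsilon>" "integrable lborel v"
  shows "integrable lborel (\<lambda>y. v y * mollifier \<epsilon> (x - y))"
proof -
  have "\<forall>x::real^'n. \<epsilon> < norm x \<longrightarrow> mollifier \<epsilon> x = 0"
    by (auto intro: mollifier_vanishing[OF assms(1)])
  from integrable_scaleR_vanishing[OF assms(2) smooth_continuous[OF smooth_mollifier] this]
  show ?thesis by simp
qed

lemma conv_mollifier_close:
  fixes v :: "real^'n::finite \<Rightarrow> real"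
  assumes e: "0 < \<epsilon>" and v: "integrable lborel v" and c: "\<And>y. norm (x - y) < \<epsilon> \<Longrightarrow> \<bar>v y - a\<bar> \<le> e"
  shows "\<bar>conv v (mollifier \<epsilon>) x - a\<bar> \<le> e"
proof -
  note i = conv_mollifier_integrable[OF e v, of x] integral_mollifier_reflect[OF e, of x]
  have "conv v (mollifier \<epsilon>) x - a = (LINT y|lborel. v y * mollifier \<epsilon> (x - y) - a * mollifier \<epsilon> (x - y))"
    using i by (simp add: conv_def)
  also have "\<bar>\<dots>\<bar> \<le> (LINT y|lborel. e * mollifier \<epsilon> (x - y))"
  proof (rule integral_abs_bound_integral)
    show "\<bar>v y * mollifier \<epsilon> (x - y) - a * mollifier \<epsilon> (x - y)\<bar> \<le> e * mollifier \<epsilon> (x - y)" for y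
      using c[of y] mollifier_vanishing[OF e, of "x - y"] mollifier_nonneg[of \<epsilon> "x - y"]
      by (cases "norm (x - y) < \<epsilon>") (auto simp: abs_mult mult_right_mono simp flip: left_diff_distrib)
  qed (use i in auto)
  also have "\<dots> = e" using i by simp
  finally show ?thesis .
qed

lemma conv_mollifier_le:
  fixes v :: "real^'n::finite \<Rightarrow> real"
  assumes e: "0 < \<epsilon>" and v: "integrable lborel v" and le: "\<And>y. v y \<le> T"
  shows "conv v (mollifier \<epsilon>) x \<le> T"
proof -
  note i = conv_mollifier_integrable[OF e v, of x] integral_mollifier_reflect[OF e, of x]
  have "conv v (mollifier \<epsilon>) x \<le> (LINT y|lborel. T * mollifier \<epsilon> (x - y))"
    unfolding conv_def using i le mollifier_nonneg by (intro integral_mono mult_right_mono) auto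
  then show ?thesis using i by simp
qed

lemma conv_mollifier_ge:
  fixes v :: "real^'n::finite \<Rightarrow> real"
  assumes e: "0 < \<epsilon>" and v: "integrable lborel v" and le: "\<And>y. T \<le> v y"
  shows "T \<le> conv v (mollifier \<epsilon>) x"
proof -
  note i = conv_mollifier_integrable[OF e v, of x] integral_mollifier_reflect[OF e, of x]
  have "(LINT y|lborel. T * mollifier \<epsilon> (x - y)) \<le> conv v (mollifier \<epsilon>) x"
    unfolding conv_def using i le mollifier_nonneg by (intro integral_mono mult_right_mono) auto
  then show ?thesis using i by simp
qed

lemma conv_mollifier_tendsto:
  fixes v :: "real^'n::finite \<Rightarrow> real"
  assumes v: "integrable lborel v" and c: "isCont v x" and \<epsilon>: "\<And>n. 0 < \<epsilon> n" "\<epsilon> \<longlonglongrightarrow> 0"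
  shows "(\<lambda>n::nat. conv v (mollifier (\<epsilon> n)) x) \<longlonglongrightarrow> v x"
proof (rule LIMSEQ_I)
  fix e :: real assume "0 < e"
  then obtain d where d: "0 < d" "\<And>y. dist y x < d \<Longrightarrow> dist (v y) (v x) < e / 2"
    using c unfolding continuous_at_eps_delta by (metis half_gt_zero)
  from LIMSEQ_D[OF \<epsilon>(2) d(1)] obtain N where N: "\<And>n. N \<le> n \<Longrightarrow> \<epsilon> n < d" using \<epsilon>(1) by force
  have "norm (conv v (mollifier (\<epsilon> n)) x - v x) < e" if "N \<le> n" for n
  proof -
    have "\<bar>conv v (mollifier (\<epsilon> n)) x - v x\<bar> \<le> e / 2"
    proof (rule conv_mollifier_close[OF \<epsilon>(1) v])
      fix y assume "norm (x - y) < \<epsilon> n"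
      then have "dist y x < d" using N[OF that] by (simp add: dist_norm norm_minus_commute)
      from d(2)[OF this] show "\<bar>v y - v x\<bar> \<le> e / 2" by (simp add: dist_norm)
    qed
    then show ?thesis using \<open>0 < e\<close> by simp
  qed
  then show "\<exists>N. \<forall>n\<ge>N. norm (conv v (mollifier (\<epsilon> n)) x - v x) < e" by blast
qed

text \<open>The mollified function is an average of the translates g(x - h) with weight
  \<open>mollifier \<epsilon> h\<close>. The variance inequality moves the square inside the
  average, and after exchanging the integrals only shifts with |h| < \<epsilon> carry
  weight.\<close>

lemma conv_mollifier_L2_le:
  fixes g :: "real^'n::finite \<Rightarrow> real"
  assumes e: "0 < \<epsilon>" and g: "integrable lborel g" "integrable lborel (\<lambda>x. (g x)\<^sup>2)"
    and le: "\<And>h. norm h < \<epsilon> \<Longrightarrow> (LINT x|lborel. (g (x + h) - g x)\<^sup>2) \<le> \<eta>"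
  shows "(\<integral>\<^sup>+x. ennreal ((conv g (mollifier \<epsilon>) x - g x)\<^sup>2) \<partial>lborel) \<le> ennreal \<eta>"
proof -
  let ?k = "mollifier \<epsilon> :: real^'n \<Rightarrow> real"
  have [measurable]: "g \<in> borel_measurable borel" using borel_measurable_integrable[OF g(1)] by simp
  have [measurable]: "?k \<in> borel_measurable borel"
    using smooth_continuous[OF smooth_mollifier] by (rule borel_measurable_continuous_onI)
  note ik = integrable_mollifier[OF e, where 'n = 'n] integral_mollifier[OF e, where 'n = 'n]
  have cv: "conv g ?k x = (LINT h|lborel. ?k h * g (x - h))" for x
  proof -
    have "(LINT h|lborel. ?k h * g (x - h)) = (LINT y|lborel. (\<lambda>h. ?k h * g (x - h)) (x - y))"
      by (rule integral_reflect_translate[symmetric]) measurable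
    then show ?thesis by (simp add: conv_def mult.commute)
  qed
  have ikg: "integrable lborel (\<lambda>h. ?k h * g (x - h))" for x
  proof -
    have "integrable (distr lborel borel (\<lambda>y. x - y)) g" using g(1) by (simp add: lborel_distr_reflect)
    then have "integrable lborel (\<lambda>h. g (x - h))" by (subst (asm) integrable_distr_eq) measurable
    from conv_mollifier_integrable[OF e this, of 0] show ?thesis
      by (simp add: mult.commute mollifier_minus[of _ 0, simplified])
  qed
  have "(\<integral>\<^sup>+x. ennreal ((conv g ?k x - g x)\<^sup>2) \<partial>lborel)
    \<le> (\<integral>\<^sup>+x. (\<integral>\<^sup>+h. ennreal (?k h) * ennreal ((g (x - h) - g x)\<^sup>2) \<partial>lborel) \<partial>lborel)"
  proof (rule nn_integral_mono)
    fix x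
    let ?R = "\<integral>\<^sup>+h. ennreal (?k h * (g (x - h) - g x)\<^sup>2) \<partial>lborel"
    have "ennreal ((conv g ?k x - g x)\<^sup>2) \<le> ?R"
    \<comment> \<open>If the weighted square integral is infinite, the bound at this x is trivial;
      finiteness therefore need not be established point by point.\<close>
    proof (cases "?R = \<infinity>")
      case False
      have i2: "integrable lborel (\<lambda>h. ?k h * (g (x - h) - g x)\<^sup>2)"
        using False by (intro integrableI_nonneg) (auto simp: mollifier_nonneg top.not_eq_extremum)
      have i1: "integrable lborel (\<lambda>h. ?k h * (g (x - h) - g x))"
        using ikg[of x] ik by (simp add: right_diff_distrib)
      have "conv g ?k x - g x = (LINT h|lborel. ?k h * (g (x - h) - g x))"
        using ikg[of x] ik by (simp add: cv right_diff_distrib)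
      then have "(conv g ?k x - g x)\<^sup>2 \<le> (LINT h|lborel. ?k h * (g (x - h) - g x)\<^sup>2)"
        using integral_square_le[OF ik mollifier_nonneg i1 i2] by simp
      also have "ennreal \<dots> = ?R"
        by (rule nn_integral_eq_integral[symmetric, OF i2]) (simp add: mollifier_nonneg)
      finally show ?thesis using ennreal_leI by blast
    qed simp
    then show "ennreal ((conv g ?k x - g x)\<^sup>2) \<le> (\<integral>\<^sup>+h. ennreal (?k h) * ennreal ((g (x - h) - g x)\<^sup>2) \<partial>lborel)"
      by (simp add: ennreal_mult mollifier_nonneg)
  qed
  also have "\<dots> = (\<integral>\<^sup>+h. (\<integral>\<^sup>+x. ennreal (?k h) * ennreal ((g (x - h) - g x)\<^sup>2) \<partial>lborel) \<partial>lborel)"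
    by (rule pair_sigma_finite.Fubini') (unfold_locales, measurable)
  also have "\<dots> \<le> (\<integral>\<^sup>+h. ennreal (?k h) * ennreal \<eta> \<partial>lborel)"
  proof (rule nn_integral_mono)
    fix h :: "real^'n"
    show "(\<integral>\<^sup>+x. ennreal (?k h) * ennreal ((g (x - h) - g x)\<^sup>2) \<partial>lborel) \<le> ennreal (?k h) * ennreal \<eta>"
    proof (cases "norm h < \<epsilon>")
      case True
      have "integrable lborel (\<lambda>x. (g (x + - h))\<^sup>2)"
        by (rule integrable_translate[OF g(2)])
      then have "integrable lborel (\<lambda>x. 2 * (g (x + - h))\<^sup>2 + 2 * (g x)\<^sup>2)" using g(2) by simp
      then have "integrable lborel (\<lambda>x. (g (x + - h) - g x)\<^sup>2)"
      proof (rule Bochner_Integration.integrable_bound)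
        have "(a - b)\<^sup>2 \<le> 2 * a\<^sup>2 + 2 * b\<^sup>2" for a b :: real
          using zero_le_power2[of "a + b"] by (simp add: power2_eq_square algebra_simps)
        then show "AE x in lborel. norm ((g (x + - h) - g x)\<^sup>2) \<le> norm (2 * (g (x + - h))\<^sup>2 + 2 * (g x)\<^sup>2)"
          by (intro AE_I2) simp
      qed measurable
      then have "(\<integral>\<^sup>+x. ennreal ((g (x + - h) - g x)\<^sup>2) \<partial>lborel) = ennreal (LINT x|lborel. (g (x + - h) - g x)\<^sup>2)"
        by (intro nn_integral_eq_integral) auto
      also have "\<dots> \<le> ennreal \<eta>" using le[of "- h"] True by (intro ennreal_leI) simp
      finally show ?thesis by (simp add: nn_integral_cmult mult_left_mono)
    qed (simp add: mollifier_vanishing[OF e])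
  qed
  also have "\<dots> = ennreal \<eta>"
    using ik nn_integral_eq_integral[OF ik(1)] by (simp add: nn_integral_multc mollifier_nonneg)
  finally show ?thesis .
qed

lemma conv_mollifier_L2:
  fixes g :: "real^'n::finite \<Rightarrow> real"
  assumes g: "integrable lborel g" "integrable lborel (\<lambda>x. (g x)\<^sup>2)"
    and \<epsilon>: "\<And>n. 0 < \<epsilon> n" "\<epsilon> \<longlonglongrightarrow> 0"
  shows "(\<lambda>n::nat. \<integral>\<^sup>+x. ennreal ((conv g (mollifier (\<epsilon> n)) x - g x)\<^sup>2) \<partial>lborel) \<longlonglongrightarrow> 0"
proof (rule order_tendstoI)
  fix a :: ennreal assume "0 < a"
  then obtain e where e: "0 < e" "ennreal e < a"
    by (metis dense ennreal_cases ennreal_less_zero_iff not_less_zero order_le_less top.not_eq_extremum)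
  have [measurable]: "g \<in> borel_measurable borel" using borel_measurable_integrable[OF g(1)] by simp
  have "((\<lambda>h. LINT x|lborel. (g (x + h) - g x)\<^sup>2) \<longlongrightarrow> 0) (at 0)"
    unfolding tendsto_at_iff_sequentially comp_def
    using translation_continuous_L2[OF _ g(2)] by auto
  from tendstoD[OF this e(1)] obtain d where d: "0 < d"
    "\<And>h. h \<noteq> 0 \<Longrightarrow> norm h < d \<Longrightarrow> (LINT x|lborel. (g (x + h) - g x)\<^sup>2) < e"
    by (auto simp: eventually_at)
  \<comment> \<open>The limit at 0 says nothing about h = 0 itself, where the integral is simply
    0.\<close>
  have le: "(LINT x|lborel. (g (x + h) - g x)\<^sup>2) \<le> e" if "norm h < d" for h
    using d(2)[of h] that e(1) by (cases "h = 0") auto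
  have "\<forall>\<^sub>F n in sequentially. \<epsilon> n < d" using \<epsilon>(2) d(1) by (rule order_tendstoD(2))
  then show "\<forall>\<^sub>F n in sequentially. (\<integral>\<^sup>+x. ennreal ((conv g (mollifier (\<epsilon> n)) x - g x)\<^sup>2) \<partial>lborel) < a"
  proof eventually_elim
    case (elim n)
    have "(\<integral>\<^sup>+x. ennreal ((conv g (mollifier (\<epsilon> n)) x - g x)\<^sup>2) \<partial>lborel) \<le> ennreal e"
      by (rule conv_mollifier_L2_le[OF \<epsilon>(1) g]) (use le elim in auto)
    also have "\<dots> < a" by (rule e(2))
    finally show ?case .
  qed
qed simp

section \<open>Truncations as test functions\<close>

text \<open>$p e^{-a/p}$ for $p > 0$: a smooth substitute for the positive part, with slope in $[0,1]$. Unlike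
  a mollified positive part it has exactly the same support, and it exceeds $p/e$ for $p \ge a$.\<close>

definition soft_pos :: "real \<Rightarrow> real \<Rightarrow> real" where
  "soft_pos a p = p * flat 0 (p / a)"

text \<open>Differentiating p e^{-a/p} gives (1 + a/p) e^{-a/p}. It is at most 1 because 1 + y <=
  e^y.\<close>

definition soft_pos_deriv :: "real \<Rightarrow> real \<Rightarrow> real" where
  "soft_pos_deriv a p = flat 0 (p / a) + flat 1 (p / a)"

lemma soft_pos_has_derivative:
  "0 < a \<Longrightarrow> (soft_pos a has_real_derivative soft_pos_deriv a p) (at p)"
proof -
  assume a: "0 < a"
  have "((\<lambda>p. flat 0 (p / a)) has_real_derivative flat 2 (p / a) * (1 / a)) (at p)"
    using DERIV_chain2[OF flat_has_derivative[of 0] DERIV_cdivide[OF DERIV_ident, of a], of p]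
    by (simp add: numeral_2_eq_2)
  from DERIV_mult[OF DERIV_ident this]
  have "((\<lambda>p. p * flat 0 (p / a)) has_real_derivative 1 * flat 0 (p / a) + flat 2 (p / a) * (1 / a) * p) (at p)" .
  moreover have "flat 2 (p / a) * (1 / a) * p = flat 1 (p / a)"
    using flat_Suc[of "p / a" 1] by (simp add: mult.commute numeral_2_eq_2)
  ultimately show ?thesis by (simp add: soft_pos_def[abs_def] soft_pos_deriv_def)
qed

lemma soft_pos_deriv_nonneg: "0 \<le> soft_pos_deriv a p"
  by (simp add: soft_pos_deriv_def flat_nonneg)

lemma soft_pos_deriv_le_1: "soft_pos_deriv a p \<le> 1"
proof (cases "0 < p / a")
  case True
  then have "soft_pos_deriv a p = (1 + 1 / (p / a)) * exp (- (1 / (p / a)))"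
    by (simp add: soft_pos_deriv_def flat_def algebra_simps)
  also have "\<dots> \<le> exp (1 / (p / a)) * exp (- (1 / (p / a)))"
    by (intro mult_right_mono exp_ge_add_one_self) auto
  finally show ?thesis by (simp flip: exp_add)
qed (simp add: soft_pos_deriv_def flat_def)

lemma soft_pos_nonneg: "0 < a \<Longrightarrow> 0 \<le> soft_pos a p"
  by (auto simp: soft_pos_def flat_def zero_less_divide_iff)

lemma soft_pos_eq_0: "0 < a \<Longrightarrow> p \<le> 0 \<Longrightarrow> soft_pos a p = 0"
  by (auto simp: soft_pos_def flat_def zero_less_divide_iff)

lemma soft_pos_deriv_eq_0: "0 < a \<Longrightarrow> p \<le> 0 \<Longrightarrow> soft_pos_deriv a p = 0"
  by (auto simp: soft_pos_deriv_def flat_def zero_less_divide_iff)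

lemma soft_pos_ge:
  assumes "0 < a" "a \<le> p" shows "a * exp (- 1) \<le> soft_pos a p"
proof -
  have "a * exp (- 1) \<le> p * exp (- (1 / (p / a)))"
    using assms by (intro mult_mono) auto
  then show ?thesis using assms by (simp add: soft_pos_def flat_def)
qed

lemma soft_pos_lipschitz: "0 < a \<Longrightarrow> \<bar>soft_pos a p - soft_pos a q\<bar> \<le> \<bar>p - q\<bar>"
  using field_differentiable_bound[of UNIV "soft_pos a" "soft_pos_deriv a" 1 p q]
    soft_pos_has_derivative soft_pos_deriv_nonneg[of a] soft_pos_deriv_le_1[of a] by simp

lemma smooth_soft_pos: "smooth \<phi> \<Longrightarrow> smooth (\<lambda>x. soft_pos a (\<phi> x))"
  unfolding soft_pos_def divide_inverse by (intro smooth_mult smooth_flat smooth_const)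

lemma continuous_soft_pos: "continuous_on S (soft_pos a)" "continuous_on S (soft_pos_deriv a)"
  unfolding soft_pos_def soft_pos_deriv_def divide_inverse
  by (intro continuous_intros continuous_on_compose2[OF continuous_flat[of UNIV]]; simp)+

lemma borel_measurable_soft_pos [measurable]:
  "soft_pos a \<in> borel_measurable borel" "soft_pos_deriv a \<in> borel_measurable borel"
  by (intro borel_measurable_continuous_onI continuous_soft_pos)+

lemma test_functionI:
  assumes "smooth \<psi>" "\<And>x. s < norm (x - z) \<Longrightarrow> \<psi> x = 0" "cball z s \<subseteq> U"
  shows "\<psi> \<in> test_functions U"
proof -
  have "{x. \<psi> x \<noteq> 0} \<subseteq> cball z s"
    using assms(2) by (force simp: dist_norm norm_minus_commute not_le[symmetric])
  then have c: "closure {x. \<psi> x \<noteq> 0} \<subseteq> cball z s" by (intro closure_minimal) auto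
  then have "compact (closure {x. \<psi> x \<noteq> 0})"
    by (meson bounded_cball bounded_subset closed_closure compact_eq_bounded_closed)
  with c assms show ?thesis by (auto simp: test_functions_def smooth_def)
qed

section \<open>Limits in L^2, and the passage between \<open>lebesgue_on U\<close> and
  \<open>lborel\<close>\<close>

lemma L2_cauchy_schwarz:
  fixes f g :: "'b \<Rightarrow> real"
  assumes [measurable]: "f \<in> borel_measurable M" "g \<in> borel_measurable M"
    and f: "integrable M (\<lambda>x. (f x)\<^sup>2)" and g: "integrable M (\<lambda>x. (g x)\<^sup>2)"
  shows "integrable M (\<lambda>x. f x * g x)"
    and "(LINT x|M. f x * g x)\<^sup>2 \<le> (LINT x|M. (f x)\<^sup>2) * (LINT x|M. (g x)\<^sup>2)"
proof -
  have "integrable M (\<lambda>x. (f x)\<^sup>2 + (g x)\<^sup>2)" using f g by simp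
  then show i: "integrable M (\<lambda>x. f x * g x)"
  proof (rule Bochner_Integration.integrable_bound)
    have "\<bar>a * b\<bar> \<le> a\<^sup>2 + b\<^sup>2" for a b :: real
      using sum_squares_bound[of "\<bar>a\<bar>" "\<bar>b\<bar>"] abs_ge_zero[of "a * b"]
      unfolding abs_mult power2_abs by linarith
    then show "AE x in M. norm (f x * g x) \<le> norm ((f x)\<^sup>2 + (g x)\<^sup>2)" by simp
  qed measurable
  define a b c where "a = (LINT x|M. (f x)\<^sup>2)" and "b = (LINT x|M. f x * g x)" and "c = (LINT x|M. (g x)\<^sup>2)"
  have q: "0 \<le> a - 2 * t * b + t\<^sup>2 * c" for t
  proof -
    have "0 \<le> (LINT x|M. (f x - t * g x)\<^sup>2)" by simp
    also have "\<dots> = (LINT x|M. (f x)\<^sup>2 - 2 * t * (f x * g x) + t\<^sup>2 * (g x)\<^sup>2)"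
      by (rule Bochner_Integration.integral_cong) (auto simp: power2_eq_square algebra_simps)
    also have "\<dots> = a - 2 * t * b + t\<^sup>2 * c" using f g i by (simp add: a_def b_def c_def)
    finally show ?thesis .
  qed
  have "0 \<le> c" by (simp add: c_def)
  show "b\<^sup>2 \<le> a * c"
  proof (cases "c = 0")
    case True
    have "b = 0"
    proof (rule ccontr)
      assume "b \<noteq> 0"
      \<comment> \<open>For c = 0 the quadratic degenerates to an affine function of t, and this t
        gives it the value -1.\<close>
      then show False using q[of "(a + 1) / (2 * b)"] True by (simp add: field_simps)
    qed
    then show ?thesis using True by simp
  next
    case False
    with \<open>0 \<le> c\<close> have "0 < c" by simp
    have "0 \<le> a - b\<^sup>2 / c"
      using q[of "b / c"] \<open>0 < c\<close> by (simp add: power2_eq_square field_simps)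
    then show ?thesis using \<open>0 < c\<close> by (simp add: field_simps)
  qed
qed

lemma L2_tendsto_inner:
  fixes f :: "nat \<Rightarrow> 'b \<Rightarrow> real"
  assumes [measurable]: "\<And>n. f n \<in> borel_measurable M" "F \<in> borel_measurable M" "g \<in> borel_measurable M"
    and f2: "\<And>n. integrable M (\<lambda>x. (f n x)\<^sup>2)" and F2: "integrable M (\<lambda>x. (F x)\<^sup>2)"
    and g2: "integrable M (\<lambda>x. (g x)\<^sup>2)" and l: "(\<lambda>n. LINT x|M. (f n x - F x)\<^sup>2) \<longlonglongrightarrow> 0"
  shows "(\<lambda>n. LINT x|M. f n x * g x) \<longlonglongrightarrow> (LINT x|M. F x * g x)"
proof -
  have d2: "integrable M (\<lambda>x. (f n x - F x)\<^sup>2)" for n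
  proof -
    have "integrable M (\<lambda>x. (f n x)\<^sup>2 - 2 * (f n x * F x) + (F x)\<^sup>2)"
      using f2 F2 L2_cauchy_schwarz(1)[OF _ _ f2 F2] by simp
    moreover have "(\<lambda>x. (f n x)\<^sup>2 - 2 * (f n x * F x) + (F x)\<^sup>2) = (\<lambda>x. (f n x - F x)\<^sup>2)"
      by (auto simp: power2_diff)
    ultimately show ?thesis by simp
  qed
  have "(\<lambda>n. (LINT x|M. (f n x - F x) * g x)\<^sup>2) \<longlonglongrightarrow> 0"
  proof (rule tendsto_sandwich[OF _ _ tendsto_const])
    show "\<forall>\<^sub>F n in sequentially. (LINT x|M. (f n x - F x) * g x)\<^sup>2 \<le> (LINT x|M. (f n x - F x)\<^sup>2) * (LINT x|M. (g x)\<^sup>2)"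
      by (intro always_eventually allI L2_cauchy_schwarz(2) d2 g2) auto
    show "(\<lambda>n. (LINT x|M. (f n x - F x)\<^sup>2) * (LINT x|M. (g x)\<^sup>2)) \<longlonglongrightarrow> 0"
      using tendsto_mult_right[OF l] by simp
  qed simp
  then have "(\<lambda>n. LINT x|M. (f n x - F x) * g x) \<longlonglongrightarrow> 0" by (simp add: tendsto_null_power)
  moreover have "(LINT x|M. (f n x - F x) * g x) = (LINT x|M. f n x * g x) - (LINT x|M. F x * g x)" for n
    using L2_cauchy_schwarz(1)[OF _ _ f2 g2] L2_cauchy_schwarz(1)[OF _ _ F2 g2]
    by (simp add: left_diff_distrib)
  ultimately show ?thesis by (simp add: LIM_zero_iff)
qed

lemma L2_tendsto_square:
  fixes f :: "nat \<Rightarrow> 'b \<Rightarrow> real"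
  assumes [measurable]: "\<And>n. f n \<in> borel_measurable M" "F \<in> borel_measurable M"
    and f2: "\<And>n. integrable M (\<lambda>x. (f n x)\<^sup>2)" and F2: "integrable M (\<lambda>x. (F x)\<^sup>2)"
    and l: "(\<lambda>n. LINT x|M. (f n x - F x)\<^sup>2) \<longlonglongrightarrow> 0"
  shows "(\<lambda>n. LINT x|M. (f n x)\<^sup>2) \<longlonglongrightarrow> (LINT x|M. (F x)\<^sup>2)"
proof -
  have i: "integrable M (\<lambda>x. f n x * F x)" for n
    using L2_cauchy_schwarz(1)[OF _ _ f2 F2] by simp
  have d: "(LINT x|M. (f n x)\<^sup>2) = (LINT x|M. (f n x - F x)\<^sup>2) + 2 * (LINT x|M. f n x * F x) - (LINT x|M. (F x)\<^sup>2)" for n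
  proof -
    have "(LINT x|M. (f n x - F x)\<^sup>2) = (LINT x|M. (f n x)\<^sup>2 - 2 * (f n x * F x) + (F x)\<^sup>2)"
      by (rule Bochner_Integration.integral_cong) (auto simp: power2_diff)
    then show ?thesis using f2 F2 i by simp
  qed
  have "(\<lambda>n. (LINT x|M. (f n x - F x)\<^sup>2) + 2 * (LINT x|M. f n x * F x) - (LINT x|M. (F x)\<^sup>2))
      \<longlonglongrightarrow> 0 + 2 * (LINT x|M. F x * F x) - (LINT x|M. (F x)\<^sup>2)"
    by (intro tendsto_intros l L2_tendsto_inner f2 F2) auto
  then show ?thesis unfolding d[symmetric] by (simp add: power2_eq_square)
qed

lemma lebesgue_on_integral:
  fixes F :: "'a::euclidean_space \<Rightarrow> 'b::euclidean_space"
  assumes [measurable]: "F \<in> borel_measurable borel" "U \<in> sets borel"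
  shows "integral\<^sup>L (lebesgue_on U) F = (LINT x|lborel. indicator U x *\<^sub>R F x)"
    and "integrable (lebesgue_on U) F \<longleftrightarrow> integrable lborel (\<lambda>x. indicator U x *\<^sub>R F x)"
  by (subst integral_restrict_space integrable_restrict_space; simp add: integral_completion integrable_completion)+

text \<open>Weak gradients and subsolutions are expressed over \<open>lebesgue_on U\<close>, while
  translations and iterated integrals live on \<open>lborel\<close>. Functions that vanish off
  \<open>U\<close> move freely between the two, and the truncations are built to do so.\<close>

lemma lebesgue_on_integral_vanishing:
  fixes F :: "'a::euclidean_space \<Rightarrow> 'b::euclidean_space"
  assumes "F \<in> borel_measurable borel" "U \<in> sets borel" "\<And>x. x \<notin> U \<Longrightarrow> F x = 0"
  shows "integral\<^sup>L (lebesgue_on U) F = (LINT x|lborel. F x)"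
    and "integrable (lebesgue_on U) F \<longleftrightarrow> integrable lborel F"
proof -
  have "(\<lambda>x. indicator U x *\<^sub>R F x) = F" using assms(3) by (auto simp: indicator_def)
  then show "integral\<^sup>L (lebesgue_on U) F = (LINT x|lborel. F x)"
    "integrable (lebesgue_on U) F \<longleftrightarrow> integrable lborel F"
    using lebesgue_on_integral[OF assms(1,2)] by simp_all
qed

lemma borel_measurable_lebesgue_on:
  "F \<in> borel_measurable borel \<Longrightarrow> F \<in> borel_measurable (lebesgue_on U)"
  by (intro measurable_restrict_space1 measurable_completion) simp

lemma tendsto_integral_of_nn_integral:
  fixes F :: "nat \<Rightarrow> 'b \<Rightarrow> real"
  assumes "\<And>n. F n \<in> borel_measurable M" "\<And>n x. 0 \<le> F n x"
    and "(\<lambda>n. \<integral>\<^sup>+x. ennreal (F n x) \<partial>M) \<longlonglongrightarrow> 0"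
  shows "(\<lambda>n. LINT x|M. F n x) \<longlonglongrightarrow> 0"
proof -
  have "(\<lambda>n. enn2real (\<integral>\<^sup>+x. ennreal (F n x) \<partial>M)) \<longlonglongrightarrow> 0"
    using assms(3) by (intro tendsto_enn2real) simp_all
  then show ?thesis using assms by (simp add: integral_eq_nn_integral)
qed

lemma gradient_diff:
  assumes "\<phi> differentiable (at x)" "\<psi> differentiable (at x)"
  shows "gradient (\<lambda>x. \<phi> x - \<psi> x) x = gradient \<phi> x - gradient \<psi> x"
proof (rule gradient_eq)
  show "((\<lambda>x. \<phi> x - \<psi> x) has_derivative (\<lambda>h. (gradient \<phi> x - gradient \<psi> x) \<bullet> h)) (at x)"
    using has_derivative_diff[OF assms[THEN gradient_has_derivative]] by (simp add: inner_diff_left)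
qed

lemma integral_by_parts:
  fixes \<phi> \<psi> :: "real^'n::finite \<Rightarrow> real"
  assumes s: "smooth \<phi>" "smooth \<psi>" and van: "\<forall>x. r < norm x \<longrightarrow> \<phi> x = 0"
  shows "(LINT x|lborel. \<phi> x * partial_deriv i \<psi> x) = - (LINT x|lborel. partial_deriv i \<phi> x * \<psi> x)"
proof -
  have c: "continuous_on UNIV \<phi>" "continuous_on UNIV \<psi>"
    "continuous_on UNIV (partial_deriv i \<phi>)" "continuous_on UNIV (partial_deriv i \<psi>)"
    using s by (intro smooth_continuous smooth_partial_deriv; simp)+
  have i: "integrable lborel (\<lambda>x. \<phi> x * partial_deriv i \<psi> x)"
    "integrable lborel (\<lambda>x. partial_deriv i \<phi> x * \<psi> x)"
    using van vanishing_partial_deriv[OF van]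
    by (intro integrable_vanishing[where r = r] continuous_intros c; simp)+
  have "0 = (LINT x|lborel. partial_deriv i (\<lambda>x. \<phi> x * \<psi> x) x)"
    using van by (subst integral_partial_deriv[where r = r]) (auto intro: s)
  also have "\<dots> = (LINT x|lborel. \<phi> x * partial_deriv i \<psi> x + partial_deriv i \<phi> x * \<psi> x)"
    by (simp add: partial_deriv_mult smooth_differentiable s)
  also have "\<dots> = (LINT x|lborel. \<phi> x * partial_deriv i \<psi> x) + (LINT x|lborel. partial_deriv i \<phi> x * \<psi> x)"
    using i by simp
  finally show ?thesis by simp
qed

lemma norm_square_vec: "(norm y)\<^sup>2 = (\<Sum>i\<in>UNIV. (y $ i)\<^sup>2)" for y :: "real^'n::finite"
  unfolding power2_norm_eq_inner by (simp add: inner_vec_def power2_eq_square)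

lemma nth_square_le: "(y $ i)\<^sup>2 \<le> (norm y)\<^sup>2" for y :: "real^'n::finite"
  using component_le_norm_cart[of y i] power_mono[of "\<bar>y $ i\<bar>" "norm y" 2] by simp

lemma norm_diff_square_le: "(norm (x - y))\<^sup>2 \<le> 2 * (norm x)\<^sup>2 + 2 * (norm y)\<^sup>2"
  for x y :: "'a::real_inner"
  using zero_le_power2[of "norm (x + y)"] by (simp add: power2_norm_eq_inner inner_simps inner_commute)

lemma indicator_square: "(indicat_real S x)\<^sup>2 = indicat_real S x"
  by (simp add: indicator_def)

lemma matrix_vector_mult_measurable:
  fixes A :: "'b \<Rightarrow> real^'n::finite^'n" and g :: "'b \<Rightarrow> real^'n"
  assumes "A \<in> borel_measurable M" "g \<in> borel_measurable M"
  shows "(\<lambda>x. A x *v g x) \<in> borel_measurable M"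
proof (rule borel_measurable_continuous_Pair[OF assms])
  show "continuous_on UNIV (\<lambda>x::(real^'n^'n) \<times> (real^'n). fst x *v snd x)"
    unfolding matrix_vector_mult_def by (intro continuous_intros)
qed

lemma symmetric_matrix_inner:
  fixes A :: "real^'n::finite^'n"
  assumes "transpose A = A"
  shows "(A *v x) \<bullet> y = (A *v y) \<bullet> x"
  using assms by (metis dot_lmul_matrix inner_commute transpose_matrix_vector)

text \<open>The test function is a smoothed $(u-q)_+$ on $B(z,\rho)$, extended by zero. Since $q \ge T \ge u$ outside
  $B(z,s)$, it vanishes near the boundary, and so do its approximations: the mollifications of $u$
  restricted to $B(z,\rho)$ are bounded by $T$ everywhere.\<close>

locale truncation =
  fixes U :: "(real^'n::finite) set" and u :: "real^'n \<Rightarrow> real" and Du :: "real^'n \<Rightarrow> real^'n"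
    and z :: "real^'n" and \<rho> s T :: real and q :: "real^'n \<Rightarrow> real" and a :: real
  assumes open_U: "open U" and W: "has_W12_gradient U u Du"
    and Du_borel [measurable]: "Du \<in> borel_measurable borel"
    and cont: "continuous_on U u" and ball_sub: "ball z \<rho> \<subseteq> U"
    and u_nonneg: "\<And>x. x \<in> ball z \<rho> \<Longrightarrow> 0 \<le> u x" and u_le: "\<And>x. x \<in> ball z \<rho> \<Longrightarrow> u x \<le> T"
    and smooth_q: "smooth q" and s_pos: "0 < s" and s_less: "s < \<rho>"
    and q_ge: "\<And>x. s \<le> norm (x - z) \<Longrightarrow> T \<le> q x" and a_pos: "0 < a"
begin

abbreviation "B \<equiv> ball z \<rho>"
abbreviation "C \<equiv> cball z s"

definition v :: "real^'n \<Rightarrow> real" where "v x = indicator B x * u x"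
text \<open>In general not a weak partial derivative of \<open>v\<close> on the whole space, since
  \<open>v\<close> may jump across the sphere bounding \<open>B\<close>. The two are compared, after
  mollification, only at points of \<open>C\<close>.\<close>

definition w :: "'n \<Rightarrow> real^'n \<Rightarrow> real" where "w i x = indicator B x * Du x $ i"
definition \<phi> :: "real^'n \<Rightarrow> real" where "\<phi> x = soft_pos a (v x - q x)"
text \<open>The chain rule for \<open>\<phi>\<close>. The uncut \<open>Du\<close> may stand here
  because the first factor vanishes outside \<open>C\<close>.\<close>

definition D\<phi> :: "real^'n \<Rightarrow> real^'n" where
  "D\<phi> x = soft_pos_deriv a (v x - q x) *\<^sub>R (Du x - gradient q x)"
text \<open>The summand 2 makes every radius smaller than \<rho> - s, so that mollifying at a point
  of \<open>C\<close> only sees values inside \<open>B\<close>.\<close>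

definition \<epsilon> :: "nat \<Rightarrow> real" where "\<epsilon> n = (\<rho> - s) / (real n + 2)"
definition V :: "nat \<Rightarrow> real^'n \<Rightarrow> real" where "V n = conv v (mollifier (\<epsilon> n))"
definition \<psi> :: "nat \<Rightarrow> real^'n \<Rightarrow> real" where "\<psi> n x = soft_pos a (V n x - q x)"

lemma sets_BC [measurable]: "B \<in> sets borel" "C \<in> sets borel" "U \<in> sets borel"
  using open_U by auto

lemma Du_nth_borel [measurable]: "(\<lambda>x. Du x $ i) \<in> borel_measurable borel"
proof -
  have "(\<lambda>x. Du x \<bullet> axis i 1) \<in> borel_measurable borel" by measurable
  then show ?thesis by (simp add: inner_axis)
qed

lemma C_sub_B: "C \<subseteq> B"
  using s_less by auto

lemma T_nonneg: "0 \<le> T"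
  using u_nonneg[of z] u_le[of z] s_pos s_less by simp

lemma v_nonneg: "0 \<le> v x" and v_le: "v x \<le> T"
  using u_nonneg[of x] u_le[of x] T_nonneg by (auto simp: v_def indicator_def)

lemma v_borel [measurable]: "v \<in> borel_measurable borel"
  using borel_measurable_continuous_on_indicator[of B u] continuous_on_subset[OF cont ball_sub]
  by (simp add: v_def[abs_def])

lemma integrable_indicator_ball: "integrable lborel (indicat_real (ball x r))" for x :: "real^'n"
  by (intro integrable_real_indicator emeasure_lborel_ball_finite) auto

lemma integrable_v: "integrable lborel v"
proof (rule Bochner_Integration.integrable_bound)
  show "integrable lborel (\<lambda>x. T * indicat_real B x)"
    using integrable_indicator_ball by simp
  show "AE x in lborel. norm (v x) \<le> norm (T * indicat_real B x)"
    using u_nonneg u_le T_nonneg by (auto simp: v_def indicator_def)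
qed measurable

lemma isCont_v: "x \<in> B \<Longrightarrow> isCont v x"
proof -
  assume x: "x \<in> B"
  have "isCont u x"
    using continuous_on_subset[OF cont ball_sub] x by (simp add: continuous_on_eq_continuous_at)
  moreover have "\<forall>\<^sub>F y in nhds x. v y = u y"
    using eventually_nhds_in_open[OF open_ball x] by eventually_elim (simp add: v_def)
  ultimately show ?thesis using isCont_cong by blast
qed

lemma w_borel [measurable]: "w i \<in> borel_measurable borel"
  unfolding w_def[abs_def] by measurable

lemma integrable_Du: "integrable lborel (\<lambda>x. indicator B x * (norm (Du x))\<^sup>2)"
proof -
  have "integrable (lebesgue_on U) (\<lambda>x. (norm (Du x))\<^sup>2)"
    using W by (simp add: has_W12_gradient_def square_integrable_on_def)
  then have "integrable lborel (\<lambda>x. indicator U x * (norm (Du x))\<^sup>2)"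
    using open_U by (subst (asm) lebesgue_on_integral) auto
  then show ?thesis
    proof (rule Bochner_Integration.integrable_bound)
    show "AE x in lborel. norm (indicator B x * (norm (Du x))\<^sup>2) \<le> norm (indicator U x * (norm (Du x))\<^sup>2)"
      using ball_sub by (intro AE_I2) (auto simp: indicator_def simp del: mem_ball)
  qed measurable
qed

lemma integrable_w2: "integrable lborel (\<lambda>x. (w i x)\<^sup>2)"
proof (rule Bochner_Integration.integrable_bound[OF integrable_Du])
  have "(Du x $ i)\<^sup>2 \<le> (norm (Du x))\<^sup>2" for x
    using component_le_norm_cart[of "Du x" i] abs_le_square_iff[of "Du x $ i" "norm (Du x)"] by simp
  then show "AE x in lborel. norm ((w i x)\<^sup>2) \<le> norm (indicator B x * (norm (Du x))\<^sup>2)"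
    by (auto simp: w_def indicator_def)
qed measurable

lemma integrable_w: "integrable lborel (w i)"
proof (rule Bochner_Integration.integrable_bound)
  show "integrable lborel (\<lambda>x. indicat_real B x + (w i x)\<^sup>2)"
    using integrable_indicator_ball integrable_w2 by simp
  have "\<bar>t\<bar> \<le> 1 + t\<^sup>2" for t :: real
    using sum_squares_bound[of 1 "\<bar>t\<bar>"] by simp
  then show "AE x in lborel. norm (w i x) \<le> norm (indicat_real B x + (w i x)\<^sup>2)"
    by (auto simp: w_def indicator_def)
qed measurable

lemma \<epsilon>_pos: "0 < \<epsilon> n"
  using s_less by (simp add: \<epsilon>_def)

lemma \<epsilon>_less: "\<epsilon> n < \<rho> - s"
proof -
  have "(\<rho> - s) * 1 < (\<rho> - s) * (real n + 2)" using s_less by (intro mult_strict_left_mono) auto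
  then show ?thesis by (simp add: \<epsilon>_def divide_less_eq)
qed

lemma \<epsilon>_tendsto: "\<epsilon> \<longlonglongrightarrow> 0"
proof -
  have "(\<lambda>n. (\<rho> - s) * (1 / real (n + 2))) \<longlonglongrightarrow> (\<rho> - s) * 0"
    by (intro tendsto_intros LIMSEQ_ignore_initial_segment[OF lim_1_over_n])
  then show ?thesis by (simp add: \<epsilon>_def[abs_def] add.commute)
qed

lemma mollifier_bounded_support: "\<forall>x. \<epsilon> n < norm x \<longrightarrow> mollifier (\<epsilon> n) (x::real^'n) = 0"
  by (auto intro: mollifier_vanishing[OF \<epsilon>_pos])

lemma smooth_V: "smooth (V n)"
  unfolding V_def
  by (rule smooth_conv[OF integrable_v smooth_mollifier mollifier_bounded_support])

lemma V_le: "V n x \<le> T" and V_nonneg: "0 \<le> V n x"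
  unfolding V_def
  by (rule conv_mollifier_le[OF \<epsilon>_pos integrable_v v_le], rule conv_mollifier_ge[OF \<epsilon>_pos integrable_v v_nonneg])

lemma V_tendsto: "x \<in> B \<Longrightarrow> (\<lambda>n. V n x) \<longlonglongrightarrow> v x"
  unfolding V_def by (rule conv_mollifier_tendsto[OF integrable_v isCont_v \<epsilon>_pos \<epsilon>_tendsto])

text \<open>The mollifier centred at x, as a function of y, is supported in \<open>B\<close> because
  x lies in \<open>C\<close>, hence it is an admissible test function for the weak gradient of
  \<open>u\<close>. The sign from differentiating k(x - y) in y cancels the one from the weak
  formulation.\<close>

lemma partial_deriv_V:
  assumes x: "x \<in> C"
  shows "partial_deriv i (V n) x = conv (w i) (mollifier (\<epsilon> n)) x"
proof -
  let ?k = "mollifier (\<epsilon> n) :: real^'n \<Rightarrow> real"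
  let ?\<tau> = "\<lambda>y. ?k (y - x)"
  have far: "\<epsilon> n < norm (x - y)" if "y \<notin> B" for y
  proof (rule ccontr)
    assume "\<not> ?thesis"
    then have "dist z y \<le> s + \<epsilon> n" using x dist_triangle[of z y x] by (simp add: dist_norm norm_minus_commute)
    with \<epsilon>_less[of n] that show False by simp
  qed
  have d: "partial_deriv i ?\<tau> y = - partial_deriv i ?k (x - y)" for y
  proof -
    have eq: "?\<tau> = (\<lambda>y. ?k (x - y))" by (auto simp: mollifier_minus)
    have "((\<lambda>y. ?k (x - y)) has_derivative (\<lambda>h. gradient ?k (x - y) \<bullet> (- h))) (at y)"
      by (rule has_derivative_compose[OF _ gradient_has_derivative[OF smooth_differentiable[OF smooth_mollifier]]])
        (auto intro!: derivative_eq_intros)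
    from partial_deriv_eq[OF this, of i] show ?thesis
      unfolding eq by (simp add: inner_axis gradient_def)
  qed
  have van: "?\<tau> y = 0" "partial_deriv i ?\<tau> y = 0" if "y \<notin> B" for y
    using far[OF that] mollifier_bounded_support[of n] vanishing_partial_deriv[OF mollifier_bounded_support[of n]]
    by (simp_all add: d norm_minus_commute[of y x])
  have m [measurable]: "?\<tau> \<in> borel_measurable borel" "partial_deriv i ?\<tau> \<in> borel_measurable borel"
    by (intro borel_measurable_continuous_onI smooth_continuous smooth_partial_deriv smooth_mollifier_shift)+
  have "cball x (\<epsilon> n) \<subseteq> U"
  proof
    fix y assume "y \<in> cball x (\<epsilon> n)"
    then have "\<not> \<epsilon> n < norm (x - y)" by (simp add: dist_norm)
    with far ball_sub show "y \<in> U" by blast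
  qed
  then have "?\<tau> \<in> test_functions U"
    by (rule test_functionI[OF smooth_mollifier_shift, rotated]) (use mollifier_bounded_support in blast)
  then have wk: "(LINT y|lebesgue_on U. u y * partial_deriv i ?\<tau> y) = - (LINT y|lebesgue_on U. Du y $ i * ?\<tau> y)"
    using W by (simp add: has_W12_gradient_def)
  have "partial_deriv i (V n) x = conv v (partial_deriv i ?k) x"
    unfolding V_def partial_deriv_conv[OF integrable_v smooth_mollifier mollifier_bounded_support] ..
  also have "\<dots> = - (LINT y|lborel. v y * partial_deriv i ?\<tau> y)"
    by (simp add: conv_def d)
  also have "(LINT y|lborel. v y * partial_deriv i ?\<tau> y) = (LINT y|lebesgue_on U. v y * partial_deriv i ?\<tau> y)"
    using van ball_sub by (intro lebesgue_on_integral_vanishing(1)[symmetric]) (auto simp del: mem_ball)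
  also have "\<dots> = (LINT y|lebesgue_on U. u y * partial_deriv i ?\<tau> y)"
    using van(2) by (intro Bochner_Integration.integral_cong) (auto simp: v_def indicator_def)
  also have "- \<dots> = (LINT y|lebesgue_on U. Du y $ i * ?\<tau> y)" using wk by simp
  also have "\<dots> = (LINT y|lebesgue_on U. w i y * ?\<tau> y)"
    using van(1) by (intro Bochner_Integration.integral_cong) (auto simp: w_def indicator_def)
  also have "\<dots> = (LINT y|lborel. w i y * ?\<tau> y)"
    using van ball_sub by (intro lebesgue_on_integral_vanishing(1)) (auto simp del: mem_ball)
  also have "\<dots> = conv (w i) ?k x"
    by (simp add: conv_def mollifier_minus[of _ x])
  finally show ?thesis .
qed

section \<open>Smooth approximants of the truncation and their convergence in W^{1,2}\<close>

lemma smooth_\<psi>: "smooth (\<psi> n)"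
  unfolding \<psi>_def by (intro smooth_soft_pos smooth_diff smooth_V smooth_q)

lemma \<psi>_vanishing: "s \<le> norm (x - z) \<Longrightarrow> \<psi> n x = 0"
  unfolding \<psi>_def using V_le[of n x] q_ge[of x] by (intro soft_pos_eq_0 a_pos) auto

lemma \<phi>_vanishing: "s \<le> norm (x - z) \<Longrightarrow> \<phi> x = 0"
  and D\<phi>_vanishing: "s \<le> norm (x - z) \<Longrightarrow> D\<phi> x = 0"
  unfolding \<phi>_def D\<phi>_def using v_le[of x] q_ge[of x] a_pos
  by (auto intro!: soft_pos_eq_0 soft_pos_deriv_eq_0)

lemma gradient_\<psi>:
  "gradient (\<psi> n) x = soft_pos_deriv a (V n x - q x) *\<^sub>R (gradient (V n) x - gradient q x)"
proof -
  have "gradient (\<psi> n) x = soft_pos_deriv a (V n x - q x) *\<^sub>R gradient (\<lambda>x. V n x - q x) x"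
    unfolding \<psi>_def
    by (rule gradient_eq, rule has_derivative_gradient_compose[OF soft_pos_has_derivative[OF a_pos]])
      (intro smooth_differentiable smooth_diff smooth_V smooth_q)
  then show ?thesis
    by (simp add: gradient_diff smooth_differentiable smooth_V smooth_q)
qed

lemma gradient_\<psi>_vanishing:
  assumes "s \<le> norm (x - z)" shows "gradient (\<psi> n) x = 0"
  unfolding gradient_\<psi> using assms V_le[of n x] q_ge[of x] a_pos
  by (simp add: soft_pos_deriv_eq_0)

lemma approximation_borel [measurable]:
  "V n \<in> borel_measurable borel" "q \<in> borel_measurable borel"
  "\<psi> n \<in> borel_measurable borel" "gradient (\<psi> n) \<in> borel_measurable borel"
  "gradient q \<in> borel_measurable borel" "gradient (V n) \<in> borel_measurable borel"
  by (intro borel_measurable_continuous_onI smooth_continuous smooth_continuous_gradient smooth_V smooth_q smooth_\<psi>)+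

lemma \<phi>_borel [measurable]: "\<phi> \<in> borel_measurable borel" "D\<phi> \<in> borel_measurable borel"
  unfolding \<phi>_def[abs_def] D\<phi>_def[abs_def] by measurable

lemma outside_C: "x \<notin> C \<Longrightarrow> s \<le> norm (x - z)"
  by (simp add: dist_norm norm_minus_commute)

lemma integrable_indicator_C: "integrable lborel (\<lambda>x. c * indicat_real C x)"
proof -
  have "emeasure lborel C < \<infinity>" by (intro emeasure_compact_finite) simp
  then show ?thesis by simp
qed

text \<open>\<open>soft_pos\<close> is 1-Lipschitz, so the error is at most |V_n - v|: it tends to 0
  pointwise on \<open>C\<close> by continuity of \<open>u\<close>, and it is bounded by T because
  both functions take values in [0, T].\<close>

lemma \<psi>_tendsto_L2: "(\<lambda>n. LINT x|lborel. (\<psi> n x - \<phi> x)\<^sup>2) \<longlonglongrightarrow> 0"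
proof -
  have le: "\<bar>\<psi> n x - \<phi> x\<bar> \<le> \<bar>V n x - v x\<bar>" for n x
    unfolding \<psi>_def \<phi>_def using soft_pos_lipschitz[OF a_pos, of "V n x - q x" "v x - q x"] by simp
  have "(\<lambda>n. LINT x|lborel. (\<psi> n x - \<phi> x)\<^sup>2) \<longlonglongrightarrow> (LINT (x::real^'n)|lborel. (0::real))"
  proof (rule integral_dominated_convergence[where w = "\<lambda>x. T\<^sup>2 * indicat_real C x"])
    show "AE x in lborel. (\<lambda>n. (\<psi> n x - \<phi> x)\<^sup>2) \<longlonglongrightarrow> 0"
    proof (intro AE_I2)
      fix x
      show "(\<lambda>n. (\<psi> n x - \<phi> x)\<^sup>2) \<longlonglongrightarrow> 0"
      proof (cases "x \<in> C")
        case True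
        then have "x \<in> B" using C_sub_B by blast
        from V_tendsto[OF this] have "(\<lambda>n. \<bar>V n x - v x\<bar>) \<longlonglongrightarrow> 0"
          by (intro tendsto_rabs_zero) (simp add: LIM_zero_iff)
        then have "(\<lambda>n. \<psi> n x - \<phi> x) \<longlonglongrightarrow> 0"
          by (rule Lim_null_comparison[rotated]) (simp add: le)
        then show ?thesis using tendsto_power[of _ 0 _ 2] by fastforce
      next
        case False
        then show ?thesis using \<psi>_vanishing[OF outside_C] \<phi>_vanishing[OF outside_C] by simp
      qed
    qed
    show "AE x in lborel. norm ((\<psi> n x - \<phi> x)\<^sup>2) \<le> T\<^sup>2 * indicat_real C x" for n
    proof (intro AE_I2)
      fix x
      have "\<bar>\<psi> n x - \<phi> x\<bar> \<le> T"
        using le[of n x] V_le[of n x] V_nonneg[of n x] v_le[of x] v_nonneg[of x] by linarith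
      then have "(\<psi> n x - \<phi> x)\<^sup>2 \<le> T\<^sup>2"
        using power_mono[of "\<bar>\<psi> n x - \<phi> x\<bar>" T 2] by simp
      then show "norm ((\<psi> n x - \<phi> x)\<^sup>2) \<le> T\<^sup>2 * indicat_real C x"
        using \<psi>_vanishing[OF outside_C] \<phi>_vanishing[OF outside_C] by (cases "x \<in> C") (auto simp del: mem_cball)
    qed
  qed (use integrable_indicator_C in measurable)
  then show ?thesis by simp
qed

lemma integrable_gradient_error:
  "integrable lborel (\<lambda>x. indicator C x * (norm (Du x - gradient q x))\<^sup>2)"
proof -
  have "compact ((\<lambda>x. norm (gradient q x)) ` C)"
    by (intro compact_continuous_image continuous_intros smooth_continuous_gradient smooth_q) auto
  then obtain K where K: "\<And>x. x \<in> C \<Longrightarrow> norm (gradient q x) \<le> K"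
    by (meson bdd_above.unfold compact_imp_bounded bounded_imp_bdd_above image_eqI)
  show ?thesis
  proof (rule Bochner_Integration.integrable_bound)
    show "integrable lborel (\<lambda>x. 2 * (indicator B x * (norm (Du x))\<^sup>2) + 2 * K\<^sup>2 * indicat_real C x)"
      using integrable_Du integrable_indicator_C by simp
    show "AE x in lborel. norm (indicator C x * (norm (Du x - gradient q x))\<^sup>2)
        \<le> norm (2 * (indicator B x * (norm (Du x))\<^sup>2) + 2 * K\<^sup>2 * indicat_real C x)"
    proof (intro AE_I2)
      fix x
      show "norm (indicator C x * (norm (Du x - gradient q x))\<^sup>2)
        \<le> norm (2 * (indicator B x * (norm (Du x))\<^sup>2) + 2 * K\<^sup>2 * indicat_real C x)"
      proof (cases "x \<in> C")
        case True
        then have "x \<in> B" using C_sub_B by blast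
        moreover have "(norm (gradient q x))\<^sup>2 \<le> K\<^sup>2" using K[OF True] by (intro power_mono) auto
        ultimately show ?thesis using True norm_diff_square_le[of "Du x" "gradient q x"] by (simp del: mem_ball mem_cball)
      qed simp
    qed
  qed measurable
qed

lemma integrable_D\<phi>: "integrable lborel (\<lambda>x. (norm (D\<phi> x))\<^sup>2)"
proof (rule Bochner_Integration.integrable_bound[OF integrable_gradient_error])
  show "AE x in lborel. norm ((norm (D\<phi> x))\<^sup>2) \<le> norm (indicator C x * (norm (Du x - gradient q x))\<^sup>2)"
  proof (intro AE_I2)
    fix x
    have "norm (D\<phi> x) \<le> norm (Du x - gradient q x)"
      unfolding D\<phi>_def using soft_pos_deriv_nonneg[of a] soft_pos_deriv_le_1[of a] by (simp add: mult_left_le_one_le)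
    then have "(norm (D\<phi> x))\<^sup>2 \<le> (norm (Du x - gradient q x))\<^sup>2" by (intro power_mono) auto
    then show "norm ((norm (D\<phi> x))\<^sup>2) \<le> norm (indicator C x * (norm (Du x - gradient q x))\<^sup>2)"
      using D\<phi>_vanishing[OF outside_C, of x] by (cases "x \<in> C") (auto simp del: mem_cball)
  qed
qed measurable

text \<open>The error splits into two terms. In \<open>X\<close> a slope in [0,1] multiplies the
  difference of the gradients of \<open>V n\<close> and \<open>u\<close>, which is handled by L^2
  mollification of the components \<open>w i\<close>. In \<open>Y\<close> the difference of two
  slopes multiplies the fixed square integrable function Du - Dq, which is handled by dominated
  convergence.\<close>

lemma gradient_\<psi>_tendsto_L2:
  "(\<lambda>n. LINT x|lborel. (norm (gradient (\<psi> n) x - D\<phi> x))\<^sup>2) \<longlonglongrightarrow> 0"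
proof -
  define h where "h n x = indicator C x *
    ((soft_pos_deriv a (V n x - q x) - soft_pos_deriv a (v x - q x))\<^sup>2 * (norm (Du x - gradient q x))\<^sup>2)" for n x
  define c where "c n i x = (conv (w i) (mollifier (\<epsilon> n)) x - w i x)\<^sup>2" for n i x
  have [measurable]: "h n \<in> borel_measurable borel" for n unfolding h_def[abs_def] by measurable
  have cm: "smooth (conv (w i) (mollifier (\<epsilon> n)))" for i n
    by (rule smooth_conv[OF integrable_w smooth_mollifier mollifier_bounded_support])
  have [measurable]: "conv (w i) (mollifier (\<epsilon> n)) \<in> borel_measurable borel" for i n
    by (intro borel_measurable_continuous_onI smooth_continuous cm)
  have [measurable]: "c n i \<in> borel_measurable borel" for n i unfolding c_def[abs_def] by measurable
  have d1: "(soft_pos_deriv a p - soft_pos_deriv a p')\<^sup>2 \<le> 1" for p p'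
    using soft_pos_deriv_nonneg[of a p] soft_pos_deriv_le_1[of a p] soft_pos_deriv_nonneg[of a p'] soft_pos_deriv_le_1[of a p']
    by (simp add: abs_square_le_1)
  have hb: "\<bar>h n x\<bar> \<le> indicator C x * (norm (Du x - gradient q x))\<^sup>2" for n x
    using mult_right_mono[OF d1, of "(norm (Du x - gradient q x))\<^sup>2"] by (simp add: h_def indicator_def)
  have h0: "0 \<le> h n x" for n x by (simp add: h_def)
  have ih: "integrable lborel (h n)" for n
    by (rule Bochner_Integration.integrable_bound[OF integrable_gradient_error]) (use hb in auto)
  have "(\<lambda>n. LINT x|lborel. h n x) \<longlonglongrightarrow> (LINT (x::real^'n)|lborel. (0::real))"
  proof (rule integral_dominated_convergence[OF _ _ integrable_gradient_error])
    show "AE x in lborel. (\<lambda>n. h n x) \<longlonglongrightarrow> 0"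
    proof (intro AE_I2)
      fix x
      show "(\<lambda>n. h n x) \<longlonglongrightarrow> 0"
      proof (cases "x \<in> C")
        case True
        then have "x \<in> B" using C_sub_B by blast
        have "isCont (soft_pos_deriv a) p" for p
          using continuous_soft_pos(2)[of UNIV a] by (simp add: continuous_on_eq_continuous_at)
        moreover have "(\<lambda>n. V n x - q x) \<longlonglongrightarrow> v x - q x"
          by (intro tendsto_intros V_tendsto \<open>x \<in> B\<close>)
        ultimately have "(\<lambda>n. soft_pos_deriv a (V n x - q x)) \<longlonglongrightarrow> soft_pos_deriv a (v x - q x)"
          by (rule isCont_tendsto_compose)
        then have "(\<lambda>n. indicator C x * ((soft_pos_deriv a (V n x - q x) - soft_pos_deriv a (v x - q x))\<^sup>2 * (norm (Du x - gradient q x))\<^sup>2))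
          \<longlonglongrightarrow> indicator C x * ((soft_pos_deriv a (v x - q x) - soft_pos_deriv a (v x - q x))\<^sup>2 * (norm (Du x - gradient q x))\<^sup>2)"
          by (intro tendsto_intros)
        then show ?thesis by (simp add: h_def)
      qed (simp add: h_def)
    qed
  qed (use hb in auto)
  then have hl: "(\<lambda>n. \<integral>\<^sup>+x. ennreal (h n x) \<partial>lborel) \<longlonglongrightarrow> 0"
    using h0 by (simp add: nn_integral_eq_integral[OF ih] tendsto_ennreal_iff flip: ennreal_0)
  have cl: "(\<lambda>n. \<integral>\<^sup>+x. ennreal (c n i x) \<partial>lborel) \<longlonglongrightarrow> 0" for i
    unfolding c_def by (rule conv_mollifier_L2[OF integrable_w integrable_w2 \<epsilon>_pos \<epsilon>_tendsto])
  have c0: "0 \<le> c n i x" for n i x by (simp add: c_def)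
  have pt: "(norm (gradient (\<psi> n) x - D\<phi> x))\<^sup>2 \<le> (\<Sum>i\<in>UNIV. 2 * c n i x) + 2 * h n x" for n x
  proof (cases "x \<in> C")
    case True
    then have xB: "x \<in> B" using C_sub_B by blast
    define X where "X = soft_pos_deriv a (V n x - q x) *\<^sub>R (gradient (V n) x - Du x)"
    define Y where "Y = (soft_pos_deriv a (V n x - q x) - soft_pos_deriv a (v x - q x)) *\<^sub>R (Du x - gradient q x)"
    have "gradient (\<psi> n) x - D\<phi> x = X + Y"
      by (simp add: gradient_\<psi> D\<phi>_def X_def Y_def algebra_simps)
    moreover have "(norm (X + Y))\<^sup>2 \<le> 2 * (norm X)\<^sup>2 + 2 * (norm Y)\<^sup>2"
      using zero_le_power2[of "norm (X - Y)"] by (simp add: power2_norm_eq_inner inner_simps inner_commute)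
    moreover have "(norm Y)\<^sup>2 = h n x" using True by (simp add: Y_def h_def power_mult_distrib)
    moreover have "(norm X)\<^sup>2 \<le> (norm (gradient (V n) x - Du x))\<^sup>2"
      unfolding X_def using soft_pos_deriv_nonneg[of a] soft_pos_deriv_le_1[of a]
      by (intro power_mono) (simp_all add: mult_left_le_one_le)
    moreover have "(norm (gradient (V n) x - Du x))\<^sup>2 = (\<Sum>i\<in>UNIV. c n i x)"
      using partial_deriv_V[OF True] xB
      by (simp add: norm_square_vec c_def gradient_def w_def del: mem_ball)
    ultimately show ?thesis by (simp flip: sum_distrib_left)
  next
    case False
    then show ?thesis
      using gradient_\<psi>_vanishing[OF outside_C] D\<phi>_vanishing[OF outside_C] c0 h0
      by (simp add: sum_nonneg)
  qed
  have le: "(\<integral>\<^sup>+x. ennreal ((norm (gradient (\<psi> n) x - D\<phi> x))\<^sup>2) \<partial>lborel)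
    \<le> (\<Sum>i\<in>UNIV. 2 * (\<integral>\<^sup>+x. ennreal (c n i x) \<partial>lborel)) + 2 * (\<integral>\<^sup>+x. ennreal (h n x) \<partial>lborel)" for n
  proof -
    have "(\<integral>\<^sup>+x. ennreal ((norm (gradient (\<psi> n) x - D\<phi> x))\<^sup>2) \<partial>lborel)
      \<le> (\<integral>\<^sup>+x. ennreal ((\<Sum>i\<in>UNIV. 2 * c n i x) + 2 * h n x) \<partial>lborel)"
      by (intro nn_integral_mono ennreal_leI pt)
    also have "\<dots> = (\<integral>\<^sup>+x. (\<Sum>i\<in>UNIV. 2 * ennreal (c n i x)) + 2 * ennreal (h n x) \<partial>lborel)"
      using c0 h0 by (intro nn_integral_cong)
        (simp add: ennreal_plus sum_nonneg ennreal_mult flip: sum_ennreal)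
    also have "\<dots> = (\<Sum>i\<in>UNIV. 2 * (\<integral>\<^sup>+x. ennreal (c n i x) \<partial>lborel)) + 2 * (\<integral>\<^sup>+x. ennreal (h n x) \<partial>lborel)"
      by (simp add: nn_integral_add nn_integral_sum nn_integral_cmult)
    finally show ?thesis .
  qed
  have lim: "(\<lambda>n. (\<Sum>i\<in>UNIV. 2 * (\<integral>\<^sup>+x. ennreal (c n i x) \<partial>lborel)) + 2 * (\<integral>\<^sup>+x. ennreal (h n x) \<partial>lborel)) \<longlonglongrightarrow> (\<Sum>i\<in>(UNIV::'n set). 2 * 0) + 2 * 0"
    by (intro tendsto_add tendsto_sum ennreal_tendsto_cmult cl hl) auto
  show ?thesis
  proof (rule tendsto_integral_of_nn_integral)
    show "(\<lambda>n. \<integral>\<^sup>+x. ennreal ((norm (gradient (\<psi> n) x - D\<phi> x))\<^sup>2) \<partial>lborel) \<longlonglongrightarrow> 0"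
      by (rule tendsto_sandwich[OF _ _ tendsto_const, of _ _ _ "\<lambda>n. (\<Sum>i\<in>UNIV. 2 * (\<integral>\<^sup>+x. ennreal (c n i x) \<partial>lborel)) + 2 * (\<integral>\<^sup>+x. ennreal (h n x) \<partial>lborel)"])
        (use le lim in simp_all)
  qed auto
qed

lemma \<psi>_bounded_support: "\<forall>x. norm z + s < norm x \<longrightarrow> \<psi> n x = 0"
proof (intro allI impI \<psi>_vanishing)
  show "s \<le> norm (x - z)" if "norm z + s < norm x" for x
    using norm_triangle_sub[of x z] that by simp
qed

lemma integrable_\<psi>2: "integrable lborel (\<lambda>x. (\<psi> n x)\<^sup>2)"
  and integrable_gradient_\<psi>2: "integrable lborel (\<lambda>x. (norm (gradient (\<psi> n) x))\<^sup>2)"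
  and integrable_partial_\<psi>2: "integrable lborel (\<lambda>x. (partial_deriv i (\<psi> n) x)\<^sup>2)"
  using \<psi>_bounded_support[of n] vanishing_gradient[OF \<psi>_bounded_support[of n]] vanishing_partial_deriv[OF \<psi>_bounded_support[of n]]
  by (intro integrable_vanishing[where r = "norm z + s"] continuous_intros smooth_continuous
      smooth_continuous_gradient smooth_partial_deriv smooth_\<psi>; simp)+

text \<open>Comparison with the smooth approximant \<open>\<psi> 0\<close>, which differs from
  \<open>\<phi>\<close> by at most T on \<open>C\<close>, replaces a direct bound for
  \<open>q\<close>.\<close>

lemma integrable_\<phi>2: "integrable lborel (\<lambda>x. (\<phi> x)\<^sup>2)"
proof (rule Bochner_Integration.integrable_bound)
  show "integrable lborel (\<lambda>x. 2 * (\<psi> 0 x)\<^sup>2 + 2 * (T\<^sup>2 * indicat_real C x))"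
    using integrable_\<psi>2[of 0] integrable_indicator_C[of "T\<^sup>2"] by simp
  show "AE x in lborel. norm ((\<phi> x)\<^sup>2) \<le> norm (2 * (\<psi> 0 x)\<^sup>2 + 2 * (T\<^sup>2 * indicat_real C x))"
  proof (intro AE_I2)
    fix x
    show "norm ((\<phi> x)\<^sup>2) \<le> norm (2 * (\<psi> 0 x)\<^sup>2 + 2 * (T\<^sup>2 * indicat_real C x))"
    proof (cases "x \<in> C")
      case True
      have "\<bar>\<psi> 0 x - \<phi> x\<bar> \<le> \<bar>V 0 x - v x\<bar>"
        unfolding \<psi>_def \<phi>_def using soft_pos_lipschitz[OF a_pos, of "V 0 x - q x" "v x - q x"] by simp
      then have "\<bar>\<psi> 0 x - \<phi> x\<bar> \<le> T"
        using V_le[of 0 x] V_nonneg[of 0 x] v_le[of x] v_nonneg[of x] by linarith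
      then have "(\<psi> 0 x - \<phi> x)\<^sup>2 \<le> T\<^sup>2"
        using power_mono[of "\<bar>\<psi> 0 x - \<phi> x\<bar>" T 2] by simp
      moreover have "(\<phi> x)\<^sup>2 \<le> 2 * (\<psi> 0 x)\<^sup>2 + 2 * (\<psi> 0 x - \<phi> x)\<^sup>2"
        using zero_le_power2[of "2 * \<psi> 0 x - \<phi> x"] by (simp add: power2_eq_square algebra_simps)
      ultimately show ?thesis using True by (simp del: mem_cball)
    qed (simp add: \<phi>_vanishing[OF outside_C])
  qed
qed measurable

lemma zero_outside_U:
  assumes "x \<notin> U"
  shows "\<phi> x = 0" "D\<phi> x = 0" "\<psi> n x = 0" "gradient (\<psi> n) x = 0"
proof -
  have "x \<notin> C" using assms ball_sub C_sub_B by blast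
  from outside_C[OF this] show "\<phi> x = 0" "D\<phi> x = 0" "\<psi> n x = 0" "gradient (\<psi> n) x = 0"
    by (simp_all add: \<phi>_vanishing D\<phi>_vanishing \<psi>_vanishing gradient_\<psi>_vanishing)
qed

lemma D\<phi>_nth_borel [measurable]: "(\<lambda>x. D\<phi> x $ i) \<in> borel_measurable borel"
proof -
  have "(\<lambda>x. D\<phi> x \<bullet> axis i 1) \<in> borel_measurable borel" by measurable
  then show ?thesis by (simp add: inner_axis)
qed

lemma integrable_D\<phi>_nth: "integrable lborel (\<lambda>x. (D\<phi> x $ i)\<^sup>2)"
  by (rule Bochner_Integration.integrable_bound[OF integrable_D\<phi>]) (auto simp: nth_square_le)

lemma integrable_gradient_difference:
  "integrable lborel (\<lambda>x. (norm (gradient (\<psi> n) x - D\<phi> x))\<^sup>2)"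
proof (rule Bochner_Integration.integrable_bound)
  show "integrable lborel (\<lambda>x. 2 * (norm (gradient (\<psi> n) x))\<^sup>2 + 2 * (norm (D\<phi> x))\<^sup>2)"
    using integrable_gradient_\<psi>2 integrable_D\<phi> by simp
qed (use norm_diff_square_le in auto)

lemma partial_\<psi>_tendsto_L2: "(\<lambda>n. LINT x|lborel. (partial_deriv i (\<psi> n) x - D\<phi> x $ i)\<^sup>2) \<longlonglongrightarrow> 0"
proof (rule tendsto_sandwich[OF _ _ tendsto_const gradient_\<psi>_tendsto_L2])
  have "(partial_deriv i (\<psi> n) x - D\<phi> x $ i)\<^sup>2 \<le> (norm (gradient (\<psi> n) x - D\<phi> x))\<^sup>2" for n x
    using nth_square_le[of "gradient (\<psi> n) x - D\<phi> x" i] by (simp add: gradient_def)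
  then show "\<forall>\<^sub>F n in sequentially. (LINT x|lborel. (partial_deriv i (\<psi> n) x - D\<phi> x $ i)\<^sup>2)
      \<le> (LINT x|lborel. (norm (gradient (\<psi> n) x - D\<phi> x))\<^sup>2)"
    by (intro always_eventually allI integral_mono_AE' integrable_gradient_difference) auto
qed auto

text \<open>Classical integration by parts holds for each \<open>\<psi> n\<close>, and both sides
  converge by L^2 convergence against the fixed test function.\<close>

lemma has_W12_gradient_\<phi>: "has_W12_gradient U \<phi> D\<phi>"
  unfolding has_W12_gradient_def square_integrable_on_def
proof (intro conjI ballI allI)
  show "\<phi> \<in> borel_measurable (lebesgue_on U)" "D\<phi> \<in> borel_measurable (lebesgue_on U)"
    by (intro borel_measurable_lebesgue_on; measurable)+
  show "integrable (lebesgue_on U) (\<lambda>x. (norm (\<phi> x))\<^sup>2)"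
    using integrable_\<phi>2 zero_outside_U by (subst lebesgue_on_integral_vanishing) auto
  show "integrable (lebesgue_on U) (\<lambda>x. (norm (D\<phi> x))\<^sup>2)"
    using integrable_D\<phi> zero_outside_U by (subst lebesgue_on_integral_vanishing) auto
next
  fix \<xi> i assume \<xi>: "\<xi> \<in> test_functions U"
  then have s\<xi>: "smooth \<xi>" by (simp add: test_functions_def smooth_def)
  have "bounded {x. \<xi> x \<noteq> 0}"
    using \<xi> by (auto simp: test_functions_def intro: bounded_subset[OF compact_imp_bounded closure_subset])
  then obtain r where "\<forall>x\<in>{x. \<xi> x \<noteq> 0}. norm x \<le> r" unfolding bounded_iff by blast
  then have van: "\<forall>x. r < norm x \<longrightarrow> \<xi> x = 0" by force
  have i: "integrable lborel (\<lambda>x. (\<xi> x)\<^sup>2)" "integrable lborel (\<lambda>x. (partial_deriv i \<xi> x)\<^sup>2)"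
    using van vanishing_partial_deriv[OF van]
    by (intro integrable_vanishing[where r = r] continuous_intros smooth_continuous smooth_partial_deriv s\<xi>; simp)+
  have [measurable]: "\<xi> \<in> borel_measurable borel" "partial_deriv i \<xi> \<in> borel_measurable borel"
    "partial_deriv i (\<psi> n) \<in> borel_measurable borel" for n
    by (intro borel_measurable_continuous_onI smooth_continuous smooth_partial_deriv s\<xi> smooth_\<psi>)+
  have "(\<lambda>n. LINT x|lborel. \<psi> n x * partial_deriv i \<xi> x) \<longlonglongrightarrow> (LINT x|lborel. \<phi> x * partial_deriv i \<xi> x)"
    by (intro L2_tendsto_inner integrable_\<psi>2 integrable_\<phi>2 i \<psi>_tendsto_L2) measurable
  moreover have "(\<lambda>n. - (LINT x|lborel. partial_deriv i (\<psi> n) x * \<xi> x)) \<longlonglongrightarrow> - (LINT x|lborel. D\<phi> x $ i * \<xi> x)"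
    by (intro tendsto_minus L2_tendsto_inner integrable_partial_\<psi>2 integrable_D\<phi>_nth i partial_\<psi>_tendsto_L2) measurable
  ultimately have "(LINT x|lborel. \<phi> x * partial_deriv i \<xi> x) = - (LINT x|lborel. D\<phi> x $ i * \<xi> x)"
    unfolding integral_by_parts[OF smooth_\<psi> s\<xi> \<psi>_bounded_support] by (rule LIMSEQ_unique)
  moreover have "(LINT x|lebesgue_on U. \<phi> x * partial_deriv i \<xi> x) = (LINT x|lborel. \<phi> x * partial_deriv i \<xi> x)"
    using zero_outside_U by (intro lebesgue_on_integral_vanishing) auto
  moreover have "(LINT x|lebesgue_on U. D\<phi> x $ i * \<xi> x) = (LINT x|lborel. D\<phi> x $ i * \<xi> x)"
    using zero_outside_U by (intro lebesgue_on_integral_vanishing) auto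
  ultimately show "(LINT x|lebesgue_on U. \<phi> x * partial_deriv i \<xi> x) = - (LINT x|lebesgue_on U. D\<phi> x $ i * \<xi> x)"
    by simp
qed

lemma \<phi>_in_W12_0: "\<phi> \<in> W12_0 U"
proof -
  have "\<psi> n \<in> test_functions U" for n
    by (rule test_functionI[OF smooth_\<psi>, of s z]) (use \<psi>_vanishing C_sub_B ball_sub in auto)
  moreover have "(LINT x|lebesgue_on U. (\<psi> n x - \<phi> x)\<^sup>2) = (LINT x|lborel. (\<psi> n x - \<phi> x)\<^sup>2)" for n
    using zero_outside_U by (intro lebesgue_on_integral_vanishing) auto
  moreover have "(LINT x|lebesgue_on U. (norm (gradient (\<psi> n) x - D\<phi> x))\<^sup>2)
      = (LINT x|lborel. (norm (gradient (\<psi> n) x - D\<phi> x))\<^sup>2)" for n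
    using zero_outside_U by (intro lebesgue_on_integral_vanishing) auto
  moreover have "(\<lambda>n. (LINT x|lborel. (\<psi> n x - \<phi> x)\<^sup>2)
      + (LINT x|lborel. (norm (gradient (\<psi> n) x - D\<phi> x))\<^sup>2)) \<longlonglongrightarrow> 0"
    using tendsto_add[OF \<psi>_tendsto_L2 gradient_\<psi>_tendsto_L2] by simp
  ultimately show ?thesis
    unfolding W12_0_def using has_W12_gradient_\<phi>
    by (intro CollectI exI[of _ D\<phi>] conjI exI[of _ \<psi>]) simp_all
qed

section \<open>Functional inequalities and the energy estimate for the truncation\<close>

lemma \<phi>_nonneg: "0 \<le> \<phi> x"
  unfolding \<phi>_def by (intro soft_pos_nonneg a_pos)

lemma nash_\<phi>:
  "measure lborel (ball (0::real^'n) \<delta>) * ((LINT x|lborel. (\<phi> x)\<^sup>2) - \<delta>\<^sup>2 / 2 * (LINT x|lborel. (norm (D\<phi> x))\<^sup>2))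
    \<le> (LINT x|lborel. \<phi> x)\<^sup>2"
proof -
  have \<psi>0: "0 \<le> \<psi> n x" for n x unfolding \<psi>_def by (intro soft_pos_nonneg a_pos)
  have l0: "(\<lambda>n. LINT x|lborel. (\<psi> n x)\<^sup>2) \<longlonglongrightarrow> (LINT x|lborel. (\<phi> x)\<^sup>2)"
    by (intro L2_tendsto_square integrable_\<psi>2 integrable_\<phi>2 \<psi>_tendsto_L2) measurable
  have "(\<lambda>n. LINT x|lborel. (norm (gradient (\<psi> n) x) - norm (D\<phi> x))\<^sup>2) \<longlonglongrightarrow> 0"
  proof (rule tendsto_sandwich[OF _ _ tendsto_const gradient_\<psi>_tendsto_L2])
    have "(norm x - norm y)\<^sup>2 \<le> (norm (x - y))\<^sup>2" for x y :: "real^'n"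
      using power_mono[OF norm_triangle_ineq3[of x y], of 2] by simp
    then show "\<forall>\<^sub>F n in sequentially. (LINT x|lborel. (norm (gradient (\<psi> n) x) - norm (D\<phi> x))\<^sup>2)
        \<le> (LINT x|lborel. (norm (gradient (\<psi> n) x - D\<phi> x))\<^sup>2)"
      by (intro always_eventually allI integral_mono_AE' integrable_gradient_difference) auto
  qed auto
  then have l1: "(\<lambda>n. LINT x|lborel. (norm (gradient (\<psi> n) x))\<^sup>2) \<longlonglongrightarrow> (LINT x|lborel. (norm (D\<phi> x))\<^sup>2)"
    by (intro L2_tendsto_square integrable_gradient_\<psi>2 integrable_D\<phi>) measurable
  have ic: "integrable lborel (\<lambda>x. (indicat_real C x)\<^sup>2)"
    using integrable_indicator_C[of 1] by (simp add: indicator_square)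
  \<comment> \<open>All these functions are supported in \<open>C\<close>, so pairing with its
    indicator turns L^2 convergence into convergence of the L^1 norms.\<close>
  have "(\<lambda>n. LINT x|lborel. \<psi> n x * indicat_real C x) \<longlonglongrightarrow> (LINT x|lborel. \<phi> x * indicat_real C x)"
    by (intro L2_tendsto_inner integrable_\<psi>2 integrable_\<phi>2 ic \<psi>_tendsto_L2) measurable
  moreover have "\<psi> n x * indicat_real C x = \<bar>\<psi> n x\<bar>" "\<phi> x * indicat_real C x = \<phi> x" for n x
    using \<psi>_vanishing[OF outside_C, of x] \<phi>_vanishing[OF outside_C, of x] \<psi>0[of n x] by (auto simp: indicator_def)
  ultimately have l2: "(\<lambda>n. LINT x|lborel. \<bar>\<psi> n x\<bar>) \<longlonglongrightarrow> (LINT x|lborel. \<phi> x)" by simp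
  show ?thesis
  proof (rule LIMSEQ_le)
    show "(\<lambda>n. measure lborel (ball (0::real^'n) \<delta>) * ((LINT x|lborel. (\<psi> n x)\<^sup>2)
        - \<delta>\<^sup>2 / 2 * (LINT x|lborel. (norm (gradient (\<psi> n) x))\<^sup>2)))
      \<longlonglongrightarrow> measure lborel (ball (0::real^'n) \<delta>) * ((LINT x|lborel. (\<phi> x)\<^sup>2) - \<delta>\<^sup>2 / 2 * (LINT x|lborel. (norm (D\<phi> x))\<^sup>2))"
      by (intro tendsto_intros l0 l1)
    show "(\<lambda>n. (LINT x|lborel. \<bar>\<psi> n x\<bar>)\<^sup>2) \<longlonglongrightarrow> (LINT x|lborel. \<phi> x)\<^sup>2"
      by (intro tendsto_intros l2)
    show "\<exists>N. \<forall>n\<ge>N. measure lborel (ball (0::real^'n) \<delta>) * ((LINT x|lborel. (\<psi> n x)\<^sup>2)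
        - \<delta>\<^sup>2 / 2 * (LINT x|lborel. (norm (gradient (\<psi> n) x))\<^sup>2)) \<le> (LINT x|lborel. \<bar>\<psi> n x\<bar>)\<^sup>2"
      by (intro exI[of _ 0] allI impI nash_inequality[OF smooth_\<psi> \<psi>_bounded_support])
  qed
qed

lemma positive_set: "{x. 0 < v x - q x} \<in> sets borel" "{x. 0 < v x - q x} \<subseteq> C"
proof -
  show "{x. 0 < v x - q x} \<in> sets borel" by measurable
  show "{x. 0 < v x - q x} \<subseteq> C"
    using outside_C q_ge v_le by (smt (verit, best) mem_Collect_eq subsetI)
qed

lemma emeasure_positive_set: "emeasure lborel {x. 0 < v x - q x} < \<infinity>"
proof -
  have "emeasure lborel {x. 0 < v x - q x} \<le> emeasure lborel C" by (intro emeasure_mono positive_set) auto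
  also have "\<dots> < \<infinity>" by (intro emeasure_compact_finite) simp
  finally show ?thesis .
qed

text \<open>By Cauchy-Schwarz on the positivity set S, the squared L^1 norm is at most |S| times the
  squared L^2 norm. When |S| is at most half the measure of the \<delta>-ball, this is absorbed by
  half of the left side of Nash's inequality, and the two factors 1/2 cancel. Here \<delta> is
  comparable to |S|^{1/n} when chosen optimally.\<close>

lemma faber_krahn:
  assumes small: "2 * measure lborel {x. 0 < v x - q x} \<le> measure lborel (ball (0::real^'n) \<delta>)" and "0 < \<delta>"
  shows "(LINT x|lborel. (\<phi> x)\<^sup>2) \<le> \<delta>\<^sup>2 * (LINT x|lborel. (norm (D\<phi> x))\<^sup>2)"
proof -
  let ?S = "{x. 0 < v x - q x}" and ?m = "measure lborel (ball (0::real^'n) \<delta>)"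
  define X Y where "X = (LINT x|lborel. (\<phi> x)\<^sup>2)" and "Y = (LINT x|lborel. (norm (D\<phi> x))\<^sup>2)"
  have [measurable]: "?S \<in> sets borel" by (rule positive_set)
  have iS: "integrable lborel (\<lambda>x. (indicat_real ?S x)\<^sup>2)"
    unfolding indicator_square using emeasure_positive_set by (intro integrable_real_indicator) auto
  have "(LINT x|lborel. \<phi> x * indicat_real ?S x) = (LINT x|lborel. \<phi> x)"
    unfolding \<phi>_def using soft_pos_eq_0[OF a_pos]
    by (intro Bochner_Integration.integral_cong) (auto simp: indicator_def)
  moreover have "(LINT x|lborel. (indicat_real ?S x)\<^sup>2) = measure lborel ?S"
    unfolding indicator_square by simp
  ultimately have "(LINT x|lborel. \<phi> x)\<^sup>2 \<le> X * measure lborel ?S"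
    using L2_cauchy_schwarz(2)[OF _ _ integrable_\<phi>2 iS] by (simp add: X_def)
  with nash_\<phi>[of \<delta>] have "?m * (X - \<delta>\<^sup>2 / 2 * Y) \<le> X * measure lborel ?S"
    by (simp add: X_def Y_def)
  also have "\<dots> \<le> X * (?m / 2)" using small by (intro mult_left_mono) (auto simp: X_def)
  finally have "?m * (X - \<delta>\<^sup>2 * Y) \<le> 0" by (simp add: algebra_simps)
  moreover have "0 < ?m" using \<open>0 < \<delta>\<close> by simp
  ultimately have "X - \<delta>\<^sup>2 * Y \<le> 0" by (simp add: mult_le_0_iff)
  then show ?thesis by (simp add: X_def Y_def)
qed

lemma \<phi>_integrable: "integrable lborel \<phi>"
proof -
  have "integrable lborel (\<lambda>x. (indicat_real C x)\<^sup>2)"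
    using integrable_indicator_C[of 1] by (simp add: indicator_square)
  from L2_cauchy_schwarz(1)[OF _ _ integrable_\<phi>2 this]
  have "integrable lborel (\<lambda>x. \<phi> x * indicat_real C x)" by simp
  moreover have "\<phi> x * indicat_real C x = \<phi> x" for x
    by (cases "x \<in> C") (simp_all add: \<phi>_vanishing[OF outside_C])
  ultimately show ?thesis by (simp only:)
qed

text \<open>With $\zeta = Du - Dq$ one has $\langle A Du,\zeta\rangle = \langle A\zeta,\zeta\rangle + \langle A Dq,\zeta\rangle
  \ge \frac12\langle A\zeta,\zeta\rangle - \frac12\langle A Dq,Dq\rangle$.\<close>

lemma energy_inequality:
  fixes A :: "real^'n \<Rightarrow> real^'n^'n" and f :: "real \<Rightarrow> real"
  assumes ell: "elliptic_field l L U A" and l: "0 < l"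
    and int: "integrable (lebesgue_on U) (\<lambda>x. f (u x) * \<phi> x)"
    and le: "(LINT x|lebesgue_on U. (A x *v Du x) \<bullet> D\<phi> x) \<le> - (LINT x|lebesgue_on U. f (u x) * \<phi> x)"
    and b: "\<And>x. x \<in> C \<Longrightarrow> norm (gradient q x) \<le> b"
    and m: "\<And>x. x \<in> B \<Longrightarrow> 0 < v x - q x \<Longrightarrow> m \<le> f (u x)"
  shows "l * (LINT x|lborel. (norm (D\<phi> x))\<^sup>2) + 2 * m * (LINT x|lborel. \<phi> x)
    \<le> L * b\<^sup>2 * measure lborel {x. 0 < v x - q x}"
proof -
  let ?S = "{x. 0 < v x - q x}"
  let ?I = "\<lambda>x. (A x *v Du x) \<bullet> D\<phi> x"
  have [measurable]: "?S \<in> sets borel" by (rule positive_set)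
  have SC: "?S \<subseteq> C" by (rule positive_set)
  have sym: "transpose (A x) = A x" if "x \<in> U" for x using ell that by (simp add: elliptic_field_def)
  have lo: "l * (norm \<xi>)\<^sup>2 \<le> (A x *v \<xi>) \<bullet> \<xi>" and hi: "(A x *v \<xi>) \<bullet> \<xi> \<le> L * (norm \<xi>)\<^sup>2" if "x \<in> U" for x \<xi>
    using ell that by (simp_all add: elliptic_field_def)
  have psd: "0 \<le> (A x *v \<xi>) \<bullet> \<xi>" if "x \<in> U" for x \<xi>
    using lo[OF that, of \<xi>] l by (smt (verit) mult_nonneg_nonneg zero_le_power2)
  \<comment> \<open>Nonnegativity of the quadratic form at the sum and at the difference of the two
    vectors; symmetry merges the mixed terms.\<close>
  have cross: "2 * \<bar>(A x *v \<xi>) \<bullet> \<eta>\<bar> \<le> (A x *v \<xi>) \<bullet> \<xi> + (A x *v \<eta>) \<bullet> \<eta>" if "x \<in> U" for x \<xi> \<eta>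
    using psd[OF that, of "\<xi> + \<eta>"] psd[OF that, of "\<xi> - \<eta>"] symmetric_matrix_inner[OF sym[OF that], of \<eta> \<xi>]
    by (simp add: matrix_vector_right_distrib matrix_vector_mult_diff_distrib inner_simps abs_if)
  have mI: "?I \<in> borel_measurable (lebesgue_on U)"
    using ell unfolding elliptic_field_def
    by (intro borel_measurable_inner matrix_vector_mult_measurable borel_measurable_lebesgue_on[OF Du_borel]
        borel_measurable_lebesgue_on[OF \<phi>_borel(2)]) auto
  have iDu: "integrable (lebesgue_on U) (\<lambda>x. (norm (Du x))\<^sup>2)"
    using W by (simp add: has_W12_gradient_def square_integrable_on_def)
  have iD\<phi>: "integrable (lebesgue_on U) (\<lambda>x. (norm (D\<phi> x))\<^sup>2)"
    using has_W12_gradient_\<phi> by (simp add: has_W12_gradient_def square_integrable_on_def)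
  have iI: "integrable (lebesgue_on U) ?I"
  proof (rule Bochner_Integration.integrable_bound[OF _ mI])
    show "integrable (lebesgue_on U) (\<lambda>x. L * (norm (Du x))\<^sup>2 + L * (norm (D\<phi> x))\<^sup>2)"
      using iDu iD\<phi> by simp
    have "\<bar>?I x\<bar> \<le> L * (norm (Du x))\<^sup>2 + L * (norm (D\<phi> x))\<^sup>2" if "x \<in> U" for x
      using cross[OF that, of "Du x" "D\<phi> x"] hi[OF that, of "Du x"] hi[OF that, of "D\<phi> x"] by linarith
    then show "AE x in lebesgue_on U. norm (?I x) \<le> norm (L * (norm (Du x))\<^sup>2 + L * (norm (D\<phi> x))\<^sup>2)"
      by (intro AE_I2) force
  qed
  have ind0: "indicat_real ?S x = 0" if "x \<notin> U" for x
  proof -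
    have "x \<notin> ?S" using that SC C_sub_B ball_sub by blast
    then show ?thesis by simp
  qed
  have iS: "integrable (lebesgue_on U) (indicat_real ?S)"
    using ind0 emeasure_positive_set by (subst lebesgue_on_integral_vanishing) auto
  have pt: "l / 2 * (norm (D\<phi> x))\<^sup>2 - L * b\<^sup>2 / 2 * indicator ?S x \<le> ?I x" if x: "x \<in> U" for x
  proof (cases "x \<in> ?S")
    case False
    then have "D\<phi> x = 0" unfolding D\<phi>_def by (simp add: soft_pos_deriv_eq_0[OF a_pos])
    then show ?thesis using False by simp
  next
    case True
    define g \<zeta> c where "g = gradient q x" and "\<zeta> = Du x - g" and "c = soft_pos_deriv a (v x - q x)"
    have c: "0 \<le> c" "c \<le> 1" by (simp_all add: c_def soft_pos_deriv_nonneg soft_pos_deriv_le_1)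
    have g: "(norm g)\<^sup>2 \<le> b\<^sup>2" unfolding g_def using b True SC by (intro power_mono) auto
    \<comment> \<open>Inserting a unit vector into both ellipticity bounds gives l <= L.\<close>
    have L0: "0 \<le> L" using lo[OF x, of "axis undefined 1"] hi[OF x, of "axis undefined 1"] l by (simp add: norm_axis_1)
    have "(A x *v Du x) \<bullet> \<zeta> = (A x *v \<zeta>) \<bullet> \<zeta> + (A x *v g) \<bullet> \<zeta>"
      by (simp add: \<zeta>_def matrix_vector_mult_diff_distrib inner_simps)
    moreover have "- (A x *v g) \<bullet> \<zeta> * 2 \<le> (A x *v g) \<bullet> g + (A x *v \<zeta>) \<bullet> \<zeta>"
      using cross[OF x, of g \<zeta>] by (simp add: abs_if split: if_splits)
    moreover have "(A x *v g) \<bullet> g \<le> L * b\<^sup>2"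
      using hi[OF x, of g] mult_left_mono[OF g L0] by linarith
    ultimately have "l / 2 * (norm \<zeta>)\<^sup>2 - L * b\<^sup>2 / 2 \<le> (A x *v Du x) \<bullet> \<zeta>"
      using lo[OF x, of \<zeta>] by simp
    from mult_left_mono[OF this c(1)]
    have "c * (l / 2 * (norm \<zeta>)\<^sup>2) - c * (L * b\<^sup>2 / 2) \<le> ?I x"
      by (simp add: D\<phi>_def \<zeta>_def g_def c_def right_diff_distrib)
    moreover have "c * (L * b\<^sup>2 / 2) \<le> L * b\<^sup>2 / 2" using c L0 by (intro mult_left_le_one_le) auto
    \<comment> \<open>The squared gradient carries c^2 while the tested form carries a single c; c^2
      <= c since the slope lies in [0,1].\<close>
    moreover have "l / 2 * (norm (D\<phi> x))\<^sup>2 \<le> c * (l / 2 * (norm \<zeta>)\<^sup>2)"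
    proof -
      have "c\<^sup>2 * (l / 2 * (norm \<zeta>)\<^sup>2) \<le> c * (l / 2 * (norm \<zeta>)\<^sup>2)"
        using c l by (intro mult_right_mono) (auto simp: power2_eq_square mult_left_le)
      then show ?thesis by (simp add: D\<phi>_def \<zeta>_def g_def c_def power_mult_distrib mult.left_commute)
    qed
    ultimately show ?thesis using True by simp
  qed
  have "l / 2 * (LINT x|lborel. (norm (D\<phi> x))\<^sup>2) - L * b\<^sup>2 / 2 * measure lborel ?S
    = l / 2 * (LINT x|lebesgue_on U. (norm (D\<phi> x))\<^sup>2) - L * b\<^sup>2 / 2 * (LINT x|lebesgue_on U. indicat_real ?S x)"
  proof -
    have "(LINT x|lebesgue_on U. (norm (D\<phi> x))\<^sup>2) = (LINT x|lborel. (norm (D\<phi> x))\<^sup>2)"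
      using zero_outside_U by (intro lebesgue_on_integral_vanishing) auto
    moreover have "(LINT x|lebesgue_on U. indicat_real ?S x) = (LINT x|lborel. indicat_real ?S x)"
      using ind0 by (intro lebesgue_on_integral_vanishing) auto
    ultimately show ?thesis by simp
  qed
  also have "\<dots> = (LINT x|lebesgue_on U. l / 2 * (norm (D\<phi> x))\<^sup>2 - L * b\<^sup>2 / 2 * indicator ?S x)"
    using iD\<phi> iS by simp
  also have "\<dots> \<le> (LINT x|lebesgue_on U. ?I x)"
    using iD\<phi> iS iI pt by (intro integral_mono) auto
  also have "\<dots> \<le> - (LINT x|lebesgue_on U. f (u x) * \<phi> x)" by (rule le)
  also have "\<dots> \<le> - (LINT x|lebesgue_on U. m * \<phi> x)"
  proof -
    have "(LINT x|lebesgue_on U. m * \<phi> x) \<le> (LINT x|lebesgue_on U. f (u x) * \<phi> x)"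
    proof (rule integral_mono[OF _ int])
      show "integrable (lebesgue_on U) (\<lambda>x. m * \<phi> x)"
        using \<phi>_integrable zero_outside_U by (subst lebesgue_on_integral_vanishing) auto
      fix x
      show "m * \<phi> x \<le> f (u x) * \<phi> x"
      proof (cases "x \<in> ?S")
        case True
        then have "x \<in> B" using SC C_sub_B by blast
        then show ?thesis using True m[of x] \<phi>_nonneg[of x] by (intro mult_right_mono) auto
      next
        case False
        then have "\<phi> x = 0" unfolding \<phi>_def by (simp add: soft_pos_eq_0[OF a_pos])
        then show ?thesis by simp
      qed
    qed
    then show ?thesis by simp
  qed
  also have "(LINT x|lebesgue_on U. m * \<phi> x) = m * (LINT x|lborel. \<phi> x)"
    using zero_outside_U by (subst lebesgue_on_integral_vanishing) auto
  finally show ?thesis by (simp add: field_simps)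
qed

text \<open>Chebyshev's inequality for the square and for the first power. The height is a/e because
  \<open>soft_pos a\<close> is at least that from \<open>a\<close> onwards.\<close>

lemma level_estimate:
  assumes "\<And>x. x \<in> S \<Longrightarrow> a \<le> v x - q x" and S: "S \<in> sets borel"
  shows "(a * exp (- 1))\<^sup>2 * measure lborel S \<le> (LINT x|lborel. (\<phi> x)\<^sup>2)"
    and "a * exp (- 1) * measure lborel S \<le> (LINT x|lborel. \<phi> x)"
proof -
  have le: "a * exp (- 1) \<le> \<phi> x" if "x \<in> S" for x
    unfolding \<phi>_def using assms(1)[OF that] by (intro soft_pos_ge a_pos)
  have "S \<subseteq> {x. 0 < v x - q x}" using assms(1) a_pos by force
  then have "emeasure lborel S \<le> emeasure lborel {x. 0 < v x - q x}"
    using positive_set(1) by (intro emeasure_mono) auto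
  then have fin: "emeasure lborel S < \<infinity>" using emeasure_positive_set by (rule le_less_trans)
  then have i: "integrable lborel (\<lambda>x. c * indicat_real S x)" for c
    using S by (intro integrable_mult_right integrable_real_indicator) auto
  have "(LINT x|lborel. (a * exp (- 1))\<^sup>2 * indicat_real S x) \<le> (LINT x|lborel. (\<phi> x)\<^sup>2)"
  proof (intro integral_mono i integrable_\<phi>2)
    fix x
    show "(a * exp (- 1))\<^sup>2 * indicat_real S x \<le> (\<phi> x)\<^sup>2"
      using le[of x] a_pos power_mono[of "a * exp (- 1)" "\<phi> x" 2] by (cases "x \<in> S") auto
  qed
  then show "(a * exp (- 1))\<^sup>2 * measure lborel S \<le> (LINT x|lborel. (\<phi> x)\<^sup>2)" using S by simp
  have "(LINT x|lborel. a * exp (- 1) * indicat_real S x) \<le> (LINT x|lborel. \<phi> x)"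
  proof (intro integral_mono i \<phi>_integrable)
    fix x
    show "a * exp (- 1) * indicat_real S x \<le> \<phi> x"
      using le[of x] \<phi>_nonneg[of x] by (cases "x \<in> S") auto
  qed
  then show "a * exp (- 1) * measure lborel S \<le> (LINT x|lborel. \<phi> x)" using S by simp
qed

end

section \<open>The growth estimate\<close>

lemma measure_ball_scale:
  assumes "0 < r" "0 \<le> c"
  shows "measure lborel (ball (0::real^'n::finite) (c * r)) = c ^ CARD('n) * measure lborel (ball (0::real^'n) r)"
  using assms by (simp add: content_ball power_mult_distrib)

text \<open>\<open>Du\<close> is one fixed Borel representative, and \<open>sub\<close> is the weak
  inequality for that same representative, restricted to test functions that are nonnegative
  everywhere. This isolates the estimate from the existential quantifier in
  \<open>subsolution\<close>.\<close>

locale growth =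
  fixes l L :: real and A :: "real^'n::finite \<Rightarrow> real^'n^'n" and f :: "real \<Rightarrow> real"
    and U :: "(real^'n) set" and u :: "real^'n \<Rightarrow> real" and Du :: "real^'n \<Rightarrow> real^'n"
    and z :: "real^'n" and \<rho> t :: real
  assumes l_pos: "0 < l" and l_le_L: "l \<le> L" and ell: "elliptic_field l L U A"
    and mono_f: "mono f" and f_nonneg: "\<And>s. 0 \<le> f s"
    and open_U: "open U" and W: "has_W12_gradient U u Du" and Du_borel: "Du \<in> borel_measurable borel"
    and cont: "continuous_on U u" and ball_sub: "ball z \<rho> \<subseteq> U"
    and u_nonneg: "\<And>x. x \<in> ball z \<rho> \<Longrightarrow> 0 \<le> u x" and u_le: "\<And>x. x \<in> ball z \<rho> \<Longrightarrow> u x \<le> 2 * t"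
    and u_center: "u z = t" and t_pos: "0 < t" and \<rho>_pos: "0 < \<rho>"
    and sub: "\<And>\<phi> D\<phi>. \<phi> \<in> W12_0 U \<Longrightarrow> has_W12_gradient U \<phi> D\<phi> \<Longrightarrow> (\<And>x. 0 \<le> \<phi> x) \<Longrightarrow>
        integrable (lebesgue_on U) (\<lambda>x. f (u x) * \<phi> x) \<and>
        (LINT x|lebesgue_on U. (A x *v Du x) \<bullet> D\<phi> x) \<le> - (LINT x|lebesgue_on U. f (u x) * \<phi> x)"
begin

text \<open>The paraboloid equals 2t on the sphere of radius \<rho> and 0 at the centre, where
  \<open>P\<close> takes the value t. \<open>q k\<close> is the matching obstacle: u exceeds
  \<open>q k\<close> in the ball exactly where \<open>P\<close> exceeds k.\<close>

definition P :: "real^'n \<Rightarrow> real" where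
  "P x = indicator (ball z \<rho>) x * u x - 2 * t / \<rho>\<^sup>2 * (norm (x - z))\<^sup>2"
definition q :: "real \<Rightarrow> real^'n \<Rightarrow> real" where
  "q k x = k + 2 * t / \<rho>\<^sup>2 * (norm (x - z))\<^sup>2"
definition S :: "real \<Rightarrow> (real^'n) set" where "S k = {x. k < P x}"

lemma gradient_q: "gradient (q k) x = (4 * t / \<rho>\<^sup>2) *\<^sub>R (x - z)"
proof (rule gradient_eq)
  have "((\<lambda>x. (x - z) \<bullet> (x - z)) has_derivative (\<lambda>h. (x - z) \<bullet> h + h \<bullet> (x - z))) (at x)"
    by (auto intro!: derivative_eq_intros)
  then have "((\<lambda>x. (norm (x - z))\<^sup>2) has_derivative (\<lambda>h. 2 * ((x - z) \<bullet> h))) (at x)"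
    by (simp add: power2_norm_eq_inner inner_commute)
  from has_derivative_add[OF has_derivative_const[of k] has_derivative_mult_right[OF this, of "2 * t / \<rho>\<^sup>2"]]
  have "(q k has_derivative (\<lambda>h. 0 + 2 * t / \<rho>\<^sup>2 * (2 * ((x - z) \<bullet> h)))) (at x)"
    unfolding q_def .
  moreover have "(\<lambda>h. 0 + 2 * t / \<rho>\<^sup>2 * (2 * ((x - z) \<bullet> h))) = (\<bullet>) ((4 * t / \<rho>\<^sup>2) *\<^sub>R (x - z))"
    by (rule ext) simp
  ultimately show "(q k has_derivative (\<bullet>) ((4 * t / \<rho>\<^sup>2) *\<^sub>R (x - z))) (at x)"
    by (simp only:)
qed

text \<open>At the lowest level t/2 the paraboloid has to supply the remaining 3t/2, that is 3/4 of
  2t. The radius 7/8 \<rho> suffices because (7/8)^2 = 49/64 exceeds 3/4.\<close>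

lemma truncation_at_level:
  assumes k: "t / 2 \<le> k" and a: "0 < a"
  shows "truncation U u Du z \<rho> (7 / 8 * \<rho>) (2 * t) (q k) a"
proof
  show "smooth (q k)"
    unfolding q_def by (intro smooth_add smooth_mult smooth_const smooth_dist_sq)
  show "2 * t \<le> q k x" if "7 / 8 * \<rho> \<le> norm (x - z)" for x
  proof -
    have "(7 / 8 * \<rho>)\<^sup>2 \<le> (norm (x - z))\<^sup>2" using that \<rho>_pos by (intro power_mono) auto
    then have "2 * t / \<rho>\<^sup>2 * (49 / 64 * \<rho>\<^sup>2) \<le> 2 * t / \<rho>\<^sup>2 * (norm (x - z))\<^sup>2"
      using t_pos by (intro mult_left_mono) (auto simp: power2_eq_square)
    moreover have "2 * t / \<rho>\<^sup>2 * (49 / 64 * \<rho>\<^sup>2) = 98 / 64 * t" using \<rho>_pos by simp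
    ultimately show ?thesis using k t_pos by (simp add: q_def)
  qed
qed (use open_U W Du_borel cont ball_sub u_nonneg u_le \<rho>_pos a in auto)

text \<open>Where P > k, also u >= P > k >= t/2, so monotonicity replaces f(u) by the constant
  f(t/2). The factor 4t/\<rho> bounds the gradient of the paraboloid on the ball.\<close>

lemma energy:
  assumes k: "t / 2 \<le> k" and a: "0 < a"
  shows "l * (LINT x|lborel. (norm (truncation.D\<phi> u Du z \<rho> (q k) a x))\<^sup>2)
      + 2 * f (t / 2) * (LINT x|lborel. truncation.\<phi> u z \<rho> (q k) a x)
    \<le> L * (4 * t / \<rho>)\<^sup>2 * measure lborel (S k)"
proof -
  interpret truncation U u Du z \<rho> "7 / 8 * \<rho>" "2 * t" "q k" a by (rule truncation_at_level[OF k a])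
  note s = sub[OF \<phi>_in_W12_0 has_W12_gradient_\<phi> \<phi>_nonneg]
  have eq: "{x. 0 < v x - q k x} = S k" by (auto simp: S_def P_def v_def q_def)
  show ?thesis
    unfolding eq[symmetric]
  proof (rule energy_inequality[OF ell l_pos s[THEN conjunct1] s[THEN conjunct2]])
    fix x assume "x \<in> cball z (7 / 8 * \<rho>)"
    then have "norm (x - z) \<le> \<rho>" using \<rho>_pos by (simp add: dist_norm norm_minus_commute)
    then have "4 * t / \<rho>\<^sup>2 * norm (x - z) \<le> 4 * t / \<rho>\<^sup>2 * \<rho>"
      using t_pos by (intro mult_left_mono) auto
    also have "\<dots> = 4 * t / \<rho>" by (simp add: power2_eq_square)
    finally show "norm (gradient (q k) x) \<le> 4 * t / \<rho>"
      using t_pos by (simp add: gradient_q)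
  next
    fix x assume x: "x \<in> ball z \<rho>" "0 < v x - q k x"
    have "0 \<le> 2 * t / \<rho>\<^sup>2 * (norm (x - z))\<^sup>2" using t_pos by simp
    with x k have "t / 2 \<le> u x" by (simp add: v_def q_def)
    then show "f (t / 2) \<le> f (u x)" using mono_f by (simp add: monoD)
  qed
qed

lemma S_borel: "S k \<in> sets borel" if "t / 2 \<le> k"
proof -
  interpret truncation U u Du z \<rho> "7 / 8 * \<rho>" "2 * t" "q k" 1 by (rule truncation_at_level[OF that]) simp
  have "{x. 0 < v x - q k x} = S k" by (auto simp: S_def P_def v_def q_def)
  with positive_set(1) show ?thesis by (simp only:)
qed

lemma S_sub_ball: "S k \<subseteq> ball z \<rho>" if "t / 2 \<le> k"
proof -
  interpret truncation U u Du z \<rho> "7 / 8 * \<rho>" "2 * t" "q k" 1 by (rule truncation_at_level[OF that]) simp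
  have "{x. 0 < v x - q k x} = S k" by (auto simp: S_def P_def v_def q_def)
  with positive_set(2) C_sub_B show ?thesis by blast
qed

text \<open>One step of Stampacchia's iteration: Chebyshev at level k + a for the truncation at k,
  then Faber-Krahn, then the energy inequality with its nonnegative f-term dropped.\<close>

lemma decay_step:
  assumes k: "t / 2 \<le> k" and a: "0 < a" and \<delta>: "0 < \<delta>"
    and small: "2 * measure lborel (S k) \<le> measure lborel (ball (0::real^'n) \<delta>)"
  shows "l * (a * exp (- 1))\<^sup>2 * measure lborel (S (k + a)) \<le> \<delta>\<^sup>2 * (L * (4 * t / \<rho>)\<^sup>2 * measure lborel (S k))"
proof -
  interpret truncation U u Du z \<rho> "7 / 8 * \<rho>" "2 * t" "q k" a by (rule truncation_at_level[OF k a])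
  have eq: "{x. 0 < v x - q k x} = S k" by (auto simp: S_def P_def v_def q_def)
  have lev: "a \<le> v x - q k x" if "x \<in> S (k + a)" for x
    using that by (simp add: S_def P_def v_def q_def)
  have "(a * exp (- 1))\<^sup>2 * measure lborel (S (k + a)) \<le> (LINT x|lborel. (\<phi> x)\<^sup>2)"
    by (rule level_estimate(1)[OF lev S_borel]) (use k a in auto)
  also have "\<dots> \<le> \<delta>\<^sup>2 * (LINT x|lborel. (norm (D\<phi> x))\<^sup>2)"
    using small \<delta> by (intro faber_krahn) (simp_all only: eq)
  finally have "l * ((a * exp (- 1))\<^sup>2 * measure lborel (S (k + a))) \<le> l * (\<delta>\<^sup>2 * (LINT x|lborel. (norm (D\<phi> x))\<^sup>2))"
    using l_pos by (intro mult_left_mono) auto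
  also have "\<dots> = \<delta>\<^sup>2 * (l * (LINT x|lborel. (norm (D\<phi> x))\<^sup>2))" by simp
  also have "\<dots> \<le> \<delta>\<^sup>2 * (L * (4 * t / \<rho>)\<^sup>2 * measure lborel (S k))"
  proof (intro mult_left_mono)
    have "0 \<le> 2 * f (t / 2) * (LINT x|lborel. \<phi> x)"
      using f_nonneg \<phi>_nonneg by (intro mult_nonneg_nonneg integral_nonneg_AE) auto
    then show "l * (LINT x|lborel. (norm (D\<phi> x))\<^sup>2) \<le> L * (4 * t / \<rho>)\<^sup>2 * measure lborel (S k)"
      using energy[OF k a] by simp
  qed simp
  finally show ?thesis by (simp add: mult.assoc)
qed

text \<open>Chosen such that with radii $\delta_j = 2^{-j}\kappa\rho$ and level increments $2^{-j}t/16$ each iteration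
  step shrinks the superlevel set by the factor $2^{-n}$, in accordance with the ball of radius
  $\delta_{j+1}$.\<close>

definition \<kappa> :: real where "\<kappa> = sqrt (l * exp (- 2) / (4096 * L * 2 ^ CARD('n)))"

lemma \<kappa>_pos: "0 < \<kappa>"
  using l_pos l_le_L by (simp add: \<kappa>_def)

text \<open>The levels rise from 3t/4 towards 7t/8 and thus stay below t. The bound is at once the
  outcome of one step and the smallness that Faber-Krahn requires in the next, which is why the
  radius is halved along with the increment.\<close>

lemma measure_S_small:
  assumes small: "2 * measure lborel (S (3 / 4 * t)) \<le> measure lborel (ball (0::real^'n) (\<kappa> * \<rho>))"
  shows "2 * measure lborel (S (3 / 4 * t + t / 8 * (1 - (1 / 2) ^ j)))
    \<le> measure lborel (ball (0::real^'n) ((1 / 2) ^ j * (\<kappa> * \<rho>)))"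
proof (induction j)
  case 0
  then show ?case using small by simp
next
  case (Suc j)
  define k where "k = 3 / 4 * t + t / 8 * (1 - (1 / 2) ^ j)"
  define a where "a = t / 16 * (1 / 2) ^ j"
  define \<delta> where "\<delta> = (1 / 2) ^ j * (\<kappa> * \<rho>)"
  have "(1 / 2) ^ j \<le> (1::real)" by (simp add: power_le_one)
  then have "0 \<le> t / 8 * (1 - (1 / 2) ^ j)" using t_pos by (intro mult_nonneg_nonneg) auto
  then have "t / 2 \<le> k" using t_pos unfolding k_def by linarith
  moreover have a: "0 < a" using t_pos by (simp add: a_def)
  moreover have \<delta>: "0 < \<delta>" using \<kappa>_pos \<rho>_pos by (simp add: \<delta>_def)
  ultimately have step: "l * (a * exp (- 1))\<^sup>2 * measure lborel (S (k + a)) \<le> \<delta>\<^sup>2 * (L * (4 * t / \<rho>)\<^sup>2 * measure lborel (S k))"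
    using Suc unfolding k_def[symmetric] \<delta>_def[symmetric] by (intro decay_step)
  have Lp: "0 < L" using l_pos l_le_L by simp
  \<comment> \<open>The number 4096 is 16 * 16^2: one factor 16 comes from (4t/\<rho>)^2, and 16^2
    from the increment t/16. The power of 2 provides the required shrinking, and
    \<open>exp (- 2)\<close> is the squared loss in Chebyshev's inequality for
    \<open>soft_pos\<close>.\<close>
  have k2: "\<kappa>\<^sup>2 * (4096 * L * 2 ^ CARD('n)) = l * exp (- 2)"
    using l_pos Lp by (simp add: \<kappa>_def)
  have "(exp (- 1))\<^sup>2 = exp (- 2 :: real)" by (simp flip: exp_double)
  then have "\<delta>\<^sup>2 * (L * (4 * t / \<rho>)\<^sup>2) * 2 ^ CARD('n) = l * (a * exp (- 1))\<^sup>2"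
    using k2 \<rho>_pos by (simp add: \<delta>_def a_def power_mult_distrib power_divide field_simps)
  then have eq: "\<delta>\<^sup>2 * (L * (4 * t / \<rho>)\<^sup>2) = l * (a * exp (- 1))\<^sup>2 * (1 / 2) ^ CARD('n)"
    by (simp add: field_simps power_divide)
  have "l * (a * exp (- 1))\<^sup>2 * measure lborel (S (k + a)) \<le> l * (a * exp (- 1))\<^sup>2 * ((1 / 2) ^ CARD('n) * measure lborel (S k))"
    using step unfolding mult.assoc[symmetric] eq[unfolded mult.assoc[symmetric]] .
  then have "measure lborel (S (k + a)) \<le> (1 / 2) ^ CARD('n) * measure lborel (S k)"
    using l_pos a by (subst (asm) mult_le_cancel_left_pos) auto
  also have "2 * \<dots> \<le> (1 / 2) ^ CARD('n) * measure lborel (ball (0::real^'n) \<delta>)"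
    using Suc unfolding k_def[symmetric] \<delta>_def[symmetric] by simp
  also have "\<dots> = measure lborel (ball (0::real^'n) (1 / 2 * \<delta>))"
    by (rule measure_ball_scale[symmetric]) (use \<delta> in auto)
  finally have "2 * measure lborel (S (k + a)) \<le> measure lborel (ball (0::real^'n) (1 / 2 * \<delta>))" by simp
  moreover have "k + a = 3 / 4 * t + t / 8 * (1 - (1 / 2) ^ Suc j)" by (simp add: k_def a_def algebra_simps)
  moreover have "1 / 2 * \<delta> = (1 / 2) ^ Suc j * (\<kappa> * \<rho>)" by (simp add: \<delta>_def)
  ultimately show ?case by simp
qed

text \<open>Otherwise the iteration never stops and makes S(7t/8) a null set. But \<open>P\<close>
  is continuous near \<open>z\<close> with value t > 7t/8 there, so this set contains a
  ball.\<close>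

lemma measure_S_large:
  "measure lborel (ball (0::real^'n) (\<kappa> * \<rho>)) < 2 * measure lborel (S (3 / 4 * t))"
proof (rule ccontr)
  assume "\<not> ?thesis"
  then have small: "2 * measure lborel (S (3 / 4 * t)) \<le> measure lborel (ball (0::real^'n) (\<kappa> * \<rho>))" by simp
  define m where "m = measure lborel (S (7 / 8 * t))"
  have fin: "emeasure lborel (S k) < \<infinity>" if "t / 2 \<le> k" for k
    using emeasure_mono[OF S_sub_ball[OF that], of lborel] emeasure_lborel_ball_finite[of z \<rho>]
    by (auto intro: le_less_trans)
  have "2 * m \<le> ((1 / 2) ^ CARD('n)) ^ j * measure lborel (ball (0::real^'n) (\<kappa> * \<rho>))" for j
  proof -
    let ?k = "3 / 4 * t + t / 8 * (1 - (1 / 2) ^ j)"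
    have "0 \<le> (1 / 2 :: real) ^ j" "(1 / 2 :: real) ^ j \<le> 1" by (simp_all add: power_le_one)
    then have "0 \<le> t / 8 * (1 - (1 / 2) ^ j)" "t / 8 * (1 - (1 / 2) ^ j) \<le> t / 8"
      using t_pos by (auto intro!: mult_left_le)
    then have k: "t / 2 \<le> ?k" "?k \<le> 7 / 8 * t" using t_pos by linarith+
    then have "S (7 / 8 * t) \<subseteq> S ?k" by (auto simp: S_def)
    then have "m \<le> measure lborel (S ?k)"
      unfolding m_def using S_borel k t_pos fin[OF k(1)]
      by (intro measure_mono_fmeasurable) (auto simp: fmeasurable_def)
    then have "2 * m \<le> measure lborel (ball (0::real^'n) ((1 / 2) ^ j * (\<kappa> * \<rho>)))"
      using measure_S_small[OF small, of j] by simp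
    also have "\<dots> = ((1 / 2) ^ j) ^ CARD('n) * measure lborel (ball (0::real^'n) (\<kappa> * \<rho>))"
      using \<kappa>_pos \<rho>_pos by (intro measure_ball_scale) auto
    finally show ?thesis by (simp add: power_mult[symmetric] mult.commute)
  qed
  moreover have "(\<lambda>j. ((1 / 2) ^ CARD('n)) ^ j * measure lborel (ball (0::real^'n) (\<kappa> * \<rho>))) \<longlonglongrightarrow> 0 * measure lborel (ball (0::real^'n) (\<kappa> * \<rho>))"
    by (intro tendsto_mult_right LIMSEQ_power_zero) (simp add: power_less_one_iff)
  ultimately have "2 * m \<le> 0" by (intro LIMSEQ_le_const) auto
  then have m0: "m = 0" by (simp add: m_def measure_le_0_iff)
  define g where "g x = u x - 2 * t / \<rho>\<^sup>2 * (norm (x - z))\<^sup>2" for x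
  have "isCont g z"
    unfolding g_def using continuous_on_subset[OF cont ball_sub] \<rho>_pos
    by (intro continuous_intros) (simp add: continuous_on_eq_continuous_at)
  then have "(g \<longlongrightarrow> g z) (nhds z)" by (simp only: isCont_def tendsto_at_iff_tendsto_nhds)
  then have "\<forall>\<^sub>F x in nhds z. 7 / 8 * t < g x"
    by (rule order_tendstoD(1)) (use t_pos u_center in \<open>simp add: g_def\<close>)
  moreover have "\<forall>\<^sub>F x in nhds z. x \<in> ball z \<rho>"
    using \<rho>_pos by (intro eventually_nhds_in_open) auto
  ultimately have "\<forall>\<^sub>F x in nhds z. x \<in> S (7 / 8 * t)"
    by eventually_elim (simp add: S_def P_def g_def)
  then obtain d where d: "0 < d" "ball z d \<subseteq> S (7 / 8 * t)"
    by (auto simp: eventually_nhds_metric subset_iff dist_commute)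
  have "0 < measure lborel (ball z d)" using d by simp
  also have "\<dots> \<le> m"
    unfolding m_def using d S_borel[of "7 / 8 * t"] t_pos fin[of "7 / 8 * t"]
    by (intro measure_mono_fmeasurable) (auto simp: fmeasurable_def)
  finally show False using m0 by simp
qed

text \<open>The truncation at level t/2 with width t/4 is at least t/(4e) on S(3t/4), whose measure
  exceeds half that of the ball of radius \<kappa>\<rho>. Thus the f-term of the energy inequality
  is at least f(t/2) t \<kappa>^n / (4e) times the measure of the ball of radius \<rho>, and the
  right side is at most 16 L t^2/\<rho>^2 times the same measure; dividing gives 64 = 16 *
  4.\<close>

lemma growth_bound: "f (t / 2) \<le> 64 * exp 1 * L / \<kappa> ^ CARD('n) * (t / \<rho>\<^sup>2)"
proof -
  define b where "b = measure lborel (ball (0::real^'n) \<rho>)"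
  have b: "0 < b" using \<rho>_pos by (simp add: b_def)
  interpret truncation U u Du z \<rho> "7 / 8 * \<rho>" "2 * t" "q (t / 2)" "t / 4" 
    by (rule truncation_at_level) (use t_pos in auto)
  have "measure lborel (S (t / 2)) \<le> measure lborel (ball z \<rho>)"
    using S_borel[of "t / 2"] S_sub_ball[of "t / 2"] emeasure_lborel_ball_finite[of z \<rho>]
    by (intro measure_mono_fmeasurable) (auto simp: fmeasurable_def)
  also have "\<dots> = b" using \<rho>_pos by (simp add: b_def content_ball)
  finally have up: "measure lborel (S (t / 2)) \<le> b" .
  have lev: "t / 4 \<le> v x - q (t / 2) x" if "x \<in> S (3 / 4 * t)" for x
    using that by (simp add: S_def P_def v_def q_def)
  have "\<kappa> ^ CARD('n) * b \<le> 2 * measure lborel (S (3 / 4 * t))"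
    using measure_S_large measure_ball_scale[of \<rho> \<kappa>, where 'n = 'n] \<kappa>_pos \<rho>_pos by (simp add: b_def)
  then have "t / 8 * exp (- 1) * (\<kappa> ^ CARD('n) * b) \<le> t / 8 * exp (- 1) * (2 * measure lborel (S (3 / 4 * t)))"
    using t_pos by (intro mult_left_mono) auto
  also have "\<dots> = t / 4 * exp (- 1) * measure lborel (S (3 / 4 * t))" by simp
  also have "\<dots> \<le> (LINT x|lborel. \<phi> x)"
    by (rule level_estimate(2)[OF lev S_borel]) (use t_pos in auto)
  finally have lo: "t / 8 * exp (- 1) * (\<kappa> ^ CARD('n) * b) \<le> (LINT x|lborel. \<phi> x)" .
  have "f (t / 2) * (2 * (t / 8 * exp (- 1) * (\<kappa> ^ CARD('n) * b))) \<le> f (t / 2) * (2 * (LINT x|lborel. \<phi> x))"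
    using lo f_nonneg by (intro mult_left_mono) auto
  also have "\<dots> \<le> l * (LINT x|lborel. (norm (D\<phi> x))\<^sup>2) + 2 * f (t / 2) * (LINT x|lborel. \<phi> x)"
    using l_pos by simp
  also have "\<dots> \<le> L * (4 * t / \<rho>)\<^sup>2 * measure lborel (S (t / 2))"
    using t_pos by (intro energy) auto
  also have "\<dots> \<le> L * (4 * t / \<rho>)\<^sup>2 * b"
    using up l_pos l_le_L by (intro mult_left_mono) auto
  finally have "f (t / 2) * (t / 4 * exp (- 1) * \<kappa> ^ CARD('n)) * b \<le> L * (4 * t / \<rho>)\<^sup>2 * b"
    by (simp add: mult_ac)
  then have "f (t / 2) * (t / 4 * exp (- 1) * \<kappa> ^ CARD('n)) \<le> L * (4 * t / \<rho>)\<^sup>2"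
    using b by simp
  then have "f (t / 2) \<le> L * (4 * t / \<rho>)\<^sup>2 / (t / 4 * exp (- 1) * \<kappa> ^ CARD('n))"
    using t_pos \<kappa>_pos by (simp add: pos_le_divide_eq)
  also have "\<dots> = 64 * exp 1 * L / \<kappa> ^ CARD('n) * (t / \<rho>\<^sup>2)"
    using t_pos \<kappa>_pos \<rho>_pos by (simp add: field_simps power2_eq_square exp_minus)
  finally show ?thesis .
qed

end

text \<open>Weak gradients are only Lebesgue measurable, but the product measures behind Fubini's theorem
  require Borel functions.\<close>

lemma ex_borel_representative:
  fixes g :: "real^'n::finite \<Rightarrow> real^'n"
  assumes U: "open U" and g: "g \<in> borel_measurable (lebesgue_on U)"
  obtains g' where "g' \<in> borel_measurable borel" "AE x in lebesgue_on U. g x = g' x"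
proof -
  have Us: "U \<in> sets lebesgue" using U by simp
  have "\<exists>g'\<in>borel_measurable lborel. AE x in lborel. (indicator U x *\<^sub>R g x) $ i = g' x" for i
  proof (rule completion_ex_borel_measurable_real)
    have "(\<lambda>x. indicator U x *\<^sub>R g x) \<in> borel_measurable lebesgue"
      using g borel_measurable_restrict_space_iff[of U lebesgue g] Us by simp
    then have "(\<lambda>x. (indicator U x *\<^sub>R g x) \<bullet> axis i 1) \<in> borel_measurable lebesgue" by measurable
    then show "(\<lambda>x. (indicator U x *\<^sub>R g x) $ i) \<in> borel_measurable lebesgue" by (simp add: inner_axis)
  qed
  then obtain G where G: "\<And>i. G i \<in> borel_measurable lborel" "\<And>i. AE x in lborel. (indicator U x *\<^sub>R g x) $ i = G i x"
    by metis
  define g' where "g' x = (\<chi> i. G i x)" for x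
  have "g' \<in> borel_measurable borel"
  proof (rule borel_measurable_euclidean_space[THEN iffD2, rule_format])
    fix e :: "real^'n" assume "e \<in> Basis"
    then obtain i where "e = axis i 1" by (auto simp: Basis_vec_def)
    then show "(\<lambda>x. g' x \<bullet> e) \<in> borel_measurable borel" using G(1)[of i] by (simp add: g'_def inner_axis)
  qed
  moreover have "AE x in lborel. \<forall>i\<in>UNIV. (indicator U x *\<^sub>R g x) $ i = G i x"
    using G(2) by (intro AE_finite_allI) auto
  then have "AE x in lborel. x \<in> U \<longrightarrow> g x = g' x"
    by eventually_elim (auto simp: g'_def vec_eq_iff)
  then have "AE x in lebesgue. x \<in> U \<longrightarrow> g x = g' x" by (rule AE_completion)
  then have "AE x in lebesgue_on U. g x = g' x" using Us by (subst AE_restrict_space_iff) auto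
  ultimately show ?thesis by (rule that)
qed

lemma has_W12_gradient_cong_AE:
  fixes g g' :: "real^'n::finite \<Rightarrow> real^'n"
  assumes W: "has_W12_gradient U u g" and g': "g' \<in> borel_measurable borel"
    and ae: "AE x in lebesgue_on U. g x = g' x"
  shows "has_W12_gradient U u g'"
proof -
  have gm: "g \<in> borel_measurable (lebesgue_on U)" using W by (simp add: has_W12_gradient_def square_integrable_on_def)
  have g'm: "g' \<in> borel_measurable (lebesgue_on U)" by (rule borel_measurable_lebesgue_on[OF g'])
  have "integrable (lebesgue_on U) (\<lambda>x. (norm (g x))\<^sup>2)"
    using W by (simp add: has_W12_gradient_def square_integrable_on_def)
  then have "integrable (lebesgue_on U) (\<lambda>x. (norm (g' x))\<^sup>2)"
    by (rule integrable_cong_AE_imp) (use g'm ae in auto)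
  then have "g' square_integrable_on U" using g'm by (simp add: square_integrable_on_def)
  moreover have "(LINT x|lebesgue_on U. g x $ i * \<phi> x) = (LINT x|lebesgue_on U. g' x $ i * \<phi> x)"
    if "\<phi> \<in> test_functions U" for \<phi> i
  proof (rule integral_cong_AE)
    have "\<phi> \<in> borel_measurable borel"
      using that by (intro borel_measurable_continuous_onI smooth_continuous) (simp add: test_functions_def smooth_def)
    then have pm: "\<phi> \<in> borel_measurable (lebesgue_on U)" by (rule borel_measurable_lebesgue_on)
    have "(\<lambda>x. h x \<bullet> axis i 1) \<in> borel_measurable (lebesgue_on U)"
      if "h \<in> borel_measurable (lebesgue_on U)" for h :: "real^'n \<Rightarrow> real^'n"
      using that by measurable
    then show "(\<lambda>x. g x $ i * \<phi> x) \<in> borel_measurable (lebesgue_on U)"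
      "(\<lambda>x. g' x $ i * \<phi> x) \<in> borel_measurable (lebesgue_on U)"
      using gm g'm pm by (auto simp: inner_axis)
    show "AE x in lebesgue_on U. g x $ i * \<phi> x = g' x $ i * \<phi> x"
      using ae by eventually_elim simp
  qed
  ultimately show ?thesis using W by (simp add: has_W12_gradient_def)
qed

lemma subsolution_borel_gradient:
  fixes A :: "real^'n::finite \<Rightarrow> real^'n^'n"
  assumes U: "open U" and ell: "elliptic_field l L U A" and sub: "subsolution A f U u"
  obtains Du where "Du \<in> borel_measurable borel" "has_W12_gradient U u Du"
    "\<And>\<phi> D\<phi>. \<phi> \<in> W12_0 U \<Longrightarrow> has_W12_gradient U \<phi> D\<phi> \<Longrightarrow> (\<And>x. 0 \<le> \<phi> x) \<Longrightarrow>
        integrable (lebesgue_on U) (\<lambda>x. f (u x) * \<phi> x) \<and>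
        (LINT x|lebesgue_on U. (A x *v Du x) \<bullet> D\<phi> x) \<le> - (LINT x|lebesgue_on U. f (u x) * \<phi> x)"
proof -
  from sub obtain g where W: "has_W12_gradient U u g"
    and g: "\<And>\<phi> D\<phi>. \<phi> \<in> W12_0 U \<Longrightarrow> has_W12_gradient U \<phi> D\<phi> \<Longrightarrow> (AE x in lebesgue_on U. 0 \<le> \<phi> x) \<Longrightarrow>
        integrable (lebesgue_on U) (\<lambda>x. f (u x) * \<phi> x) \<and>
        (LINT x|lebesgue_on U. (A x *v g x) \<bullet> D\<phi> x) \<le> - (LINT x|lebesgue_on U. f (u x) * \<phi> x)"
    unfolding subsolution_def by blast
  have gm: "g \<in> borel_measurable (lebesgue_on U)" using W by (simp add: has_W12_gradient_def square_integrable_on_def)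
  from ex_borel_representative[OF U gm] obtain Du where
    Du: "Du \<in> borel_measurable borel" and ae: "AE x in lebesgue_on U. g x = Du x" by blast
  have Am: "A \<in> borel_measurable (lebesgue_on U)" using ell by (simp add: elliptic_field_def)
  show ?thesis
  proof (rule that[OF Du has_W12_gradient_cong_AE[OF W Du ae]])
    fix \<phi> D\<phi> assume \<phi>: "\<phi> \<in> W12_0 U" "has_W12_gradient U \<phi> D\<phi>" "\<And>x. 0 \<le> \<phi> x"
    have Dm: "D\<phi> \<in> borel_measurable (lebesgue_on U)"
      using \<phi>(2) by (simp add: has_W12_gradient_def square_integrable_on_def)
    have "(LINT x|lebesgue_on U. (A x *v g x) \<bullet> D\<phi> x) = (LINT x|lebesgue_on U. (A x *v Du x) \<bullet> D\<phi> x)"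
    proof (rule integral_cong_AE)
      show "AE x in lebesgue_on U. (A x *v g x) \<bullet> D\<phi> x = (A x *v Du x) \<bullet> D\<phi> x"
        using ae by eventually_elim simp
    qed (intro borel_measurable_inner matrix_vector_mult_measurable Am gm Dm borel_measurable_lebesgue_on[OF Du])+
    then show "integrable (lebesgue_on U) (\<lambda>x. f (u x) * \<phi> x) \<and>
        (LINT x|lebesgue_on U. (A x *v Du x) \<bullet> D\<phi> x) \<le> - (LINT x|lebesgue_on U. f (u x) * \<phi> x)"
      using g[OF \<phi>(1,2)] \<phi>(3) by simp
  qed
qed

section \<open>Chaining balls\<close>

lemma primitive_eq:
  assumes "0 \<le> s" shows "primitive f s = (LINT x|lborel. indicator {0<..<s} x * f x)"
proof -
  have "einterval (ereal 0) (ereal s) = {0<..<s}" by (auto simp: einterval_def)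
  then show ?thesis
    using assms by (simp add: primitive_def interval_lebesgue_integral_def set_lebesgue_integral_def)
qed

lemma integrable_indicator_Ioo: "integrable lborel (\<lambda>x. c * indicat_real {0<..<s::real} x)"
proof -
  have "bounded {0<..<s}" using bounded_box[of 0 s] by (simp add: box_real)
  then show ?thesis
    by (intro integrable_mult_right integrable_real_indicator emeasure_bounded_finite) auto
qed

lemma integrable_mono_Ioo:
  fixes f :: "real \<Rightarrow> real"
  assumes "mono f" "\<And>t. 0 \<le> f t"
  shows "integrable lborel (\<lambda>x. indicator {0<..<s} x * f x)"
proof (rule Bochner_Integration.integrable_bound)
  show "integrable lborel (\<lambda>x. f s * indicat_real {0<..<s} x)"
    by (rule integrable_indicator_Ioo)
  show "(\<lambda>x. indicator {0<..<s} x * f x) \<in> borel_measurable lborel"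
    using borel_measurable_mono[OF assms(1)] by measurable
  show "AE x in lborel. norm (indicator {0<..<s} x * f x) \<le> norm (f s * indicat_real {0<..<s} x)"
    using assms by (intro AE_I2) (auto simp: indicator_def abs_of_nonneg monoD)
qed

lemma primitive_le:
  assumes "mono f" "\<And>t. 0 \<le> f t" "0 \<le> s"
  shows "primitive f s \<le> s * f s"
proof -
  have "primitive f s \<le> (LINT x|lborel. f s * indicat_real {0<..<s} x)"
    unfolding primitive_eq[OF assms(3)]
  proof (rule integral_mono[OF integrable_mono_Ioo[OF assms(1,2)]])
    show "integrable lborel (\<lambda>x. f s * indicat_real {0<..<s} x)"
      by (rule integrable_indicator_Ioo)
    show "indicator {0<..<s} x * f x \<le> f s * indicat_real {0<..<s} x" for x
      using assms(1) by (auto simp: indicator_def monoD)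
  qed
  then show ?thesis using assms(3) by (simp add: mult.commute)
qed

text \<open>Measurability through monotonicity. Clamping at 0 keeps the primitive in the form of
  \<open>primitive_eq\<close>, and integrals over nonnegative t do not notice it.\<close>

lemma primitive_measurable:
  assumes "mono f" "\<And>t. 0 \<le> f t"
  shows "(\<lambda>t. primitive f (max 0 t)) \<in> borel_measurable borel"
proof (rule borel_measurable_mono[OF monoI])
  fix s t :: real assume "s \<le> t"
  have "(LINT x|lborel. indicator {0<..<max 0 s} x * f x) \<le> (LINT x|lborel. indicator {0<..<max 0 t} x * f x)"
    using \<open>s \<le> t\<close> assms(2) by (intro integral_mono integrable_mono_Ioo assms) (auto simp: indicator_def)
  then show "primitive f (max 0 s) \<le> primitive f (max 0 t)" by (simp add: primitive_eq)
qed

lemma inverse_sqrt_integral_mono: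
  assumes "a \<le> a'" "b' \<le> b" shows "inverse_sqrt_integral F a' b' \<le> inverse_sqrt_integral F a b"
  unfolding inverse_sqrt_integral_def
  using assms by (intro nn_integral_mono mult_left_mono) (auto simp: indicator_def)

text \<open>Two consecutive intervals may share the endpoint b = c, as happens in the chaining when
  the value exactly doubles; this point is a null set, even though the integrand may be infinite
  there.\<close>

lemma inverse_sqrt_integral_add_le:
  assumes f: "mono f" "\<And>t. 0 \<le> f t" and ab: "0 \<le> a" "a \<le> b" "b \<le> c" "c \<le> d"
  shows "inverse_sqrt_integral (primitive f) a b + inverse_sqrt_integral (primitive f) c d
    \<le> inverse_sqrt_integral (primitive f) a d"
proof -
  define h where "h t = 1 / ennreal (sqrt (primitive f (max 0 t)))" for t
  have [measurable]: "h \<in> borel_measurable borel"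
    unfolding h_def using primitive_measurable[OF f] by measurable
  have eq: "inverse_sqrt_integral (primitive f) a' b' = (\<integral>\<^sup>+t. h t * indicator {a'..b'} t \<partial>lborel)"
    if "0 \<le> a'" for a' b'
    unfolding inverse_sqrt_integral_def h_def using that
    by (intro nn_integral_cong) (auto simp: indicator_def)
  have "inverse_sqrt_integral (primitive f) a b + inverse_sqrt_integral (primitive f) c d
      = (\<integral>\<^sup>+t. h t * indicator {a..b} t + h t * indicator {c..d} t \<partial>lborel)"
    using ab by (simp add: eq nn_integral_add)
  also have "\<dots> \<le> (\<integral>\<^sup>+t. h t * indicator {a..d} t \<partial>lborel)"
  proof (rule nn_integral_mono_AE)
    show "AE t in lborel. h t * indicator {a..b} t + h t * indicator {c..d} t \<le> h t * indicator {a..d} t"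
      using AE_lborel_singleton[of b] by eventually_elim (use ab in \<open>auto simp: indicator_def\<close>)
  qed
  finally show ?thesis using ab by (simp add: eq)
qed

lemma inverse_sqrt_integral_ge:
  assumes ab: "a \<le> b" and K: "0 < K" and le: "\<And>s. a \<le> s \<Longrightarrow> s \<le> b \<Longrightarrow> F s \<le> K\<^sup>2"
  shows "ennreal ((b - a) / K) \<le> inverse_sqrt_integral F a b"
proof -
  have "ennreal ((b - a) / K) = (\<integral>\<^sup>+t. ennreal (1 / K) * indicator {a..b} t \<partial>lborel)"
    using ab K by (simp add: nn_integral_cmult flip: ennreal_mult)
  also have "\<dots> \<le> inverse_sqrt_integral F a b"
    unfolding inverse_sqrt_integral_def
  proof (rule nn_integral_mono)
    fix t
    show "ennreal (1 / K) * indicator {a..b} t \<le> 1 / ennreal (sqrt (F t)) * indicator {a..b} t"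
    proof (cases "t \<in> {a..b}")
      case True
      then have "sqrt (F t) \<le> sqrt (K\<^sup>2)" using le by (intro real_sqrt_le_mono) auto
      then have r: "sqrt (F t) \<le> K" using K by simp
      have "ennreal (1 / K) \<le> 1 / ennreal (sqrt (F t))"
      \<comment> \<open>If the root is not positive, the denominator becomes 0 in
        \<open>ennreal\<close> and the quotient infinite: the convention 1/sqrt 0 = infinity makes
        the bound hold here as well.\<close>
      proof (cases "0 < sqrt (F t)")
        case True
        then have "1 / ennreal (sqrt (F t)) = ennreal (1 / sqrt (F t))"
          using divide_ennreal[of 1 "sqrt (F t)"] by simp
        with True r show ?thesis by (simp add: ennreal_leI frac_le)
      qed (simp add: ennreal_neg not_less)
      then show ?thesis using True by simp
    qed simp
  qed
  finally show ?thesis .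
qed

text \<open>\<open>N\<close> bounds how often the value can still double without exceeding
  \<open>M\<close>; for N = 0 the hypotheses contradict u(y) <= M. Moving to the nearest doubling
  point z at distance r leaves the ball of radius \<rho> - r about z inside the old ball, and since
  u(z) >= 2 u(y) the intervals [u(y)/4, u(y)/2] and [u(z)/4, M] meet in at most one point. So radii
  and integrals add up together.\<close>

lemma doubling_chain:
  fixes u :: "'a::euclidean_space \<Rightarrow> real"
  assumes cont: "continuous_on U u" and c: "0 < c"
    and f: "mono f" "\<And>t. 0 \<le> f t"
    and step: "\<And>y \<rho>. ball y \<rho> \<subseteq> U \<Longrightarrow> 0 < \<rho> \<Longrightarrow> 0 < u y \<Longrightarrow> (\<And>x. x \<in> ball y \<rho> \<Longrightarrow> u x \<le> 2 * u y) \<Longrightarrow>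
      ennreal (c * \<rho>) \<le> inverse_sqrt_integral (primitive f) (u y / 4) (u y / 2)"
  shows "ball y \<rho> \<subseteq> U \<Longrightarrow> 0 < \<rho> \<Longrightarrow> 0 < u y \<Longrightarrow> (\<And>x. x \<in> ball y \<rho> \<Longrightarrow> u x \<le> M) \<Longrightarrow> M < 2 ^ N * u y \<Longrightarrow>
      ennreal (c * \<rho>) \<le> inverse_sqrt_integral (primitive f) (u y / 4) M"
proof (induction N arbitrary: y \<rho>)
  case 0
  have "u y \<le> M" using "0.prems"(2,4) by simp
  with "0.prems"(5) show ?case by simp
next
  case (Suc N)
  let ?J = "inverse_sqrt_integral (primitive f)"
  have tM: "u y \<le> M" using Suc.prems(2,4) by simp
  show ?case
  proof (cases "\<forall>x\<in>ball y \<rho>. u x \<le> 2 * u y")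
    case True
    then have "ennreal (c * \<rho>) \<le> ?J (u y / 4) (u y / 2)" using Suc.prems by (intro step) auto
    also have "\<dots> \<le> ?J (u y / 4) M"
      using tM Suc.prems(3) by (intro inverse_sqrt_integral_mono) auto
    finally show ?thesis .
  next
    case False
    then obtain x1 where x1: "dist y x1 < \<rho>" "2 * u y < u x1" by auto
    \<comment> \<open>Restricting to the closed ball through \<open>x1\<close> keeps the
      minimisation inside \<open>U\<close>, where continuity of \<open>u\<close> makes the set
      closed, and the nearest point found there is nearest in all of the ball of radius
      \<rho>.\<close>
    let ?K = "cball y (dist y x1) \<inter> {x \<in> cball y (dist y x1). 2 * u y \<le> u x}"
    have sub: "cball y (dist y x1) \<subseteq> ball y \<rho>" using x1(1) by auto
    have "continuous_on (cball y (dist y x1)) u"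
      using cont sub Suc.prems(1) by (meson continuous_on_subset order_trans)
    then have "closed {x \<in> cball y (dist y x1). 2 * u y \<le> u x}"
      by (intro continuous_on_closed_Collect_le continuous_intros) auto
    then have "closed ?K" by (intro closed_Int) auto
    moreover have "x1 \<in> ?K" using x1 by simp
    ultimately obtain z where z: "z \<in> ?K" "\<And>x. x \<in> ?K \<Longrightarrow> dist y z \<le> dist y x"
      using distance_attains_inf[of ?K y] by blast
    define r where "r = dist y z"
    have uz: "2 * u y \<le> u z" using z(1) by simp
    \<comment> \<open>Positivity holds because z differs from y: the value at z is at least twice
      the positive value at y.\<close>
    have r: "0 < r" "r < \<rho>" using z(1) x1 uz Suc.prems(3) by (auto simp: r_def)
    have br: "u x \<le> 2 * u y" if "x \<in> ball y r" for x
    proof (rule ccontr)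
      assume "\<not> ?thesis"
      moreover have "dist y x \<le> dist y x1" using that z(1) by (simp add: r_def)
      ultimately have "dist y z \<le> dist y x" by (intro z(2)) auto
      with that show False by (simp add: r_def)
    qed
    have "ball y r \<subseteq> U" using r Suc.prems(1) by (meson subset_ball less_imp_le order_trans)
    then have s1: "ennreal (c * r) \<le> ?J (u y / 4) (u y / 2)"
      using r Suc.prems(3) br by (intro step) auto
    have bz: "ball z (\<rho> - r) \<subseteq> ball y \<rho>"
    proof
      fix x assume "x \<in> ball z (\<rho> - r)"
      then show "x \<in> ball y \<rho>" using dist_triangle[of y x z] by (simp add: r_def)
    qed
    have s2: "ennreal (c * (\<rho> - r)) \<le> ?J (u z / 4) M"
    proof (rule Suc.IH)
      show "ball z (\<rho> - r) \<subseteq> U" using bz Suc.prems(1) by blast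
      show "u x \<le> M" if "x \<in> ball z (\<rho> - r)" for x using bz that Suc.prems(4) by blast
      have "2 ^ Suc N * u y \<le> 2 ^ N * u z" using mult_left_mono[OF uz, of "2 ^ N"] by (simp add: mult_ac)
      then show "M < 2 ^ N * u z" using Suc.prems(5) by linarith
    qed (use r uz Suc.prems(3) in auto)
    have "z \<in> ball y \<rho>" using r by (simp add: r_def)
    then have "u z \<le> M" by (rule Suc.prems(4))
    have "ennreal (c * \<rho>) = ennreal (c * r) + ennreal (c * (\<rho> - r))"
      using c r by (subst ennreal_plus[symmetric]) (auto simp: algebra_simps)
    also have "\<dots> \<le> ?J (u y / 4) (u y / 2) + ?J (u z / 4) M" using s1 s2 by (rule add_mono)
    also have "\<dots> \<le> ?J (u y / 4) M"
      using Suc.prems(3) uz \<open>u z \<le> M\<close> by (intro inverse_sqrt_integral_add_le f) auto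
    finally show ?thesis .
  qed
qed

theorem theorem1p2:
  fixes l L :: real
  assumes "0 < l" and "l \<le> L"
  shows "\<exists>c>0. \<forall>(A :: real ^ 'n \<Rightarrow> real ^ 'n ^ 'n) (f :: real \<Rightarrow> real) (x0 :: real ^ 'n) (R :: real)
           (u :: real ^ 'n \<Rightarrow> real).
      0 < R \<longrightarrow>
      elliptic_field l L (ball x0 (2 * R)) A \<longrightarrow>
      mono f \<longrightarrow> (\<forall>t. 0 \<le> f t) \<longrightarrow>
      u \<in> W12 (ball x0 (2 * R)) \<longrightarrow>
      continuous_on (ball x0 (2 * R)) u \<longrightarrow>
      (\<forall>x\<in>ball x0 (2 * R). 0 \<le> u x) \<longrightarrow>
      subsolution A f (ball x0 (2 * R)) u \<longrightarrow>
      0 < u x0 \<longrightarrow>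
      (let F = primitive f;
           M = (SUP x\<in>ball x0 R. u x);
           m = (INF x\<in>ball x0 R. u x)
       in inverse_sqrt_integral F (m / 4) M \<ge> ennreal (c * R))"
proof -
  \<comment> \<open>The constant of the growth estimate with its \<open>\<kappa>\<close> written
    out, which makes it visible before any choice of \<open>A\<close>, \<open>f\<close> or
    \<open>u\<close> that it depends on n, l and L alone.\<close>
  define K where "K = 64 * exp 1 * L / sqrt (l * exp (- 2) / (4096 * L * 2 ^ CARD('n))) ^ CARD('n)"
  \<comment> \<open>On [t/4, t/2] the growth estimate gives sqrt F <= sqrt K t/\<rho>, and the
    interval has length t/4; the quotient is \<rho>/(4 sqrt K).\<close>
  define c where "c = 1 / (4 * sqrt K)"
  have K: "0 < K" using assms by (simp add: K_def)
  then have c: "0 < c" by (simp add: c_def)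
  show ?thesis
  proof (intro exI[of _ c] conjI c allI impI)
    fix A :: "real ^ 'n \<Rightarrow> real ^ 'n ^ 'n" and f :: "real \<Rightarrow> real" and x0 :: "real ^ 'n" and R :: real
      and u :: "real ^ 'n \<Rightarrow> real"
    let ?U = "ball x0 (2 * R)"
    assume R: "0 < R" and ell: "elliptic_field l L ?U A" and f: "mono f" and "\<forall>t. 0 \<le> f t"
      and cont: "continuous_on ?U u" and "\<forall>x\<in>?U. 0 \<le> u x" and sub: "subsolution A f ?U u" and u0: "0 < u x0"
    then have f0: "\<And>t. 0 \<le> f t" and u_nonneg: "\<And>x. x \<in> ?U \<Longrightarrow> 0 \<le> u x" by auto
    from subsolution_borel_gradient[OF open_ball ell sub] obtain Du where
      Du: "Du \<in> borel_measurable borel" "has_W12_gradient ?U u Du"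
      and test: "\<And>\<phi> D\<phi>. \<phi> \<in> W12_0 ?U \<Longrightarrow> has_W12_gradient ?U \<phi> D\<phi> \<Longrightarrow> (\<And>x. 0 \<le> \<phi> x) \<Longrightarrow>
        integrable (lebesgue_on ?U) (\<lambda>x. f (u x) * \<phi> x) \<and>
        (LINT x|lebesgue_on ?U. (A x *v Du x) \<bullet> D\<phi> x) \<le> - (LINT x|lebesgue_on ?U. f (u x) * \<phi> x)"
      by blast
    have step: "ennreal (c * \<rho>) \<le> inverse_sqrt_integral (primitive f) (u y / 4) (u y / 2)"
      if y: "ball y \<rho> \<subseteq> ?U" "0 < \<rho>" "0 < u y" "\<And>x. x \<in> ball y \<rho> \<Longrightarrow> u x \<le> 2 * u y" for y \<rho>
    proof -
      interpret growth l L A f ?U u Du y \<rho> "u y"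
      proof
        show "0 \<le> u x" if "x \<in> ball y \<rho>" for x using that y(1) u_nonneg by blast
      qed (use assms ell f f0 Du cont y test in auto)
      define t where "t = u y"
      have bound: "f (t / 2) \<le> K * (t / \<rho>\<^sup>2)"
        using growth_bound by (simp add: K_def \<kappa>_def t_def)
      have t: "0 < t" using y(3) by (simp add: t_def)
      have "primitive f s \<le> (sqrt K * t / \<rho>)\<^sup>2" if s: "t / 4 \<le> s" "s \<le> t / 2" for s
      proof -
        have "primitive f s \<le> s * f s" using s t by (intro primitive_le f f0) auto
        also have "\<dots> \<le> t * f (t / 2)" using s t f f0 by (intro mult_mono monoD[OF f]) auto
        also have "\<dots> \<le> t * (K * (t / \<rho>\<^sup>2))" using bound t by (intro mult_left_mono) auto
        also have "\<dots> = (sqrt K * t / \<rho>)\<^sup>2" using K by (simp add: power_mult_distrib power_divide power2_eq_square)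
        finally show ?thesis .
      qed
      then have "ennreal ((t / 2 - t / 4) / (sqrt K * t / \<rho>)) \<le> inverse_sqrt_integral (primitive f) (t / 4) (t / 2)"
        using t K y(2) by (intro inverse_sqrt_integral_ge) auto
      moreover have "(t / 2 - t / 4) / (sqrt K * t / \<rho>) = c * \<rho>"
        using t K y(2) by (simp add: c_def field_simps)
      ultimately show ?thesis by (simp add: t_def)
    qed
    define M where "M = (SUP x\<in>ball x0 R. u x)"
    define m where "m = (INF x\<in>ball x0 R. u x)"
    \<comment> \<open>This is where the larger ball is used: u is continuous on the compact closed
      ball of radius R, so the real supremum \<open>M\<close> is a genuine upper bound.\<close>
    have sub_U: "cball x0 R \<subseteq> ?U" using R by auto
    then have ball_U: "ball x0 R \<subseteq> ?U" using ball_subset_cball by blast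
    have "compact (u ` cball x0 R)"
      by (intro compact_continuous_image continuous_on_subset[OF cont sub_U]) auto
    then have "bdd_above (u ` cball x0 R)" by (intro bounded_imp_bdd_above compact_imp_bounded)
    then have bdd: "bdd_above (u ` ball x0 R)" by (rule bdd_above_mono) auto
    have leM: "u x \<le> M" if "x \<in> ball x0 R" for x
      unfolding M_def by (rule cSUP_upper[OF that bdd])
    have "m \<le> u x0"
      unfolding m_def
    proof (rule cINF_lower)
      show "bdd_below (u ` ball x0 R)"
        using ball_U u_nonneg by (intro bdd_belowI[of _ 0]) blast
    qed (use R in simp)
    \<comment> \<open>Positivity of u at the centre is what bounds the number of doublings below
      \<open>M\<close>.\<close>
    obtain N where "M / u x0 < 2 ^ N" using real_arch_pow[of 2 "M / u x0"] by auto
    then have "M < 2 ^ N * u x0" using u0 by (simp add: divide_less_eq)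
    then have "ennreal (c * R) \<le> inverse_sqrt_integral (primitive f) (u x0 / 4) M"
      using R u0 by (intro doubling_chain[OF cont c f f0 step ball_U _ _ leM]) auto
    also have "\<dots> \<le> inverse_sqrt_integral (primitive f) (m / 4) M"
      using \<open>m \<le> u x0\<close> by (intro inverse_sqrt_integral_mono) auto
    finally show "let F = primitive f; M = (SUP x\<in>ball x0 R. u x); m = (INF x\<in>ball x0 R. u x)
       in inverse_sqrt_integral F (m / 4) M \<ge> ennreal (c * R)"
      by (simp add: M_def m_def)
  qed
qed

end
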